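(* For $i=1,2$ let $\mathcal{X}_i$ be a locally compact Hausdorff space and let $\eta_i:\mathcal{X}_i\to\mathcal{X}_i$ be a proper continuous map. Then the dynamical systems $(\mathcal{X}_1,\eta_1)$ and $(\mathcal{X}_2,\eta_2)$ are conjugate if and only if some topological conjugacy algebra for $(\mathcal{X}_1,\eta_1)$ is isomorphic as an algebra to some topological conjugacy algebra for $(\mathcal{X}_2,\eta_2)$.
   Context: Systems $(\mathcal{X}_1,\eta_1)$, $(\mathcal{X}_2,\eta_2)$ are conjugate if there is a homeomorphism $\gamma_s:\mathcal{X}_1\to\mathcal{X}_2$ with $\gamma_s\circ\eta_1=\eta_2\circ\gamma_s$. "Isomorphic as algebras" means there is a bijective complex algebra homomorphism; no continuity is assumed. Compact case. Let $\mathcal{X}$ be compact Hausdorff and $\eta:\mathcal{X}\to\mathcal{X}$ continuous. The skew polynomial algebra $P(\mathcal{X},\eta)$ consists of all polynomials $\sum_n f_nU^n$, $f_n\in C(\mathcal{X})$, with multiplication determined by $Uf=(f\circ\eta)U$. A topological conjugacy algebra for $(\mathcal{X},\eta)$ is a complex Banach algebra $\mathcal{A}$ such that: (1) $P(\mathcal{X},\eta)$ is contained in $\mathcal{A}$ as a dense subalgebra and the constant function $1$ is the identity of $\mathcal{A}$; (2) $C(\mathcal{X})\subseteq\mathcal{A}$ is closed and there is an algebra homomorphism $E_0:\mathcal{A}\to C(\mathcal{X})$ with $E_0(f)=f$ for all $f\in C(\mathcal{X})$ and $\ker E_0=\mathcal{A}U$; (3) $U$ is not a right divisor of $0$ (i.e.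 $aU=0$ implies $a=0$); (4) $\limsup_n(\|E_n\|\,\|U^n\|)^{1/n}\le 1$, where the coefficient maps $E_n:\mathcal{A}\to C(\mathcal{X})$ (automatically bounded) are defined inductively as follows: each $a\in\mathcal{A}$ can be written uniquely as $a=E_0(a)+bU$ with $b\in\mathcal{A}$, and $E_{n+1}(a)=E_n(b)$ for $n\ge 0$. Non-compact case. Let $\mathcal{X}$ be a non-compact locally compact Hausdorff space, $\eta$ a proper continuous self-map, $\hat{\mathcal{X}}=\mathcal{X}\cup\{\omega\}$ the one-point compactification, $\hat\eta$ the continuous extension of $\eta$ to $\hat{\mathcal X}$ fixing $\omega$, and identify $C_0(\mathcal{X})$ with the functions in $C(\hat{\mathcal{X}})$ vanishing at $\omega$. A topological conjugacy algebra for $(\mathcal{X},\eta)$ is the norm closed subalgebra $\mathcal{A}$ of some topological conjugacy algebra $\hat{\mathcal{A}}$ for $(\hat{\mathcal{X}},\hat\eta)$ generated by the polynomials $\sum_n f_nU^n$ with coefficients $f_n\in C_0(\mathcal{X})$. *)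

theory Defs
  imports "HOL-Analysis.Analysis" "HOL-Algebra.Module"
begin

section \<open>Complex Banach algebras with explicit carrier\<close>

text \<open>
  Algebras are records with a carrier set, because the theorem quantifies existentially over
  algebras. The field \<open>one\<close> of the record is irrelevant for algebras without identity.
\<close>

definition complex_ring :: "complex ring" where
  "complex_ring = \<lparr>carrier = UNIV, mult = (*), one = 1, zero = 0, add = (+)\<rparr>"

record 'c normed_alg = "(complex, 'c) module" +
  nrm :: "'c \<Rightarrow> real"

text \<open>
  The distance is set to \<open>0\<close> off the carrier since the locale \<open>Metric_space\<close> demands symmetry
  and nonnegativity of the distance on the whole type.
\<close>

definition alg_dist :: "'c normed_alg \<Rightarrow> 'c \<Rightarrow> 'c \<Rightarrow> real" where
  "alg_dist A x y =
    (if x \<in> carrier A \<and> y \<in> carrier A then nrm A (x \<ominus>\<^bsub>A\<^esub> y) else 0)"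

definition norm_topology :: "'c normed_alg \<Rightarrow> 'c topology" where
  "norm_topology A = Metric_space.mtopology (carrier A) (alg_dist A)"

text \<open>No normalisation of the norm of the identity is imposed.\<close>

locale complex_banach_algebra =
  fixes A :: "'c normed_alg"
  assumes ring: "ring A"
    and module: "Module.module complex_ring A"
    and smult_mult_left: "\<And>c x y. \<lbrakk>x \<in> carrier A; y \<in> carrier A\<rbrakk> \<Longrightarrow>
          (c \<odot>\<^bsub>A\<^esub> x) \<otimes>\<^bsub>A\<^esub> y = c \<odot>\<^bsub>A\<^esub> (x \<otimes>\<^bsub>A\<^esub> y)"
    and smult_mult_right: "\<And>c x y. \<lbrakk>x \<in> carrier A; y \<in> carrier A\<rbrakk> \<Longrightarrow>
          x \<otimes>\<^bsub>A\<^esub> (c \<odot>\<^bsub>A\<^esub> y) = c \<odot>\<^bsub>A\<^esub> (x \<otimes>\<^bsub>A\<^esub> y)"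
    and nrm_nonneg: "\<And>x. x \<in> carrier A \<Longrightarrow> 0 \<le> nrm A x"
    and nrm_eq_zero: "\<And>x. x \<in> carrier A \<Longrightarrow> nrm A x = 0 \<longleftrightarrow> x = \<zero>\<^bsub>A\<^esub>"
    and nrm_add: "\<And>x y. \<lbrakk>x \<in> carrier A; y \<in> carrier A\<rbrakk> \<Longrightarrow>
          nrm A (x \<oplus>\<^bsub>A\<^esub> y) \<le> nrm A x + nrm A y"
    and nrm_smult: "\<And>c x. x \<in> carrier A \<Longrightarrow> nrm A (c \<odot>\<^bsub>A\<^esub> x) = cmod c * nrm A x"
    and nrm_mult: "\<And>x y. \<lbrakk>x \<in> carrier A; y \<in> carrier A\<rbrakk> \<Longrightarrow>
          nrm A (x \<otimes>\<^bsub>A\<^esub> y) \<le> nrm A x * nrm A y"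
    and complete: "Metric_space.mcomplete (carrier A) (alg_dist A)"

text \<open>Homomorphisms of complex algebras; preservation of identities is not required.\<close>

definition alg_hom ::
  "(complex, 'c, 'm) module_scheme \<Rightarrow> (complex, 'd, 'n) module_scheme \<Rightarrow> ('c \<Rightarrow> 'd) set" where
  "alg_hom A B = {\<phi> \<in> carrier A \<rightarrow> carrier B.
     (\<forall>x\<in>carrier A. \<forall>y\<in>carrier A. \<phi> (x \<oplus>\<^bsub>A\<^esub> y) = \<phi> x \<oplus>\<^bsub>B\<^esub> \<phi> y) \<and>
     (\<forall>x\<in>carrier A. \<forall>y\<in>carrier A. \<phi> (x \<otimes>\<^bsub>A\<^esub> y) = \<phi> x \<otimes>\<^bsub>B\<^esub> \<phi> y) \<and>
     (\<forall>c. \<forall>x\<in>carrier A. \<phi> (c \<odot>\<^bsub>A\<^esub> x) = c \<odot>\<^bsub>B\<^esub> \<phi> x)}"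

definition alg_isomorphic ::
  "(complex, 'c, 'm) module_scheme \<Rightarrow> (complex, 'd, 'n) module_scheme \<Rightarrow> bool" where
  "alg_isomorphic A B \<longleftrightarrow> (\<exists>\<phi> \<in> alg_hom A B. bij_betw \<phi> (carrier A) (carrier B))"

definition is_subalgebra :: "'c set \<Rightarrow> (complex, 'c, 'm) module_scheme \<Rightarrow> bool" where
  "is_subalgebra S A \<longleftrightarrow> S \<subseteq> carrier A \<and> \<zero>\<^bsub>A\<^esub> \<in> S \<and>
     (\<forall>x\<in>S. \<forall>y\<in>S. x \<oplus>\<^bsub>A\<^esub> y \<in> S) \<and>
     (\<forall>x\<in>S. \<forall>y\<in>S. x \<otimes>\<^bsub>A\<^esub> y \<in> S) \<and>
     (\<forall>c. \<forall>x\<in>S. c \<odot>\<^bsub>A\<^esub> x \<in> S)"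

definition closed_subalgebra_generated :: "'c normed_alg \<Rightarrow> 'c set \<Rightarrow> 'c set" where
  "closed_subalgebra_generated A G =
     \<Inter>{S. is_subalgebra S A \<and> closedin (norm_topology A) S \<and> G \<subseteq> S}"


section \<open>Continuous functions and skew polynomials\<close>

text \<open>
  A function on the space \<open>X\<close> is represented by its extension by \<open>0\<close> to the whole type, so
  that equality of functions is equality on \<open>topspace X\<close>.
\<close>

definition cont_alg :: "'a topology \<Rightarrow> (complex, 'a \<Rightarrow> complex) module" where
  "cont_alg X =
    \<lparr>carrier = {f. continuous_map X euclidean f \<and> (\<forall>x. x \<notin> topspace X \<longrightarrow> f x = 0)},
     mult = (\<lambda>f g x. f x * g x),
     one = (\<lambda>x. if x \<in> topspace X then 1 else 0),
     zero = (\<lambda>x. 0),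
     add = (\<lambda>f g x. f x + g x),
     smult = (\<lambda>c f x. c * f x)\<rparr>"

text \<open>The \<open>0\<close> in the set makes the supremum norm well behaved on the empty space.\<close>

definition sup_norm :: "'a topology \<Rightarrow> ('a \<Rightarrow> complex) \<Rightarrow> real" where
  "sup_norm X f = Sup (insert 0 ((\<lambda>x. cmod (f x)) ` topspace X))"

text \<open>
  The polynomial \<open>\<Sum>n. f\<^sub>n U\<^sup>n\<close> is represented by its coefficient sequence. The product is
  forced by \<open>U f = (f \<circ> \<eta>) U\<close>, i.e. \<open>(f U\<^sup>k) (g U\<^sup>m) = f (g \<circ> \<eta>\<^sup>k) U\<^sup>k\<^sup>+\<^sup>m\<close>.
\<close>

definition skew_poly_alg ::
  "'a topology \<Rightarrow> ('a \<Rightarrow> 'a) \<Rightarrow> (complex, nat \<Rightarrow> 'a \<Rightarrow> complex) module" where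
  "skew_poly_alg X \<eta> =
    \<lparr>carrier = {p. (\<forall>n. p n \<in> carrier (cont_alg X)) \<and> finite {n. p n \<noteq> (\<lambda>x. 0)}},
     mult = (\<lambda>p q n x. \<Sum>k\<le>n. p k x * q (n - k) ((\<eta> ^^ k) x)),
     one = (\<lambda>n x. if n = 0 \<and> x \<in> topspace X then 1 else 0),
     zero = (\<lambda>n x. 0),
     add = (\<lambda>p q n x. p n x + q n x),
     smult = (\<lambda>c p n x. c * p n x)\<rparr>"

text \<open>The monomial \<open>f U\<^sup>n\<close>.\<close>

definition skew_monom :: "nat \<Rightarrow> ('a \<Rightarrow> complex) \<Rightarrow> nat \<Rightarrow> 'a \<Rightarrow> complex" where
  "skew_monom n f = (\<lambda>m x. if m = n then f x else 0)"

definition skew_U :: "'a topology \<Rightarrow> nat \<Rightarrow> 'a \<Rightarrow> complex" where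
  "skew_U X = skew_monom 1 \<one>\<^bsub>cont_alg X\<^esub>"

lemma skew_U_covariance:
  assumes "f \<in> carrier (cont_alg X)"
  shows "skew_U X \<otimes>\<^bsub>skew_poly_alg X \<eta>\<^esub> skew_monom 0 f =
    skew_monom 0 (\<lambda>x. if x \<in> topspace X then f (\<eta> x) else 0)
      \<otimes>\<^bsub>skew_poly_alg X \<eta>\<^esub> skew_U X"
proof (intro ext)
  fix n x
  have "(\<Sum>k\<le>n. (if k = 1 then c else 0) * (if n - k = 0 then f ((\<eta> ^^ k) x) else 0)) =
        (if n = 1 then c * f (\<eta> x) else 0)" for c :: complex
    by (subst sum.mono_neutral_right[where S = "{..n} \<inter> {1}"]) (cases n, auto)
  moreover have "(\<Sum>k\<le>n. (if k = 0 then d else 0) *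
        (if n - k = 1 then (if (\<eta> ^^ k) x \<in> topspace X then 1 else 0) else 0)) =
        (if n = 1 then (if x \<in> topspace X then d else 0) else 0)" for d :: complex
    by (subst sum.mono_neutral_right[where S = "{0}"]) auto
  ultimately show "(skew_U X \<otimes>\<^bsub>skew_poly_alg X \<eta>\<^esub> skew_monom 0 f) n x =
    (skew_monom 0 (\<lambda>x. if x \<in> topspace X then f (\<eta> x) else 0)
      \<otimes>\<^bsub>skew_poly_alg X \<eta>\<^esub> skew_U X) n x"
    by (simp add: skew_U_def skew_monom_def skew_poly_alg_def cont_alg_def)
qed


section \<open>Topological conjugacy algebras\<close>

text \<open>
  In the following, \<open>\<iota>\<close> is the inclusion of the skew polynomials in the algebra \<open>A\<close>. The
  coefficient maps are determined by \<open>E\<^sub>0\<close>: if \<open>a = E\<^sub>0(a) + b U\<close>, then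
  \<open>E\<^sub>n\<^sub>+\<^sub>1(a) = E\<^sub>n(b)\<close>.
\<close>

primrec coeff_map :: "'a topology \<Rightarrow> 'c normed_alg \<Rightarrow> ((nat \<Rightarrow> 'a \<Rightarrow> complex) \<Rightarrow> 'c) \<Rightarrow>
    ('c \<Rightarrow> 'a \<Rightarrow> complex) \<Rightarrow> nat \<Rightarrow> 'c \<Rightarrow> 'a \<Rightarrow> complex" where
  "coeff_map X A \<iota> E0 0 = E0"
| "coeff_map X A \<iota> E0 (Suc n) = (\<lambda>a. coeff_map X A \<iota> E0 n
     (THE b. b \<in> carrier A \<and>
        a = \<iota> (skew_monom 0 (E0 a)) \<oplus>\<^bsub>A\<^esub> (b \<otimes>\<^bsub>A\<^esub> \<iota> (skew_U X))))"

text \<open>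
  Operator norm of a map from \<open>A\<close> to \<open>C(X)\<close> with the supremum norm; as in \<^const>\<open>onorm\<close>, the
  quotient \<open>0 / 0\<close> is \<open>0\<close>. On the closed subspace \<open>C(X)\<close> of \<open>A\<close> the norm of \<open>A\<close> is
  equivalent to the supremum norm, and the constants disappear in the limit superior below.
\<close>

definition coeff_onorm :: "'a topology \<Rightarrow> 'c normed_alg \<Rightarrow> ('c \<Rightarrow> 'a \<Rightarrow> complex) \<Rightarrow> real" where
  "coeff_onorm X A E = (SUP a\<in>carrier A. sup_norm X (E a) / nrm A a)"

locale compact_conjugacy_algebra = complex_banach_algebra A
  for X :: "'a topology" and \<eta> :: "'a \<Rightarrow> 'a" and A :: "'c normed_alg"
    and \<iota> :: "(nat \<Rightarrow> 'a \<Rightarrow> complex) \<Rightarrow> 'c" and E0 :: "'c \<Rightarrow> 'a \<Rightarrow> complex" +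
  assumes compact: "compact_space X"
    and Hausdorff: "Hausdorff_space X"
    and continuous: "continuous_map X X \<eta>"
    and incl_hom: "\<iota> \<in> alg_hom (skew_poly_alg X \<eta>) A"
    and incl_inj: "inj_on \<iota> (carrier (skew_poly_alg X \<eta>))"
    and incl_dense: "norm_topology A closure_of (\<iota> ` carrier (skew_poly_alg X \<eta>)) = carrier A"
    and incl_one: "\<iota> \<one>\<^bsub>skew_poly_alg X \<eta>\<^esub> = \<one>\<^bsub>A\<^esub>"
    and cont_closed:
      "closedin (norm_topology A) ((\<lambda>f. \<iota> (skew_monom 0 f)) ` carrier (cont_alg X))"
    and E0_hom: "E0 \<in> alg_hom A (cont_alg X)"
    and E0_cont: "\<And>f. f \<in> carrier (cont_alg X) \<Longrightarrow> E0 (\<iota> (skew_monom 0 f)) = f"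
    and E0_kernel: "{a \<in> carrier A. E0 a = \<zero>\<^bsub>cont_alg X\<^esub>} =
      (\<lambda>b. b \<otimes>\<^bsub>A\<^esub> \<iota> (skew_U X)) ` carrier A"
    and U_right_regular:
      "\<And>a. \<lbrakk>a \<in> carrier A; a \<otimes>\<^bsub>A\<^esub> \<iota> (skew_U X) = \<zero>\<^bsub>A\<^esub>\<rbrakk> \<Longrightarrow> a = \<zero>\<^bsub>A\<^esub>"
    and limsup_coeff:
      "limsup (\<lambda>n. ereal (root n (coeff_onorm X A (coeff_map X A \<iota> E0 n) *
          nrm A (\<iota> (skew_U X) [^]\<^bsub>A\<^esub> n)))) \<le> 1"

text \<open>
  In the non-compact case the one-point compactification adjoins the point \<open>None\<close>,
  \<open>map_option \<eta>\<close> is the extension of \<open>\<eta>\<close> fixing it, and \<open>C\<^sub>0(X)\<close> consists of the continuous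
  functions on the compactification that vanish at \<open>None\<close>.
\<close>

definition vanishing_polys ::
  "'a topology \<Rightarrow> ('a \<Rightarrow> 'a) \<Rightarrow> (nat \<Rightarrow> 'a option \<Rightarrow> complex) set" where
  "vanishing_polys X \<eta> =
    {p \<in> carrier (skew_poly_alg (Alexandroff_compactification X) (map_option \<eta>)).
       \<forall>n. p n None = 0}"

definition topological_conjugacy_algebra ::
  "'a topology \<Rightarrow> ('a \<Rightarrow> 'a) \<Rightarrow> 'c normed_alg \<Rightarrow> bool" where
  "topological_conjugacy_algebra X \<eta> A \<longleftrightarrow>
    (if compact_space X
     then \<exists>\<iota> E0. compact_conjugacy_algebra X \<eta> A \<iota> E0
     else \<exists>B \<iota> E0.
       compact_conjugacy_algebra (Alexandroff_compactification X) (map_option \<eta>) B \<iota> E0 \<and>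
       A = B\<lparr>carrier := closed_subalgebra_generated B (\<iota> ` vanishing_polys X \<eta>)\<rparr>)"

definition conjugate_systems ::
  "'a topology \<Rightarrow> ('a \<Rightarrow> 'a) \<Rightarrow> 'b topology \<Rightarrow> ('b \<Rightarrow> 'b) \<Rightarrow> bool" where
  "conjugate_systems X \<eta> Y \<theta> \<longleftrightarrow>
    (\<exists>\<gamma>. homeomorphic_map X Y \<gamma> \<and> (\<forall>x\<in>topspace X. \<gamma> (\<eta> x) = \<theta> (\<gamma> x)))"

text \<open>
  HOL cannot quantify existentially over types, so the existence of algebras is asserted on a
  type that is large enough for all of them: every element of a topological conjugacy algebra
  (in the non-compact case, of the algebra for the compactification) is the limit of a sequence
  of skew polynomials. Choosing such a sequence for each element maps the algebra injectively to
  the following type, so every topological conjugacy algebra for a system on a space with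
  points in \<open>'a\<close> has an isomorphic copy with carrier in this type.
\<close>

type_synonym 'a seq_carrier = "nat \<Rightarrow> nat \<Rightarrow> 'a option \<Rightarrow> complex"

end

(* A homomorphism from a conjugacy algebra to the complex numbers restricts to evaluation at a point x
   on functions, and if x is not fixed by eta it is determined by x. Over a fixed point, the characters
   form a disc, given by the power series a |-> sum E_n(a)(x) z^n in its interior. An algebra isomorphism
   carries characters to characters, and maps fibres to fibres because, by induction on n, the functional
   f |-> E_n(psi(f))(x) is a point derivation on functions and hence zero for n > 0. This gives the
   homeomorphism, which is continuous since f(gamma(x)) = E_0(psi(f))(x). It intertwines the maps, since
   x and eta(x) are distinguished among all pairs of distinct points by having, for a suitable character
   theta' over eta(x), a functional D with D(ab) = E_0(a)(x) D(b) + D(a) theta'(b) which is not a multiple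
   of the difference of the characters. In the non-compact case the algebra is a closed ideal of the
   algebra of the compactification, to which its characters extend. *)
theory Submission
  imports Defs "HOL-Complex_Analysis.Conformal_Mappings"
begin

text \<open>The main obstacle is the choice of \<open>\<theta>'\<close>. The functional
  \<open>D\<close> is a power series evaluated at \<open>\<theta>' U\<close>, and on the boundary of
  the disc of characters such a series may diverge. So \<open>\<theta>'\<close> must be an interior
  character. It is taken to be the transport of evaluation by \<open>E_0\<close> at the dual point:
  in coordinates the isomorphism is an injective holomorphic map on the disc over that point, its
  image is open, and the image of the centre is therefore interior.

  In the non-compact case neither \<open>U\<close> nor the identity lies in the algebra. Products
  \<open>g U\<close> with \<open>g\<close> equal to 1 at the point in question replace
  \<open>U\<close>, and factorizations of functions replace the identity. Both cases are treated at
  once as the ideal given by a closed set \<open>K\<close>, which is empty or the point at infinity.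

  From conjugate systems to isomorphic algebras: the absolutely summable skew power series form a
  conjugacy algebra, and pulling back coefficients along a conjugacy is an isomorphism between two
  of these.\<close>

section \<open>Complex Banach algebras\<close>

context complex_banach_algebra
begin

sublocale alg: ring A
  by (rule ring)

sublocale mod: module complex_ring A
  by (rule module)

lemma smult_closed [simp, intro]: "x \<in> carrier A \<Longrightarrow> c \<odot>\<^bsub>A\<^esub> x \<in> carrier A"
  using mod.smult_closed[of c x] by (simp add: complex_ring_def)

lemma smult_left_distrib:
  "x \<in> carrier A \<Longrightarrow> (c + d) \<odot>\<^bsub>A\<^esub> x = c \<odot>\<^bsub>A\<^esub> x \<oplus>\<^bsub>A\<^esub> d \<odot>\<^bsub>A\<^esub> x"
  using mod.smult_l_distr[of c d x] by (simp add: complex_ring_def)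

lemma smult_right_distrib:
  "x \<in> carrier A \<Longrightarrow> y \<in> carrier A \<Longrightarrow> c \<odot>\<^bsub>A\<^esub> (x \<oplus>\<^bsub>A\<^esub> y) = c \<odot>\<^bsub>A\<^esub> x \<oplus>\<^bsub>A\<^esub> c \<odot>\<^bsub>A\<^esub> y"
  using mod.smult_r_distr[of c x y] by (simp add: complex_ring_def)

lemma smult_smult: "x \<in> carrier A \<Longrightarrow> c \<odot>\<^bsub>A\<^esub> (d \<odot>\<^bsub>A\<^esub> x) = (c * d) \<odot>\<^bsub>A\<^esub> x"
  using mod.smult_assoc1[of c d x] by (simp add: complex_ring_def)

lemma smult_1 [simp]: "x \<in> carrier A \<Longrightarrow> 1 \<odot>\<^bsub>A\<^esub> x = x"
  using mod.smult_one[of x] by (simp add: complex_ring_def)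

lemma smult_0 [simp]: "x \<in> carrier A \<Longrightarrow> 0 \<odot>\<^bsub>A\<^esub> x = \<zero>\<^bsub>A\<^esub>"
  using mod.smult_l_null[of x] by (simp add: complex_ring_def)

lemma smult_zero [simp]: "c \<odot>\<^bsub>A\<^esub> \<zero>\<^bsub>A\<^esub> = \<zero>\<^bsub>A\<^esub>"
  using mod.smult_r_null[of c] by (simp add: complex_ring_def)

lemma add_minus_cancel:
  "x \<in> carrier A \<Longrightarrow> y \<in> carrier A \<Longrightarrow> (x \<oplus>\<^bsub>A\<^esub> y) \<ominus>\<^bsub>A\<^esub> x = y"
  by (subst alg.a_comm) (simp_all add: a_minus_def alg.a_assoc alg.r_neg)

lemma smult_minus1: "x \<in> carrier A \<Longrightarrow> (-1) \<odot>\<^bsub>A\<^esub> x = \<ominus>\<^bsub>A\<^esub> x"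
  by (metis add.right_inverse alg.add.inv_equality alg.add.m_comm smult_0 smult_1 smult_closed
      smult_left_distrib)

lemma smult_uminus: "x \<in> carrier A \<Longrightarrow> c \<odot>\<^bsub>A\<^esub> (\<ominus>\<^bsub>A\<^esub> x) = \<ominus>\<^bsub>A\<^esub> (c \<odot>\<^bsub>A\<^esub> x)"
  by (simp flip: smult_minus1 add: smult_smult)

lemma smult_minus:
  "x \<in> carrier A \<Longrightarrow> y \<in> carrier A \<Longrightarrow> c \<odot>\<^bsub>A\<^esub> (x \<ominus>\<^bsub>A\<^esub> y) = c \<odot>\<^bsub>A\<^esub> x \<ominus>\<^bsub>A\<^esub> c \<odot>\<^bsub>A\<^esub> y"
  by (simp add: a_minus_def smult_right_distrib smult_uminus)

lemma nrm_zero [simp]: "nrm A \<zero>\<^bsub>A\<^esub> = 0"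
  by (simp add: nrm_eq_zero)

lemma nrm_uminus [simp]: "x \<in> carrier A \<Longrightarrow> nrm A (\<ominus>\<^bsub>A\<^esub> x) = nrm A x"
  by (simp flip: smult_minus1 add: nrm_smult)

lemma nrm_minus_commute:
  assumes "x \<in> carrier A" "y \<in> carrier A"
  shows "nrm A (x \<ominus>\<^bsub>A\<^esub> y) = nrm A (y \<ominus>\<^bsub>A\<^esub> x)"
proof -
  have "y \<ominus>\<^bsub>A\<^esub> x = \<ominus>\<^bsub>A\<^esub> (x \<ominus>\<^bsub>A\<^esub> y)"
    using assms by (simp add: alg.ring_simprules)
  then show ?thesis
    using assms by simp
qed

lemma nrm_diff_triangle:
  assumes "x \<in> carrier A" "y \<in> carrier A" "z \<in> carrier A"
  shows "nrm A (x \<ominus>\<^bsub>A\<^esub> z) \<le> nrm A (x \<ominus>\<^bsub>A\<^esub> y) + nrm A (y \<ominus>\<^bsub>A\<^esub> z)"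
proof -
  have "x \<ominus>\<^bsub>A\<^esub> z = (x \<ominus>\<^bsub>A\<^esub> y) \<oplus>\<^bsub>A\<^esub> (y \<ominus>\<^bsub>A\<^esub> z)"
    using assms by (simp add: alg.ring_simprules)
  then show ?thesis
    using assms by (metis alg.minus_closed nrm_add)
qed

lemma nrm_minus_le:
  assumes "x \<in> carrier A" "y \<in> carrier A"
  shows "nrm A (x \<ominus>\<^bsub>A\<^esub> y) \<le> nrm A x + nrm A y"
  using nrm_add[of x "\<ominus>\<^bsub>A\<^esub> y"] assms by (simp add: a_minus_def)

lemma nrm_le_minus:
  assumes "x \<in> carrier A" "y \<in> carrier A"
  shows "nrm A x \<le> nrm A y + nrm A (x \<ominus>\<^bsub>A\<^esub> y)"
proof -
  have "x = y \<oplus>\<^bsub>A\<^esub> (x \<ominus>\<^bsub>A\<^esub> y)"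
    using assms by (simp add: alg.ring_simprules)
  then show ?thesis
    using assms by (metis alg.minus_closed nrm_add)
qed

lemma minus_eq_zero_iff:
  assumes "x \<in> carrier A" "y \<in> carrier A"
  shows "x \<ominus>\<^bsub>A\<^esub> y = \<zero>\<^bsub>A\<^esub> \<longleftrightarrow> x = y"
proof
  assume 0: "x \<ominus>\<^bsub>A\<^esub> y = \<zero>\<^bsub>A\<^esub>"
  have "x = y \<oplus>\<^bsub>A\<^esub> (x \<ominus>\<^bsub>A\<^esub> y)"
    using assms by (simp add: alg.ring_simprules)
  then show "x = y"
    using 0 assms by simp
qed (use assms in \<open>simp add: a_minus_def alg.r_neg\<close>)

sublocale metric: Metric_space "carrier A" "alg_dist A"
proof
  show "alg_dist A x y = alg_dist A y x" for x y
    by (simp add: alg_dist_def nrm_minus_commute)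
qed (auto simp: alg_dist_def nrm_nonneg nrm_eq_zero minus_eq_zero_iff nrm_diff_triangle)

lemma dist_eq: "x \<in> carrier A \<Longrightarrow> y \<in> carrier A \<Longrightarrow> alg_dist A x y = nrm A (x \<ominus>\<^bsub>A\<^esub> y)"
  by (simp add: alg_dist_def)

lemma topspace_norm_topology [simp]: "topspace (norm_topology A) = carrier A"
  by (simp add: norm_topology_def)

lemma in_closure_of_iff:
  assumes "S \<subseteq> carrier A"
  shows "a \<in> norm_topology A closure_of S \<longleftrightarrow>
    a \<in> carrier A \<and> (\<forall>e>0. \<exists>s\<in>S. nrm A (a \<ominus>\<^bsub>A\<^esub> s) < e)"
  using assms unfolding norm_topology_def metric.metric_closure_of
  by (simp add: subset_iff) (metis dist_eq zero_less_one)

lemma closedin_iff: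
  "closedin (norm_topology A) S \<longleftrightarrow> S \<subseteq> carrier A \<and>
    (\<forall>a\<in>carrier A. (\<forall>e>0. \<exists>s\<in>S. nrm A (a \<ominus>\<^bsub>A\<^esub> s) < e) \<longrightarrow> a \<in> S)" (is "?l = ?r")
proof
  assume ?l
  then have "S \<subseteq> carrier A" "norm_topology A closure_of S = S"
    using closedin_subset[of "norm_topology A" S] by (auto simp: closure_of_closedin)
  then show ?r
    using in_closure_of_iff by blast
next
  assume r: ?r
  then have "norm_topology A closure_of S \<subseteq> S"
    using in_closure_of_iff[of S] by blast
  then show ?l
    using r by (metis closure_of_eq closure_of_subset subset_antisym topspace_norm_topology)
qed

text \<open>Translations, scalings and multiplications by a fixed element satisfy such a bound, so
  that closures can be shown to be ideals one variable at a time.\<close>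

lemma closure_of_Lipschitz_image:
  assumes S: "S \<subseteq> carrier A" and W: "W \<subseteq> carrier A"
    and T: "\<And>x. x \<in> carrier A \<Longrightarrow> T x \<in> carrier A"
    and Lipschitz: "\<And>x y. x \<in> carrier A \<Longrightarrow> y \<in> carrier A \<Longrightarrow>
      nrm A (T x \<ominus>\<^bsub>A\<^esub> T y) \<le> L * nrm A (x \<ominus>\<^bsub>A\<^esub> y)"
    and image: "\<And>s. s \<in> S \<Longrightarrow> T s \<in> norm_topology A closure_of W"
    and a: "a \<in> norm_topology A closure_of S"
  shows "T a \<in> norm_topology A closure_of W"
proof -
  have a': "a \<in> carrier A" and approx: "\<forall>e>0. \<exists>s\<in>S. nrm A (a \<ominus>\<^bsub>A\<^esub> s) < e"
    using a in_closure_of_iff[OF S, of a] by auto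
  have "\<exists>w\<in>norm_topology A closure_of W. nrm A (T a \<ominus>\<^bsub>A\<^esub> w) < e" if e: "e > 0" for e
  proof -
    \<comment> \<open>\<open>L\<close> may be zero or negative, hence the divisor
      \<open>\<bar>L\<bar> + 1\<close>.\<close>
    have "e / (\<bar>L\<bar> + 1) > 0"
      using e by (simp add: add_nonneg_pos)
    then obtain s where s: "s \<in> S" "nrm A (a \<ominus>\<^bsub>A\<^esub> s) < e / (\<bar>L\<bar> + 1)"
      using approx by blast
    have s': "s \<in> carrier A"
      using s S by auto
    have "nrm A (T a \<ominus>\<^bsub>A\<^esub> T s) \<le> L * nrm A (a \<ominus>\<^bsub>A\<^esub> s)"
      using Lipschitz a' s' .
    also have "\<dots> \<le> (\<bar>L\<bar> + 1) * nrm A (a \<ominus>\<^bsub>A\<^esub> s)"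
      using a' s' by (intro mult_right_mono) (auto simp: nrm_nonneg)
    also have "\<dots> < e"
      using s(2) by (simp add: pos_less_divide_eq mult.commute add_nonneg_pos)
    finally show ?thesis
      using image[OF s(1)] by blast
  qed
  then show ?thesis
    using closedin_iff[of "norm_topology A closure_of W"] T[OF a'] by auto
qed

lemma mult_left_Lipschitz:
  assumes "a \<in> carrier A" "x \<in> carrier A" "y \<in> carrier A"
  shows "nrm A (a \<otimes>\<^bsub>A\<^esub> x \<ominus>\<^bsub>A\<^esub> a \<otimes>\<^bsub>A\<^esub> y) \<le> nrm A a * nrm A (x \<ominus>\<^bsub>A\<^esub> y)"
proof -
  have "a \<otimes>\<^bsub>A\<^esub> x \<ominus>\<^bsub>A\<^esub> a \<otimes>\<^bsub>A\<^esub> y = a \<otimes>\<^bsub>A\<^esub> (x \<ominus>\<^bsub>A\<^esub> y)"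
    using assms by (simp add: a_minus_def alg.r_distr alg.r_minus)
  then show ?thesis
    using assms by (simp add: nrm_mult)
qed

lemma mult_right_Lipschitz:
  assumes "a \<in> carrier A" "x \<in> carrier A" "y \<in> carrier A"
  shows "nrm A (x \<otimes>\<^bsub>A\<^esub> a \<ominus>\<^bsub>A\<^esub> y \<otimes>\<^bsub>A\<^esub> a) \<le> nrm A a * nrm A (x \<ominus>\<^bsub>A\<^esub> y)"
proof -
  have "x \<otimes>\<^bsub>A\<^esub> a \<ominus>\<^bsub>A\<^esub> y \<otimes>\<^bsub>A\<^esub> a = (x \<ominus>\<^bsub>A\<^esub> y) \<otimes>\<^bsub>A\<^esub> a"
    using assms by (simp add: a_minus_def alg.l_distr alg.l_minus)
  then show ?thesis
    using assms by (metis alg.minus_closed mult.commute nrm_mult)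
qed

lemma convergent_if_Cauchy:
  assumes s: "\<And>n. s n \<in> carrier A"
    and Cauchy: "\<And>e. e > 0 \<Longrightarrow> \<exists>N. \<forall>m\<ge>N. \<forall>n\<ge>N. nrm A (s m \<ominus>\<^bsub>A\<^esub> s n) < e"
  obtains l where "l \<in> carrier A" "(\<lambda>n. nrm A (s n \<ominus>\<^bsub>A\<^esub> l)) \<longlonglongrightarrow> 0"
proof -
  have "metric.MCauchy s"
    using Cauchy s by (auto simp: metric.MCauchy_def dist_eq)
  then obtain l where "limitin metric.mtopology s l sequentially"
    using complete by (auto simp: metric.mcomplete_def)
  then have "l \<in> carrier A" "(\<lambda>n. alg_dist A (s n) l) \<longlonglongrightarrow> 0"
    by (auto simp: metric.limitin_metric_dist_null)
  then show ?thesis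
    using that s by (simp add: dist_eq)
qed

lemma convergent_if_summable:
  assumes s: "\<And>n. s n \<in> carrier A"
    and summable: "summable (\<lambda>n. nrm A (s (Suc n) \<ominus>\<^bsub>A\<^esub> s n))"
  obtains l where "l \<in> carrier A" "(\<lambda>n. nrm A (s n \<ominus>\<^bsub>A\<^esub> l)) \<longlonglongrightarrow> 0"
proof (rule convergent_if_Cauchy[OF s])
  fix e :: real
  assume "e > 0"
  let ?d = "\<lambda>n. nrm A (s (Suc n) \<ominus>\<^bsub>A\<^esub> s n)"
  have le: "nrm A (s n \<ominus>\<^bsub>A\<^esub> s m) \<le> sum ?d {m..<n}" if "m \<le> n" for m n
    using that
  proof (induction n rule: dec_induct)
    case base
    then show ?case
      using s by (simp add: minus_eq_zero_iff[THEN iffD2])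
  next
    case (step n)
    then show ?case
      using nrm_diff_triangle[OF s[of "Suc n"] s[of n] s[of m]] by simp
  qed
  obtain N where N: "norm (sum ?d {m..<n}) < e" if "m \<ge> N" for m n
    using summable \<open>e > 0\<close> unfolding summable_Cauchy by meson
  have "nrm A (s n \<ominus>\<^bsub>A\<^esub> s m) < e" if "m \<ge> N" "n \<ge> N" for m n
  proof (cases "m \<le> n")
    case True
    then show ?thesis
      using le[OF True] N[OF that(1), of n] by simp
  next
    case False
    then show ?thesis
      using le[of n m] N[OF that(2), of m] nrm_minus_commute[OF s s, of n m] by simp
  qed
  then show "\<exists>N. \<forall>m\<ge>N. \<forall>n\<ge>N. nrm A (s m \<ominus>\<^bsub>A\<^esub> s n) < e"
    by blast
qed

lemma eq_if_nrm_le: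
  assumes "x \<in> carrier A" "y \<in> carrier A" "\<And>n. nrm A (x \<ominus>\<^bsub>A\<^esub> y) \<le> d n" "d \<longlonglongrightarrow> 0"
  shows "x = y"
proof -
  have "nrm A (x \<ominus>\<^bsub>A\<^esub> y) \<le> 0"
    using assms(3,4) by (meson LIMSEQ_le_const)
  then show ?thesis
    using assms(1,2) nrm_nonneg[of "x \<ominus>\<^bsub>A\<^esub> y"] nrm_eq_zero minus_eq_zero_iff by auto
qed

end

text \<open>The zero functional counts as a character: \<open>E0\<close> evaluated at a point
  outside the space is one, and a restriction to an ideal may vanish. A nonzero value is demanded
  where it matters.\<close>

definition character :: "(complex, 'c, 'm) module_scheme \<Rightarrow> ('c \<Rightarrow> complex) \<Rightarrow> bool" where
  "character A \<theta> \<longleftrightarrow>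
     (\<forall>x\<in>carrier A. \<forall>y\<in>carrier A. \<theta> (x \<oplus>\<^bsub>A\<^esub> y) = \<theta> x + \<theta> y) \<and>
     (\<forall>x\<in>carrier A. \<forall>y\<in>carrier A. \<theta> (x \<otimes>\<^bsub>A\<^esub> y) = \<theta> x * \<theta> y) \<and>
     (\<forall>c. \<forall>x\<in>carrier A. \<theta> (c \<odot>\<^bsub>A\<^esub> x) = c * \<theta> x)"

lemma character_add:
  "character A \<theta> \<Longrightarrow> x \<in> carrier A \<Longrightarrow> y \<in> carrier A \<Longrightarrow> \<theta> (x \<oplus>\<^bsub>A\<^esub> y) = \<theta> x + \<theta> y"
  and character_mult:
  "character A \<theta> \<Longrightarrow> x \<in> carrier A \<Longrightarrow> y \<in> carrier A \<Longrightarrow> \<theta> (x \<otimes>\<^bsub>A\<^esub> y) = \<theta> x * \<theta> y"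
  and character_smult:
  "character A \<theta> \<Longrightarrow> x \<in> carrier A \<Longrightarrow> \<theta> (c \<odot>\<^bsub>A\<^esub> x) = c * \<theta> x"
  by (simp_all add: character_def)

section \<open>Automatic continuity of characters and a bounded inverse theorem\<close>

context complex_banach_algebra
begin

lemma character_zero [simp]: "character A \<theta> \<Longrightarrow> \<theta> \<zero>\<^bsub>A\<^esub> = 0"
  using character_smult[of A \<theta> "\<zero>\<^bsub>A\<^esub>" 0] by simp

lemma character_minus:
  assumes "character A \<theta>" "x \<in> carrier A" "y \<in> carrier A"
  shows "\<theta> (x \<ominus>\<^bsub>A\<^esub> y) = \<theta> x - \<theta> y"
  using assms by (simp add: a_minus_def character_add character_smult flip: smult_minus1)

text \<open>If \<open>\<theta> a = 1\<close> and \<open>\<parallel>a\<parallel> < 1\<close>, then \<open>b = \<Sum>\<^sub>n\<^sub>\<ge>\<^sub>1 a\<^sup>n\<close> satisfies \<open>b = a + a b\<close>,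
  which \<^term>\<open>\<theta>\<close> turns into \<open>\<theta> b = 1 + \<theta> b\<close>.\<close>

lemma character_norm_le:
  assumes \<theta>: "character A \<theta>" and a: "a \<in> carrier A"
  shows "cmod (\<theta> a) \<le> nrm A a"
proof (rule ccontr)
  assume "\<not> ?thesis"
  then have less: "nrm A a < cmod (\<theta> a)"
    by simp
  then have "\<theta> a \<noteq> 0"
    using nrm_nonneg[OF a] by auto
  define b where "b = inverse (\<theta> a) \<odot>\<^bsub>A\<^esub> a"
  have b [simp]: "b \<in> carrier A"
    using a by (simp add: b_def)
  have "\<theta> b = 1"
    using \<theta> a \<open>\<theta> a \<noteq> 0\<close> by (simp add: b_def character_smult)
  have "nrm A b < 1"
    using less \<open>\<theta> a \<noteq> 0\<close> a by (simp add: b_def nrm_smult norm_divide divide_simps)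
  \<comment> \<open>These are the partial sums b + ... + b^n of the geometric series, with
    \<open>s 0\<close> the empty sum.\<close>
  define s where "s n = ((\<lambda>y. b \<oplus>\<^bsub>A\<^esub> b \<otimes>\<^bsub>A\<^esub> y) ^^ n) \<zero>\<^bsub>A\<^esub>" for n
  have s [simp]: "s n \<in> carrier A" for n
    by (induction n) (auto simp: s_def)
  have s_Suc: "s (Suc n) = b \<oplus>\<^bsub>A\<^esub> b \<otimes>\<^bsub>A\<^esub> s n" for n
    by (simp add: s_def)
  have diff: "s (Suc (Suc n)) \<ominus>\<^bsub>A\<^esub> s (Suc n) = b \<otimes>\<^bsub>A\<^esub> (s (Suc n) \<ominus>\<^bsub>A\<^esub> s n)" for n
  proof -
    have "(b \<oplus>\<^bsub>A\<^esub> b \<otimes>\<^bsub>A\<^esub> x) \<ominus>\<^bsub>A\<^esub> (b \<oplus>\<^bsub>A\<^esub> b \<otimes>\<^bsub>A\<^esub> y) = b \<otimes>\<^bsub>A\<^esub> (x \<ominus>\<^bsub>A\<^esub> y)"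
      if "x \<in> carrier A" "y \<in> carrier A" for x y
      using that by (simp add: alg.ring_simprules)
    then show ?thesis
      using s_Suc by simp
  qed
  have bound: "nrm A (s (Suc n) \<ominus>\<^bsub>A\<^esub> s n) \<le> nrm A b ^ Suc n" for n
  proof (induction n)
    case 0
    then show ?case
      by (simp add: s_def a_minus_def)
  next
    case (Suc n)
    have "nrm A (s (Suc (Suc n)) \<ominus>\<^bsub>A\<^esub> s (Suc n)) \<le> nrm A b * nrm A (s (Suc n) \<ominus>\<^bsub>A\<^esub> s n)"
      unfolding diff by (simp add: nrm_mult)
    also have "\<dots> \<le> nrm A b * nrm A b ^ Suc n"
      by (intro mult_left_mono Suc.IH nrm_nonneg b)
    finally show ?case
      by simp
  qed
  have "summable (\<lambda>n. nrm A (s (Suc n) \<ominus>\<^bsub>A\<^esub> s n))"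
  proof (rule summable_comparison_test')
    show "summable (\<lambda>n. nrm A b ^ Suc n)"
      using \<open>nrm A b < 1\<close> nrm_nonneg[OF b] by (subst summable_Suc_iff) (simp add: summable_geometric)
    show "norm (nrm A (s (Suc n) \<ominus>\<^bsub>A\<^esub> s n)) \<le> nrm A b ^ Suc n" if "n \<ge> 0" for n
      using bound[of n] by (simp add: nrm_nonneg)
  qed
  then obtain l where l: "l \<in> carrier A" and lim: "(\<lambda>n. nrm A (s n \<ominus>\<^bsub>A\<^esub> l)) \<longlonglongrightarrow> 0"
    using convergent_if_summable[of s] by auto
  have "l = b \<oplus>\<^bsub>A\<^esub> b \<otimes>\<^bsub>A\<^esub> l"
  proof (rule eq_if_nrm_le)
    fix n
    have "nrm A (l \<ominus>\<^bsub>A\<^esub> (b \<oplus>\<^bsub>A\<^esub> b \<otimes>\<^bsub>A\<^esub> l)) \<le>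
        nrm A (l \<ominus>\<^bsub>A\<^esub> s (Suc n)) + nrm A (s (Suc n) \<ominus>\<^bsub>A\<^esub> (b \<oplus>\<^bsub>A\<^esub> b \<otimes>\<^bsub>A\<^esub> l))"
      using l by (intro nrm_diff_triangle) auto
    also have "s (Suc n) \<ominus>\<^bsub>A\<^esub> (b \<oplus>\<^bsub>A\<^esub> b \<otimes>\<^bsub>A\<^esub> l) = b \<otimes>\<^bsub>A\<^esub> (s n \<ominus>\<^bsub>A\<^esub> l)"
      using l s[of n] unfolding s_Suc by (simp add: alg.ring_simprules del: s)
    also have "nrm A \<dots> \<le> nrm A b * nrm A (s n \<ominus>\<^bsub>A\<^esub> l)"
      using l by (simp add: nrm_mult)
    finally show "nrm A (l \<ominus>\<^bsub>A\<^esub> (b \<oplus>\<^bsub>A\<^esub> b \<otimes>\<^bsub>A\<^esub> l)) \<le>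
        nrm A (s (Suc n) \<ominus>\<^bsub>A\<^esub> l) + nrm A b * nrm A (s n \<ominus>\<^bsub>A\<^esub> l)"
      using l by (simp add: nrm_minus_commute)
  next
    show "(\<lambda>n. nrm A (s (Suc n) \<ominus>\<^bsub>A\<^esub> l) + nrm A b * nrm A (s n \<ominus>\<^bsub>A\<^esub> l)) \<longlonglongrightarrow> 0"
      using tendsto_add[OF LIMSEQ_Suc[OF lim] tendsto_mult_left[OF lim, of "nrm A b"]] by simp
  qed (use l in auto)
  then have "\<theta> l = \<theta> (b \<oplus>\<^bsub>A\<^esub> b \<otimes>\<^bsub>A\<^esub> l)"
    by simp
  also have "\<dots> = 1 + \<theta> l"
    using \<theta> l \<open>\<theta> b = 1\<close> by (simp add: character_add character_mult)
  finally show False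
    by simp
qed

lemma character_diff_le:
  assumes "character A \<theta>" "x \<in> carrier A" "y \<in> carrier A"
  shows "cmod (\<theta> x - \<theta> y) \<le> nrm A (x \<ominus>\<^bsub>A\<^esub> y)"
  using character_norm_le[of \<theta> "x \<ominus>\<^bsub>A\<^esub> y"] assms by (simp add: character_minus)

lemma character_vanishes_on_closure:
  assumes \<theta>: "character A \<theta>" and "S \<subseteq> carrier A" "\<And>s. s \<in> S \<Longrightarrow> \<theta> s = 0"
    and a: "a \<in> norm_topology A closure_of S"
  shows "\<theta> a = 0"
proof -
  have "cmod (\<theta> a) \<le> 0 + e" if e: "e > 0" for e
  proof -
    obtain s where "s \<in> S" "nrm A (a \<ominus>\<^bsub>A\<^esub> s) < e" "a \<in> carrier A"
      using a in_closure_of_iff[OF assms(2), of a] e by auto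
    then show ?thesis
      using character_diff_le[OF \<theta>, of a s] assms by auto
  qed
  then have "cmod (\<theta> a) \<le> 0"
    by (rule field_le_epsilon)
  then show ?thesis
    by simp
qed

text \<open>The bounded inverse theorem for the identity. Baire's theorem gives approximations in
  the given norm by elements that are controlled in the norm \<open>N\<close>, which are then summed up.\<close>

lemma complete_norm_dominated:
  assumes N_minus: "\<And>x y. x \<in> carrier A \<Longrightarrow> y \<in> carrier A \<Longrightarrow> N (x \<ominus>\<^bsub>A\<^esub> y) \<le> N x + N y"
    and N_smult: "\<And>c x. x \<in> carrier A \<Longrightarrow> N (c \<odot>\<^bsub>A\<^esub> x) = cmod c * N x"
    and N_complete: "\<And>s. (\<And>n. s n \<in> carrier A) \<Longrightarrow> summable (\<lambda>n. N (s (Suc n) \<ominus>\<^bsub>A\<^esub> s n)) \<Longrightarrow>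
      \<exists>l\<in>carrier A. (\<lambda>n. N (s n \<ominus>\<^bsub>A\<^esub> l)) \<longlonglongrightarrow> 0"
    and N_bound: "\<And>x. x \<in> carrier A \<Longrightarrow> nrm A x \<le> L * N x"
  obtains M where "\<And>x. x \<in> carrier A \<Longrightarrow> N x \<le> M * nrm A x"
proof -
  have N_zero: "N \<zero>\<^bsub>A\<^esub> = 0"
    using N_smult[of "\<zero>\<^bsub>A\<^esub>" 0] by simp
  have N_uminus: "N (\<ominus>\<^bsub>A\<^esub> x) = N x" if "x \<in> carrier A" for x
    using that by (simp add: N_smult flip: smult_minus1)
  have N_nonneg: "N x \<ge> 0" if "x \<in> carrier A" for x
    using N_minus[OF that that] that by (simp add: N_zero minus_eq_zero_iff[THEN iffD2])
  have N_triangle: "N x \<le> N y + N (x \<ominus>\<^bsub>A\<^esub> y)" if "x \<in> carrier A" "y \<in> carrier A" for x y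
  proof -
    have "x = (x \<ominus>\<^bsub>A\<^esub> y) \<ominus>\<^bsub>A\<^esub> (\<ominus>\<^bsub>A\<^esub> y)"
      using that by (simp add: alg.ring_simprules)
    then show ?thesis
      using N_minus[of "x \<ominus>\<^bsub>A\<^esub> y" "\<ominus>\<^bsub>A\<^esub> y"] that by (simp add: N_uminus)
  qed
  define F where "F k = norm_topology A closure_of {x \<in> carrier A. N x \<le> real k}" for k
  have F_iff: "y \<in> F k \<longleftrightarrow> y \<in> carrier A \<and>
      (\<forall>e>0. \<exists>x\<in>carrier A. N x \<le> real k \<and> nrm A (y \<ominus>\<^bsub>A\<^esub> x) < e)" for y k
    unfolding F_def by (subst in_closure_of_iff) auto
  have "(\<Union>k. F k) = carrier A"
  proof
    show "carrier A \<subseteq> (\<Union>k. F k)"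
    proof
      fix x
      assume x: "x \<in> carrier A"
      obtain k where "N x \<le> real k"
        using real_arch_simple by blast
      then have "x \<in> F k"
        using x unfolding F_iff by (auto simp: minus_eq_zero_iff[THEN iffD2] intro!: bexI[of _ x])
      then show "x \<in> (\<Union>k. F k)"
        by auto
    qed
  qed (auto simp: F_iff)
  moreover have "metric.mtopology interior_of (carrier A) = carrier A"
    by (metis interior_of_topspace metric.topspace_mtopology)
  ultimately have "metric.mtopology interior_of (\<Union>(range F)) \<noteq> {}"
    using alg.zero_closed by auto
  moreover have "closedin metric.mtopology (F k)" for k
    unfolding F_def norm_topology_def by simp
  ultimately obtain k where "metric.mtopology interior_of (F k) \<noteq> {}"
    using metric.metric_Baire_category_alt[OF complete, of "range F"] by auto
  then obtain y0 r where y0: "y0 \<in> carrier A" "r > 0" "metric.mball y0 r \<subseteq> F k"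
    by (auto simp: metric.metric_interior_of)
  \<comment> \<open>The ball around \<open>y0\<close> is moved to the origin by approximating both
    \<open>y0 + u\<close> and \<open>y0\<close> and subtracting, which doubles the bound
    \<open>k\<close>.\<close>
  have small: "\<exists>x\<in>carrier A. N x \<le> 2 * real k \<and> nrm A (u \<ominus>\<^bsub>A\<^esub> x) < e"
    if u: "u \<in> carrier A" "nrm A u < r" "e > 0" for u e
  proof -
    have "nrm A (y0 \<ominus>\<^bsub>A\<^esub> (y0 \<oplus>\<^bsub>A\<^esub> u)) = nrm A u"
      using y0 u by (simp add: nrm_minus_commute[of y0] add_minus_cancel)
    then have "y0 \<oplus>\<^bsub>A\<^esub> u \<in> metric.mball y0 r" "y0 \<in> metric.mball y0 r"
      using u y0 by (auto simp: metric.in_mball dist_eq)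
    then have "y0 \<oplus>\<^bsub>A\<^esub> u \<in> F k" "y0 \<in> F k"
      using y0 by auto
    then obtain x x' where x: "x \<in> carrier A" "N x \<le> real k"
        "nrm A ((y0 \<oplus>\<^bsub>A\<^esub> u) \<ominus>\<^bsub>A\<^esub> x) < e / 2"
      and x': "x' \<in> carrier A" "N x' \<le> real k" "nrm A (y0 \<ominus>\<^bsub>A\<^esub> x') < e / 2"
      using half_gt_zero[OF \<open>e > 0\<close>] unfolding F_iff by blast
    have "u \<ominus>\<^bsub>A\<^esub> (x \<ominus>\<^bsub>A\<^esub> x') = ((y0 \<oplus>\<^bsub>A\<^esub> u) \<ominus>\<^bsub>A\<^esub> x) \<ominus>\<^bsub>A\<^esub> (y0 \<ominus>\<^bsub>A\<^esub> x')"
    proof -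
      have "((y0 \<oplus>\<^bsub>A\<^esub> u) \<ominus>\<^bsub>A\<^esub> x) \<ominus>\<^bsub>A\<^esub> (y0 \<ominus>\<^bsub>A\<^esub> x') = ((y0 \<oplus>\<^bsub>A\<^esub> (u \<ominus>\<^bsub>A\<^esub> (x \<ominus>\<^bsub>A\<^esub> x'))) \<ominus>\<^bsub>A\<^esub> y0)"
        using x x' u y0 by (simp add: alg.ring_simprules)
      then show ?thesis
        using x x' u y0 by (simp add: add_minus_cancel)
    qed
    then have "nrm A (u \<ominus>\<^bsub>A\<^esub> (x \<ominus>\<^bsub>A\<^esub> x')) < e"
      using nrm_minus_le[of "(y0 \<oplus>\<^bsub>A\<^esub> u) \<ominus>\<^bsub>A\<^esub> x" "y0 \<ominus>\<^bsub>A\<^esub> x'"] x x' y0 u by simp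
    moreover have "N (x \<ominus>\<^bsub>A\<^esub> x') \<le> 2 * real k"
      using N_minus[of x x'] x x' by simp
    ultimately show ?thesis
      using x x' by blast
  qed
  \<comment> \<open>A vector of norm t is scaled by c = r / (2 t) to norm r / 2. Its approximants
    have \<open>N\<close> at most 2 k, and scaling back gives 2 k / c = (4 k / r) t.\<close>
  define M where "M = 4 * real k / r"
  have "M \<ge> 0"
    using y0 by (simp add: M_def)
  have approx: "\<exists>x\<in>carrier A. N x \<le> M * nrm A u \<and> nrm A (u \<ominus>\<^bsub>A\<^esub> x) \<le> nrm A u / 2"
    if u: "u \<in> carrier A" for u
  proof (cases "u = \<zero>\<^bsub>A\<^esub>")
    case True
    then show ?thesis
      by (intro bexI[of _ "\<zero>\<^bsub>A\<^esub>"]) (auto simp: N_zero a_minus_def)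
  next
    case False
    define t where "t = nrm A u"
    have "t > 0"
      using False u nrm_nonneg[of u] nrm_eq_zero[of u] by (simp add: t_def)
    define c where "c = r / (2 * t)"
    have "c > 0"
      using \<open>t > 0\<close> y0 by (simp add: c_def)
    have "nrm A (complex_of_real c \<odot>\<^bsub>A\<^esub> u) < r"
      using \<open>c > 0\<close> \<open>t > 0\<close> u y0 by (simp add: nrm_smult flip: t_def) (simp add: c_def)
    then obtain x where x: "x \<in> carrier A" "N x \<le> 2 * real k"
      "nrm A (complex_of_real c \<odot>\<^bsub>A\<^esub> u \<ominus>\<^bsub>A\<^esub> x) < c * t / 2"
      using small[of "complex_of_real c \<odot>\<^bsub>A\<^esub> u" "c * t / 2"] u \<open>c > 0\<close> \<open>t > 0\<close> by auto
    let ?x = "complex_of_real (1 / c) \<odot>\<^bsub>A\<^esub> x"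
    have "u \<ominus>\<^bsub>A\<^esub> ?x = complex_of_real (1 / c) \<odot>\<^bsub>A\<^esub> (complex_of_real c \<odot>\<^bsub>A\<^esub> u \<ominus>\<^bsub>A\<^esub> x)"
      using \<open>c > 0\<close> u x by (simp add: smult_minus smult_smult)
    then have "nrm A (u \<ominus>\<^bsub>A\<^esub> ?x) \<le> t / 2"
      using x u \<open>c > 0\<close> by (simp add: nrm_smult norm_divide) (simp add: field_simps)
    moreover have "N ?x \<le> M * t"
    proof -
      have "N ?x = N x / c"
        using x \<open>c > 0\<close> by (simp add: N_smult norm_divide)
      also have "\<dots> \<le> 2 * real k / c"
        using x \<open>c > 0\<close> by (simp add: divide_right_mono)
      also have "\<dots> = M * t"
        using y0 by (simp add: c_def M_def)
      finally show ?thesis .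
    qed
    ultimately show ?thesis
      using x by (intro bexI[of _ ?x]) (auto simp: t_def)
  qed
  then obtain g where g: "\<And>u. u \<in> carrier A \<Longrightarrow> g u \<in> carrier A"
    "\<And>u. u \<in> carrier A \<Longrightarrow> N (g u) \<le> M * nrm A u"
    "\<And>u. u \<in> carrier A \<Longrightarrow> nrm A (u \<ominus>\<^bsub>A\<^esub> g u) \<le> nrm A u / 2"
    by metis
  have "N x \<le> 2 * M * nrm A x" if x: "x \<in> carrier A" for x
  proof -
    define t where "t = nrm A x"
    \<comment> \<open>The residues of successive approximation. Their norms halve at each step, so
      that the corrections \<open>g (u n)\<close> are summable in \<open>N\<close>.\<close>
    define u where "u n = ((\<lambda>v. v \<ominus>\<^bsub>A\<^esub> g v) ^^ n) x" for n
    have u0: "u 0 = x" and u_Suc: "u (Suc n) = u n \<ominus>\<^bsub>A\<^esub> g (u n)" for n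
      by (simp_all add: u_def)
    have u [simp]: "u n \<in> carrier A" for n
      by (induction n) (auto simp: u0 u_Suc x g)
    have nrm_u: "nrm A (u n) \<le> t * (1 / 2) ^ n" for n
    proof (induction n)
      case (Suc n)
      then show ?case
        using g(3)[of "u n"] by (simp add: u_Suc)
    qed (simp add: u0 t_def)
    have step: "u (Suc n) \<ominus>\<^bsub>A\<^esub> u n = \<ominus>\<^bsub>A\<^esub> g (u n)" for n
      using u[of n] g(1)[of "u n"] unfolding u_Suc by (simp add: alg.ring_simprules del: u)
    have N_step: "N (g (u n)) \<le> M * t * (1 / 2) ^ n" for n
      using g(2)[of "u n"] mult_left_mono[OF nrm_u[of n] \<open>M \<ge> 0\<close>] by (simp add: mult.assoc)
    have "summable (\<lambda>n. N (u (Suc n) \<ominus>\<^bsub>A\<^esub> u n))"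
    proof (rule summable_comparison_test')
      show "summable (\<lambda>n. M * t * (1 / 2) ^ n)"
        by (intro summable_mult summable_geometric) simp
      show "norm (N (u (Suc n) \<ominus>\<^bsub>A\<^esub> u n)) \<le> M * t * (1 / 2) ^ n" if "n \<ge> 0" for n
        using N_step[of n] g(1)[of "u n"] by (simp add: step N_uminus N_nonneg)
    qed
    then obtain l where l: "l \<in> carrier A" and lim: "(\<lambda>n. N (u n \<ominus>\<^bsub>A\<^esub> l)) \<longlonglongrightarrow> 0"
      using N_complete[of u] by auto
    \<comment> \<open>Since \<open>N\<close> dominates the given norm up to \<open>L\<close>, the
      \<open>N\<close>-limit of the residues is also their limit in the given norm, in which they
      tend to zero.\<close>
    have "l = \<zero>\<^bsub>A\<^esub>"
    proof (rule eq_if_nrm_le)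
      fix n
      have "nrm A l \<le> nrm A (u n) + nrm A (u n \<ominus>\<^bsub>A\<^esub> l)"
        using nrm_le_minus[of l "u n"] l by (simp add: nrm_minus_commute[of l])
      also have "\<dots> \<le> t * (1 / 2) ^ n + L * N (u n \<ominus>\<^bsub>A\<^esub> l)"
        using N_bound[of "u n \<ominus>\<^bsub>A\<^esub> l"] nrm_u[of n] l by simp
      finally show "nrm A (l \<ominus>\<^bsub>A\<^esub> \<zero>\<^bsub>A\<^esub>) \<le> t * (1 / 2) ^ n + L * N (u n \<ominus>\<^bsub>A\<^esub> l)"
        using l by (simp add: a_minus_def)
    next
      have "(\<lambda>n. (1 / 2 :: real) ^ n) \<longlonglongrightarrow> 0"
        by (rule LIMSEQ_power_zero) simp
      from tendsto_add[OF tendsto_mult_left[OF this, of t] tendsto_mult_left[OF lim, of L]]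
      show "(\<lambda>n. t * (1 / 2) ^ n + L * N (u n \<ominus>\<^bsub>A\<^esub> l)) \<longlonglongrightarrow> 0"
        by simp
    qed (use l in auto)
    have bound: "N (x \<ominus>\<^bsub>A\<^esub> u n) \<le> 2 * M * t * (1 - (1 / 2) ^ n)" for n
    proof (induction n)
      case 0
      then show ?case
        using x by (simp add: u0 N_zero minus_eq_zero_iff[THEN iffD2])
    next
      case (Suc n)
      have "x \<ominus>\<^bsub>A\<^esub> u (Suc n) = (x \<ominus>\<^bsub>A\<^esub> u n) \<ominus>\<^bsub>A\<^esub> (\<ominus>\<^bsub>A\<^esub> g (u n))"
        using x u[of n] g(1)[of "u n"] unfolding u_Suc by (simp add: alg.ring_simprules del: u)
      then have "N (x \<ominus>\<^bsub>A\<^esub> u (Suc n)) \<le> N (x \<ominus>\<^bsub>A\<^esub> u n) + N (g (u n))"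
        using N_minus[of "x \<ominus>\<^bsub>A\<^esub> u n" "\<ominus>\<^bsub>A\<^esub> g (u n)"] x g(1)[of "u n"] by (simp add: N_uminus)
      also have "\<dots> \<le> 2 * M * t * (1 - (1 / 2) ^ n) + M * t * (1 / 2) ^ n"
        using Suc.IH N_step[of n] by simp
      also have "\<dots> = 2 * M * t * (1 - (1 / 2) ^ Suc n)"
        by (simp add: algebra_simps)
      finally show ?case .
    qed
    have "N x \<le> 2 * M * t + N (u n \<ominus>\<^bsub>A\<^esub> l)" for n
    proof -
      have "N x \<le> N (u n) + N (x \<ominus>\<^bsub>A\<^esub> u n)"
        using x by (intro N_triangle) auto
      also have "N (x \<ominus>\<^bsub>A\<^esub> u n) \<le> 2 * M * t * 1"
        using nrm_nonneg[OF x] \<open>M \<ge> 0\<close>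
        by (intro order_trans[OF bound] mult_left_mono) (auto simp: t_def)
      finally show ?thesis
        by (simp add: \<open>l = \<zero>\<^bsub>A\<^esub>\<close> a_minus_def)
    qed
    moreover have "(\<lambda>n. 2 * M * t + N (u n \<ominus>\<^bsub>A\<^esub> l)) \<longlonglongrightarrow> 2 * M * t + 0"
      by (intro tendsto_add tendsto_const lim)
    ultimately show "N x \<le> 2 * M * nrm A x"
      by (simp add: LIMSEQ_le_const t_def)
  qed
  then show ?thesis
    using that by blast
qed

end

section \<open>Continuous functions\<close>

lemma cont_alg_simps [simp]:
  "\<zero>\<^bsub>cont_alg X\<^esub> = (\<lambda>x. 0)"
  "\<one>\<^bsub>cont_alg X\<^esub> = (\<lambda>x. if x \<in> topspace X then 1 else 0)"
  "f \<oplus>\<^bsub>cont_alg X\<^esub> g = (\<lambda>x. f x + g x)"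
  "f \<otimes>\<^bsub>cont_alg X\<^esub> g = (\<lambda>x. f x * g x)"
  "c \<odot>\<^bsub>cont_alg X\<^esub> f = (\<lambda>x. c * f x)"
  by (simp_all add: cont_alg_def)

lemma cont_alg_iff:
  "f \<in> carrier (cont_alg X) \<longleftrightarrow> continuous_map X euclidean f \<and> (\<forall>x. x \<notin> topspace X \<longrightarrow> f x = 0)"
  by (simp add: cont_alg_def)

lemma continuous_map_mult_complex:
  fixes f g :: "'a \<Rightarrow> complex"
  shows "continuous_map X euclidean f \<Longrightarrow> continuous_map X euclidean g \<Longrightarrow>
    continuous_map X euclidean (\<lambda>x. f x * g x)"
  by (simp add: continuous_map_atin tendsto_mult)

lemma cont_alg_zero [simp]: "(\<lambda>x. 0) \<in> carrier (cont_alg X)"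
  by (simp add: cont_alg_iff)

lemma cont_alg_one [simp]: "(\<lambda>x. if x \<in> topspace X then 1 else 0) \<in> carrier (cont_alg X)"
  unfolding cont_alg_iff by (auto intro: continuous_map_eq[of X euclidean "\<lambda>x. 1"])

lemma cont_alg_add [simp, intro]:
  "f \<in> carrier (cont_alg X) \<Longrightarrow> g \<in> carrier (cont_alg X) \<Longrightarrow> (\<lambda>x. f x + g x) \<in> carrier (cont_alg X)"
  by (simp add: cont_alg_iff continuous_map_add)

lemma cont_alg_mult [simp, intro]:
  "f \<in> carrier (cont_alg X) \<Longrightarrow> g \<in> carrier (cont_alg X) \<Longrightarrow> (\<lambda>x. f x * g x) \<in> carrier (cont_alg X)"
  by (simp add: cont_alg_iff continuous_map_mult_complex)

lemma cont_alg_smult [simp, intro]: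
  "f \<in> carrier (cont_alg X) \<Longrightarrow> (\<lambda>x. c * f x) \<in> carrier (cont_alg X)"
  by (simp add: cont_alg_iff continuous_map_mult_complex)

lemma cont_alg_sum [intro]:
  "(\<And>i. i \<in> I \<Longrightarrow> f i \<in> carrier (cont_alg X)) \<Longrightarrow> (\<lambda>x. \<Sum>i\<in>I. f i x) \<in> carrier (cont_alg X)"
  by (induction I rule: infinite_finite_induct) auto

lemma cont_alg_compose [intro]:
  assumes "f \<in> carrier (cont_alg X)" "continuous_on UNIV h" "h 0 = 0"
  shows "(\<lambda>x. h (f x)) \<in> carrier (cont_alg X)"
  using assms continuous_map_compose[of X euclidean f euclidean h]
  by (simp add: cont_alg_iff o_def)

text \<open>The cut-off keeps to the convention that functions are 0 off the space, as
  \<open>h\<close> may send outside points to anything.\<close>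

definition pullback :: "'a topology \<Rightarrow> ('a \<Rightarrow> 'b) \<Rightarrow> ('b \<Rightarrow> complex) \<Rightarrow> 'a \<Rightarrow> complex" where
  "pullback X h f = (\<lambda>x. if x \<in> topspace X then f (h x) else 0)"

lemma pullback_apply [simp]: "x \<in> topspace X \<Longrightarrow> pullback X h f x = f (h x)"
  by (simp add: pullback_def)

lemma cont_alg_pullback [intro]:
  assumes "f \<in> carrier (cont_alg Y)" "continuous_map X Y h"
  shows "pullback X h f \<in> carrier (cont_alg X)"
  using assms continuous_map_compose[of X Y h euclidean f]
  by (auto simp: cont_alg_iff pullback_def o_def intro: continuous_map_eq)

text \<open>A closed ideal of C(X): everything for \<open>K = {}\<close>, and the copy of C_0 in the
  one-point compactification for \<open>K = {None}\<close>.\<close>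

definition vanishing :: "'a topology \<Rightarrow> 'a set \<Rightarrow> ('a \<Rightarrow> complex) set" where
  "vanishing X K = {f \<in> carrier (cont_alg X). \<forall>x\<in>K. f x = 0}"

lemma vanishing_carrier: "f \<in> vanishing X K \<Longrightarrow> f \<in> carrier (cont_alg X)"
  by (simp add: vanishing_def)

lemma vanishing_empty [simp]: "vanishing X {} = carrier (cont_alg X)"
  by (simp add: vanishing_def)

lemma vanishing_zero [simp]: "(\<lambda>x. 0) \<in> vanishing X K"
  by (simp add: vanishing_def)

lemma vanishing_add [intro]:
  "f \<in> vanishing X K \<Longrightarrow> g \<in> vanishing X K \<Longrightarrow> (\<lambda>x. f x + g x) \<in> vanishing X K"
  by (simp add: vanishing_def)

lemma vanishing_smult [intro]: "f \<in> vanishing X K \<Longrightarrow> (\<lambda>x. c * f x) \<in> vanishing X K"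
  by (simp add: vanishing_def)

lemma vanishing_mult_right [intro]:
  "f \<in> vanishing X K \<Longrightarrow> g \<in> carrier (cont_alg X) \<Longrightarrow> (\<lambda>x. f x * g x) \<in> vanishing X K"
  by (simp add: vanishing_def)

text \<open>Uses \<open>w = \<surd>|w| \<cdot> w / \<surd>|w|\<close>, with both factors continuous in \<open>w\<close> and zero at \<open>w = 0\<close>.\<close>

lemma cont_alg_factorization:
  assumes f: "f \<in> carrier (cont_alg X)"
  obtains g h where "g \<in> carrier (cont_alg X)" "h \<in> carrier (cont_alg X)"
    "\<And>x. f x = g x * h x" "\<And>x. f x = 0 \<Longrightarrow> g x = 0 \<and> h x = 0"
proof
  define r where "r w = complex_of_real (sqrt (cmod w))" for w
  define q where "q w = w / r w" for w
  have r_eq_0: "r w = 0 \<longleftrightarrow> w = 0" for w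
    by (simp add: r_def)
  have "continuous_on UNIV r"
    unfolding r_def by (intro continuous_intros)
  have norm_q: "cmod (q w) = sqrt (cmod w)" for w
    by (simp add: q_def r_def norm_divide real_div_sqrt)
  have "isCont q w" for w
  proof (cases "w = 0")
    case True
    have "((\<lambda>w. cmod (q w)) \<longlongrightarrow> sqrt (cmod 0)) (at 0)"
      unfolding norm_q by (intro tendsto_intros)
    then have "(q \<longlongrightarrow> 0) (at 0)"
      by (simp add: tendsto_norm_zero_iff)
    then show ?thesis
      by (simp add: True isCont_def q_def)
  next
    case False
    then show ?thesis
      using \<open>continuous_on UNIV r\<close> r_eq_0[of w] unfolding q_def
      by (intro isCont_divide) (simp_all add: continuous_on_eq_continuous_at)
  qed
  then have "continuous_on UNIV q"
    by (simp add: continuous_at_imp_continuous_on)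
  show "(\<lambda>x. r (f x)) \<in> carrier (cont_alg X)"
    by (rule cont_alg_compose[OF f \<open>continuous_on UNIV r\<close>]) (simp add: r_def)
  show "(\<lambda>x. q (f x)) \<in> carrier (cont_alg X)"
    by (rule cont_alg_compose[OF f \<open>continuous_on UNIV q\<close>]) (simp add: q_def)
  show "f x = r (f x) * q (f x)" for x
    using r_eq_0[of "f x"] by (auto simp: q_def)
  show "r (f x) = 0 \<and> q (f x) = 0" if "f x = 0" for x
    using that by (simp add: r_def q_def)
qed

lemma vanishing_separates:
  assumes "compact_space X" "Hausdorff_space X" "closedin X K" "y \<in> topspace X" "y \<notin> K"
  obtains f where "f \<in> vanishing X K" "f y = 1"
proof -
  have "normal_space X"
    using assms by (simp add: compact_Hausdorff_or_regular_imp_normal_space)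
  moreover have "closedin X {y}"
    using assms by (simp add: closedin_Hausdorff_singleton)
  ultimately obtain f where f: "continuous_map X euclideanreal f" "f ` K \<subseteq> {0}" "f ` {y} \<subseteq> {1}"
    using Urysohn_lemma_alt[of X K "{y}" 0 1] assms by auto
  define g where "g = pullback X id (\<lambda>x. complex_of_real (f x))"
  have "continuous_map X euclidean (complex_of_real \<circ> f)"
    using f(1) by (rule continuous_map_compose) (auto intro: continuous_intros)
  then have "g \<in> carrier (cont_alg X)"
    by (auto simp: cont_alg_iff g_def pullback_def o_def intro: continuous_map_eq)
  then have "g \<in> vanishing X K" "g y = 1"
    using f(2,3) assms closedin_subset[of X K] by (auto simp: vanishing_def g_def pullback_def)
  then show ?thesis
    using that by blast
qed

lemma vanishing_separates_points:
  assumes "compact_space X" "Hausdorff_space X" "closedin X K" "y \<in> topspace X" "y \<notin> K"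
    and "y' \<in> topspace X" "y \<noteq> y'"
  obtains f where "f \<in> vanishing X K" "f y = 1" "f y' = 0"
proof -
  have "closedin X (insert y' K)"
    using assms by (metis closedin_Hausdorff_singleton closedin_Un insert_is_Un)
  then obtain f where "f \<in> vanishing X (insert y' K)" "f y = 1"
    using assms by (auto elim!: vanishing_separates[of X "insert y' K" y])
  then show ?thesis
    using that by (auto simp: vanishing_def)
qed

section \<open>Characters and point derivations of function algebras\<close>

lemma character_sum:
  assumes "character (cont_alg X) \<theta>" "\<And>i. i \<in> I \<Longrightarrow> f i \<in> carrier (cont_alg X)"
  shows "\<theta> (\<lambda>x. \<Sum>i\<in>I. f i x) = (\<Sum>i\<in>I. \<theta> (f i))"
  using assms(2)
proof (induction I rule: infinite_finite_induct)
  case (insert i I)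
  then show ?case
    using character_add[OF assms(1), of "f i" "\<lambda>x. \<Sum>i\<in>I. f i x"] by (simp add: cont_alg_sum)
qed (use character_smult[OF assms(1), of "\<lambda>x. 0" 0] in auto)

text \<open>If no point were a common zero of the kernel, finitely many elements \<open>f\<^sub>i\<close> of the kernel
  would have no common zero, and the kernel would contain the invertible function
  \<open>\<Sum> cnj f\<^sub>i \<cdot> f\<^sub>i\<close>.\<close>

lemma character_cont_alg:
  assumes compact: "compact_space X" and \<theta>: "character (cont_alg X) \<theta>"
    and one: "\<theta> (\<lambda>x. if x \<in> topspace X then 1 else 0) = 1"
  obtains y where "y \<in> topspace X" "\<And>f. f \<in> carrier (cont_alg X) \<Longrightarrow> \<theta> f = f y"
proof -
  have "\<exists>y\<in>topspace X. \<forall>f\<in>carrier (cont_alg X). \<theta> f = 0 \<longrightarrow> f y = 0"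
  proof (rule ccontr)
    assume "\<not> ?thesis"
    then obtain F where F: "\<And>y. y \<in> topspace X \<Longrightarrow> F y \<in> carrier (cont_alg X)"
      "\<And>y. y \<in> topspace X \<Longrightarrow> \<theta> (F y) = 0" "\<And>y. y \<in> topspace X \<Longrightarrow> F y y \<noteq> 0"
      by metis
    let ?N = "\<lambda>y. {x \<in> topspace X. F y x \<in> - {0}}"
    have "openin X (?N y)" if "y \<in> topspace X" for y
      using F(1)[OF that] by (intro openin_continuous_map_preimage[of X euclidean]) (auto simp: cont_alg_iff)
    moreover have "topspace X \<subseteq> \<Union>(?N ` topspace X)"
      using F(3) by auto
    ultimately have "\<exists>G. finite G \<and> G \<subseteq> ?N ` topspace X \<and> topspace X \<subseteq> \<Union>G"
      using compact unfolding compact_space_alt by (elim allE[of _ "?N ` topspace X"]) auto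
    then obtain S where S: "finite S" "S \<subseteq> topspace X" "topspace X \<subseteq> (\<Union>y\<in>S. ?N y)"
      by (metis (no_types, lifting) finite_subset_image)
    define g where "g x = (\<Sum>y\<in>S. cnj (F y x) * F y x)" for x
    have cnj: "(\<lambda>x. cnj (F y x)) \<in> carrier (cont_alg X)" if "y \<in> S" for y
      using F(1)[of y] S(2) that by (intro cont_alg_compose[where h = cnj]) (auto intro: continuous_intros)
    have g: "g \<in> carrier (cont_alg X)"
      unfolding g_def using F(1) S(2) cnj by (intro cont_alg_sum[where I = S] cont_alg_mult) auto
    have "\<theta> g = (\<Sum>y\<in>S. \<theta> (\<lambda>x. cnj (F y x) * F y x))"
      unfolding g_def using F(1) S(2) cnj by (intro character_sum[OF \<theta>] cont_alg_mult) auto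
    also have "\<dots> = 0"
    proof (rule sum.neutral, rule ballI)
      fix y
      assume "y \<in> S"
      then show "\<theta> (\<lambda>x. cnj (F y x) * F y x) = 0"
        using character_mult[OF \<theta> cnj, of y "F y"] F S(2) by auto
    qed
    finally have "\<theta> g = 0" .
    have "g x \<noteq> 0" if x: "x \<in> topspace X" for x
    proof -
      have g_eq: "g x = complex_of_real (\<Sum>y\<in>S. (cmod (F y x))\<^sup>2)"
        unfolding g_def of_real_sum complex_norm_square by (simp add: mult.commute)
      obtain y where "y \<in> S" "F y x \<noteq> 0"
        using S(3) x by auto
      then have "(\<Sum>y\<in>S. (cmod (F y x))\<^sup>2) > 0"
        using S(1) by (intro sum_pos2[of S y]) auto
      then show ?thesis
        unfolding g_eq of_real_eq_0_iff by linarith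
    qed
    then have "continuous_map X euclidean (\<lambda>x. inverse (g x))"
      using g by (simp add: cont_alg_iff continuous_map_atin tendsto_inverse)
    then have "(\<lambda>x. inverse (g x)) \<in> carrier (cont_alg X)"
      using g by (simp add: cont_alg_iff)
    then have "\<theta> (\<lambda>x. inverse (g x) * g x) = 0"
      using character_mult[OF \<theta> _ g] \<open>\<theta> g = 0\<close> by simp
    moreover have "(\<lambda>x. inverse (g x) * g x) = (\<lambda>x. if x \<in> topspace X then 1 else 0)"
      using \<open>\<And>x. x \<in> topspace X \<Longrightarrow> g x \<noteq> 0\<close> g by (auto simp: cont_alg_iff)
    ultimately show False
      using one by simp
  qed
  then obtain y where y: "y \<in> topspace X"
      "\<And>f. f \<in> carrier (cont_alg X) \<Longrightarrow> \<theta> f = 0 \<Longrightarrow> f y = 0"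
    by blast
  have "\<theta> f = f y" if f: "f \<in> carrier (cont_alg X)" for f
  proof -
    define c where "c = (\<lambda>x. - \<theta> f * (if x \<in> topspace X then 1 else 0))"
    have "\<theta> c = - \<theta> f"
      using character_smult[OF \<theta> cont_alg_one, of "- \<theta> f"] one by (simp add: c_def)
    moreover have c: "c \<in> carrier (cont_alg X)"
      unfolding c_def by (intro cont_alg_smult cont_alg_one)
    ultimately have "\<theta> (\<lambda>x. f x + c x) = 0"
      using character_add[OF \<theta> f c] by simp
    then have "f y + c y = 0"
      using y(2)[of "\<lambda>x. f x + c x"] f c by simp
    then show ?thesis
      using y(1) by (simp add: c_def)
  qed
  then show ?thesis
    using that y(1) by blast
qed

text \<open>A function that vanishes at \<open>y\<close> is a product of two such functions in the
  same ideal, and the Leibniz rule annihilates such a product. Subtracting a multiple of a function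
  that is 1 at \<open>y\<close> reduces the general case to this one.\<close>

lemma point_derivation_eq_0:
  fixes D :: "('a \<Rightarrow> complex) \<Rightarrow> complex"
  assumes "compact_space X" "Hausdorff_space X" "closedin X K" "y \<in> topspace X" "y \<notin> K"
    and add: "\<And>f g. f \<in> vanishing X K \<Longrightarrow> g \<in> vanishing X K \<Longrightarrow> D (\<lambda>x. f x + g x) = D f + D g"
    and smult: "\<And>c f. f \<in> vanishing X K \<Longrightarrow> D (\<lambda>x. c * f x) = c * D f"
    and Leibniz: "\<And>f g. f \<in> vanishing X K \<Longrightarrow> g \<in> vanishing X K \<Longrightarrow>
      D (\<lambda>x. f x * g x) = f y * D g + D f * g y"
    and f: "f \<in> vanishing X K"
  shows "D f = 0"
proof -
  have 0: "D f = 0" if f: "f \<in> vanishing X K" "f y = 0" for f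
  proof -
    obtain g h where gh: "g \<in> carrier (cont_alg X)" "h \<in> carrier (cont_alg X)"
      "\<And>x. f x = g x * h x" "\<And>x. f x = 0 \<Longrightarrow> g x = 0 \<and> h x = 0"
      using cont_alg_factorization[OF vanishing_carrier[OF f(1)]] by blast
    have "g \<in> vanishing X K" "h \<in> vanishing X K"
      using f(1) gh(1,2,4) by (simp_all add: vanishing_def)
    then have "D (\<lambda>x. g x * h x) = 0"
      using Leibniz[of g h] gh(4)[OF f(2)] by simp
    moreover have "f = (\<lambda>x. g x * h x)"
      using gh(3) by auto
    ultimately show ?thesis
      by simp
  qed
  obtain e where e: "e \<in> vanishing X K" "e y = 1"
    by (rule vanishing_separates[OF assms(1-5)])
  have diff: "D (\<lambda>x. g x + c * h x) = D g + c * D h"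
    if "g \<in> vanishing X K" "h \<in> vanishing X K" for g h c
    using that add[of g "\<lambda>x. c * h x"] smult[of h c] by auto
  have ee: "(\<lambda>x. e x * e x) \<in> vanishing X K"
    using e(1) vanishing_carrier by blast
  \<comment> \<open>The ideal may lack the constant 1, so \<open>e\<close> stands in for it. Since e
    e - e vanishes at \<open>y\<close> and D(e e) = 2 D(e), also D(e) = 0.\<close>
  have "D (\<lambda>x. e x * e x + (-1) * e x) = 0"
    using e by (intro 0 vanishing_add vanishing_smult ee) auto
  then have "D e = 0"
    using diff[OF ee e(1), of "-1"] Leibniz[OF e(1) e(1)] e(2) by simp
  have "D (\<lambda>x. f x + (- f y) * e x) = 0"
    using e f by (intro 0 vanishing_add vanishing_smult) auto
  then show ?thesis
    using diff[OF f e(1), of "- f y"] \<open>D e = 0\<close> by simp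
qed

section \<open>Skew polynomials\<close>

lemma skew_poly_carrier_iff:
  "p \<in> carrier (skew_poly_alg X \<eta>) \<longleftrightarrow>
    (\<forall>n. p n \<in> carrier (cont_alg X)) \<and> finite {n. p n \<noteq> (\<lambda>x. 0)}"
  by (simp add: skew_poly_alg_def)

lemma skew_poly_mult:
  "p \<otimes>\<^bsub>skew_poly_alg X \<eta>\<^esub> q = (\<lambda>n x. \<Sum>k\<le>n. p k x * q (n - k) ((\<eta> ^^ k) x))"
  by (simp add: skew_poly_alg_def)

lemma skew_monom_carrier:
  assumes "f \<in> carrier (cont_alg X)"
  shows "skew_monom n f \<in> carrier (skew_poly_alg X \<eta>)"
proof -
  have "skew_monom n f m = (if m = n then f else (\<lambda>x. 0))" for m
    by (auto simp: skew_monom_def)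
  then show ?thesis
    using assms finite_subset[of "{m. skew_monom n f m \<noteq> (\<lambda>x. 0)}" "{n}"]
    by (auto simp: skew_poly_carrier_iff)
qed

lemma skew_U_carrier: "skew_U X \<in> carrier (skew_poly_alg X \<eta>)"
  unfolding skew_U_def by (rule skew_monom_carrier) simp

text \<open>Right multiplication by \<open>U\<close> only shifts the coefficients, because the
  factor composed with an iterate of \<open>\<eta>\<close> is the constant 1. Written for an already
  shifted sequence, it peels off the constant coefficient.\<close>

lemma skew_poly_mult_U:
  assumes p: "\<And>n. p n \<in> carrier (cont_alg X)" and \<eta>: "continuous_map X X \<eta>"
  shows "(\<lambda>n. p (Suc n)) \<otimes>\<^bsub>skew_poly_alg X \<eta>\<^esub> skew_U X = (\<lambda>n x. if n = 0 then 0 else p n x)"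
proof (intro ext)
  fix n x
  have iter: "(\<eta> ^^ k) x \<in> topspace X" if "x \<in> topspace X" for k
    using that continuous_map_funspace[OF \<eta>] by (induction k) auto
  have "(\<Sum>k\<le>n. p (Suc k) x * skew_U X (n - k) ((\<eta> ^^ k) x)) = (if n = 0 then 0 else p n x)"
  proof (cases n)
    case (Suc m)
    have "(\<Sum>k\<le>n. p (Suc k) x * skew_U X (n - k) ((\<eta> ^^ k) x)) =
        (\<Sum>k\<le>n. if k = m then p (Suc k) x * skew_U X (n - k) ((\<eta> ^^ k) x) else 0)"
      by (intro sum.cong refl) (auto simp: Suc skew_U_def skew_monom_def)
    also have "\<dots> = p n x * skew_U X 1 ((\<eta> ^^ m) x)"
      by (simp add: Suc)
    also have "\<dots> = p n x"
      using p[of n] iter[of m] by (auto simp: skew_U_def skew_monom_def cont_alg_iff)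
    finally show ?thesis
      by (simp add: Suc)
  qed (simp add: skew_U_def skew_monom_def)
  then show "((\<lambda>n. p (Suc n)) \<otimes>\<^bsub>skew_poly_alg X \<eta>\<^esub> skew_U X) n x = (if n = 0 then 0 else p n x)"
    by (simp add: skew_poly_mult)
qed

section \<open>Coefficient maps\<close>

context compact_conjugacy_algebra
begin

abbreviation J :: "('a \<Rightarrow> complex) \<Rightarrow> 'c" where
  "J f \<equiv> \<iota> (skew_monom 0 f)"

abbreviation U :: 'c where
  "U \<equiv> \<iota> (skew_U X)"

abbreviation E :: "nat \<Rightarrow> 'c \<Rightarrow> 'a \<Rightarrow> complex" where
  "E \<equiv> coeff_map X A \<iota> E0"

abbreviation coeff_bound :: "nat \<Rightarrow> real" where
  "coeff_bound n \<equiv> coeff_onorm X A (E n)"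

lemma \<eta>_closed: "x \<in> topspace X \<Longrightarrow> \<eta> x \<in> topspace X"
  using continuous_map_funspace[OF continuous] by auto

lemma \<eta>_iter_closed: "x \<in> topspace X \<Longrightarrow> (\<eta> ^^ k) x \<in> topspace X"
  by (induction k) (auto simp: \<eta>_closed)

lemma incl_closed: "p \<in> carrier (skew_poly_alg X \<eta>) \<Longrightarrow> \<iota> p \<in> carrier A"
  using incl_hom by (auto simp: alg_hom_def)

lemma incl_add:
  "p \<in> carrier (skew_poly_alg X \<eta>) \<Longrightarrow> q \<in> carrier (skew_poly_alg X \<eta>) \<Longrightarrow>
    \<iota> (p \<oplus>\<^bsub>skew_poly_alg X \<eta>\<^esub> q) = \<iota> p \<oplus>\<^bsub>A\<^esub> \<iota> q"
  using incl_hom by (auto simp: alg_hom_def)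

lemma incl_mult:
  "p \<in> carrier (skew_poly_alg X \<eta>) \<Longrightarrow> q \<in> carrier (skew_poly_alg X \<eta>) \<Longrightarrow>
    \<iota> (p \<otimes>\<^bsub>skew_poly_alg X \<eta>\<^esub> q) = \<iota> p \<otimes>\<^bsub>A\<^esub> \<iota> q"
  using incl_hom by (auto simp: alg_hom_def)

lemma incl_smult:
  "p \<in> carrier (skew_poly_alg X \<eta>) \<Longrightarrow> \<iota> (c \<odot>\<^bsub>skew_poly_alg X \<eta>\<^esub> p) = c \<odot>\<^bsub>A\<^esub> \<iota> p"
  using incl_hom by (auto simp: alg_hom_def)

lemma J_closed [simp]: "f \<in> carrier (cont_alg X) \<Longrightarrow> J f \<in> carrier A"
  by (intro incl_closed skew_monom_carrier)

lemma U_closed [simp]: "U \<in> carrier A"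
  by (intro incl_closed skew_U_carrier)

lemma J_add:
  assumes "f \<in> carrier (cont_alg X)" "g \<in> carrier (cont_alg X)"
  shows "J (\<lambda>x. f x + g x) = J f \<oplus>\<^bsub>A\<^esub> J g"
proof -
  have "skew_monom 0 (\<lambda>x. f x + g x) = skew_monom 0 f \<oplus>\<^bsub>skew_poly_alg X \<eta>\<^esub> skew_monom 0 g"
    by (simp add: skew_poly_alg_def skew_monom_def fun_eq_iff)
  then show ?thesis
    using assms by (simp add: incl_add skew_monom_carrier)
qed

lemma J_mult:
  assumes "f \<in> carrier (cont_alg X)" "g \<in> carrier (cont_alg X)"
  shows "J (\<lambda>x. f x * g x) = J f \<otimes>\<^bsub>A\<^esub> J g"
proof -
  have "(\<Sum>k\<le>n. (if k = 0 then f x else 0) * (if n - k = 0 then g ((\<eta> ^^ k) x) else 0)) =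
      (if n = 0 then f x * g x else 0)" for n x
    by (subst sum.mono_neutral_right[where S = "{0}"]) auto
  then have "skew_monom 0 (\<lambda>x. f x * g x) = skew_monom 0 f \<otimes>\<^bsub>skew_poly_alg X \<eta>\<^esub> skew_monom 0 g"
    by (simp add: skew_poly_alg_def skew_monom_def fun_eq_iff)
  then show ?thesis
    using assms by (simp add: incl_mult skew_monom_carrier)
qed

lemma J_smult:
  assumes "f \<in> carrier (cont_alg X)"
  shows "J (\<lambda>x. c * f x) = c \<odot>\<^bsub>A\<^esub> J f"
proof -
  have "skew_monom 0 (\<lambda>x. c * f x) = c \<odot>\<^bsub>skew_poly_alg X \<eta>\<^esub> skew_monom 0 f"
    by (simp add: skew_poly_alg_def skew_monom_def fun_eq_iff)
  then show ?thesis
    using assms by (simp add: incl_smult skew_monom_carrier)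
qed

lemma J_zero [simp]: "J (\<lambda>x. 0) = \<zero>\<^bsub>A\<^esub>"
  using J_smult[of "\<lambda>x. 0" 0] by simp

lemma J_one: "J (\<lambda>x. if x \<in> topspace X then 1 else 0) = \<one>\<^bsub>A\<^esub>"
proof -
  have "skew_monom 0 (\<lambda>x. if x \<in> topspace X then 1 else 0) = \<one>\<^bsub>skew_poly_alg X \<eta>\<^esub>"
    by (auto simp: skew_poly_alg_def skew_monom_def fun_eq_iff)
  then show ?thesis
    by (simp add: incl_one)
qed

lemma U_J:
  assumes "f \<in> carrier (cont_alg X)"
  shows "U \<otimes>\<^bsub>A\<^esub> J f = J (pullback X \<eta> f) \<otimes>\<^bsub>A\<^esub> U"
proof -
  have "pullback X \<eta> f \<in> carrier (cont_alg X)"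
    using assms continuous by (rule cont_alg_pullback)
  then show ?thesis
    using skew_U_covariance[OF assms, of \<eta>] assms
    by (simp add: skew_U_carrier skew_monom_carrier flip: incl_mult pullback_def)
qed

text \<open>Horner's scheme f_0 + (f_1 + (f_2 + ...) U) U, so that only functions and right
  multiplication by \<open>U\<close> have to be handled. With \<open>K\<close> the induction stays
  among polynomials whose coefficients lie in the ideal.\<close>

lemma poly_induct [consumes 2, case_names zero step]:
  assumes p: "\<And>n. p n \<in> vanishing X K" and fin: "finite {n. p n \<noteq> (\<lambda>x. 0)}"
    and zero: "Q \<zero>\<^bsub>A\<^esub>"
    and step: "\<And>f b. f \<in> vanishing X K \<Longrightarrow> b \<in> carrier A \<Longrightarrow> Q b \<Longrightarrow> Q (J f \<oplus>\<^bsub>A\<^esub> b \<otimes>\<^bsub>A\<^esub> U)"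
  shows "Q (\<iota> p)"
proof -
  have "Q (\<iota> p)" if "\<And>n. p n \<in> vanishing X K" "\<And>n. n \<ge> N \<Longrightarrow> p n = (\<lambda>x. 0)" for p N
    using that
  proof (induction N arbitrary: p)
    case 0
    then have "p = skew_monom 0 (\<lambda>x. 0)"
      by (simp add: skew_monom_def fun_eq_iff)
    then show ?case
      using zero by simp
  next
    case (Suc N)
    let ?q = "\<lambda>n. p (Suc n)"
    have "{n. ?q n \<noteq> (\<lambda>x. 0)} \<subseteq> {..<N}"
      using Suc.prems(2) by (auto simp: not_less)
    then have q: "?q \<in> carrier (skew_poly_alg X \<eta>)"
      using Suc.prems(1) finite_subset[OF _ finite_lessThan]
      by (auto simp: skew_poly_carrier_iff vanishing_def)
    have p0: "p 0 \<in> carrier (cont_alg X)"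
      using Suc.prems(1) by (simp add: vanishing_def)
    define r where "r n = (if n = 0 then (\<lambda>x. 0) else p n)" for n
    have qU: "?q \<otimes>\<^bsub>skew_poly_alg X \<eta>\<^esub> skew_U X = r"
      using Suc.prems(1)
      by (subst skew_poly_mult_U[OF _ continuous]) (auto simp: r_def vanishing_def fun_eq_iff)
    have "{n. r n \<noteq> (\<lambda>x. 0)} \<subseteq> {..<Suc N}"
      using Suc.prems(2) by (force simp: not_less r_def)
    then have r: "r \<in> carrier (skew_poly_alg X \<eta>)"
      using Suc.prems(1) finite_subset[OF _ finite_lessThan]
      by (auto simp: skew_poly_carrier_iff vanishing_def r_def)
    have "p = skew_monom 0 (p 0) \<oplus>\<^bsub>skew_poly_alg X \<eta>\<^esub> r"
      by (auto simp: r_def skew_poly_alg_def skew_monom_def fun_eq_iff)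
    then have "\<iota> p = J (p 0) \<oplus>\<^bsub>A\<^esub> \<iota> r"
      by (metis incl_add[OF skew_monom_carrier[OF p0] r])
    also have "\<iota> r = \<iota> ?q \<otimes>\<^bsub>A\<^esub> U"
      using incl_mult[OF q skew_U_carrier] by (simp add: qU)
    finally have "\<iota> p = J (p 0) \<oplus>\<^bsub>A\<^esub> \<iota> ?q \<otimes>\<^bsub>A\<^esub> U" .
    moreover have "Q (\<iota> ?q)"
      using Suc.prems by (intro Suc.IH) auto
    ultimately show ?case
      using step Suc.prems(1) q incl_closed by metis
  qed
  moreover obtain N where "\<And>n. n \<ge> N \<Longrightarrow> p n = (\<lambda>x. 0)"
    using fin unfolding finite_nat_set_iff_bounded by (metis (mono_tags, lifting) mem_Collect_eq not_le)
  ultimately show ?thesis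
    using p by blast
qed

section \<open>The splitting a = E_0(a) + b U and its behaviour under products\<close>

lemma E0_closed: "a \<in> carrier A \<Longrightarrow> E0 a \<in> carrier (cont_alg X)"
  using E0_hom by (auto simp: alg_hom_def)

lemma E0_add: "a \<in> carrier A \<Longrightarrow> b \<in> carrier A \<Longrightarrow> E0 (a \<oplus>\<^bsub>A\<^esub> b) x = E0 a x + E0 b x"
  and E0_mult: "a \<in> carrier A \<Longrightarrow> b \<in> carrier A \<Longrightarrow> E0 (a \<otimes>\<^bsub>A\<^esub> b) x = E0 a x * E0 b x"
  and E0_smult: "a \<in> carrier A \<Longrightarrow> E0 (c \<odot>\<^bsub>A\<^esub> a) x = c * E0 a x"
  using E0_hom by (auto simp: alg_hom_def)

lemma character_E0: "character A (\<lambda>a. E0 a x)"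
  by (simp add: character_def E0_add E0_mult E0_smult)

lemma E0_minus: "a \<in> carrier A \<Longrightarrow> b \<in> carrier A \<Longrightarrow> E0 (a \<ominus>\<^bsub>A\<^esub> b) x = E0 a x - E0 b x"
  by (rule character_minus[OF character_E0])

lemma E0_mult_U: "b \<in> carrier A \<Longrightarrow> E0 (b \<otimes>\<^bsub>A\<^esub> U) x = 0"
  using equalityD2[OF E0_kernel] by (auto simp: subset_iff fun_eq_iff)

lemma E0_U: "E0 U x = 0"
  using E0_mult_U[of "\<one>\<^bsub>A\<^esub>"] by simp

text \<open>No continuity of \<open>E0\<close> is among the axioms. It follows with constant 1,
  since each point evaluation of \<open>E0\<close> is a character.\<close>

lemma E0_bound: "a \<in> carrier A \<Longrightarrow> cmod (E0 a x) \<le> nrm A a"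
  by (rule character_norm_le[OF character_E0])

definition tail :: "'c \<Rightarrow> 'c" where
  "tail a = (THE b. b \<in> carrier A \<and> a = J (E0 a) \<oplus>\<^bsub>A\<^esub> b \<otimes>\<^bsub>A\<^esub> U)"

lemma E_Suc: "E (Suc n) a = E n (tail a)"
  by (simp add: tail_def)

declare coeff_map.simps(2) [simp del]

lemma mult_U_cancel:
  assumes "b \<in> carrier A" "b' \<in> carrier A" "b \<otimes>\<^bsub>A\<^esub> U = b' \<otimes>\<^bsub>A\<^esub> U"
  shows "b = b'"
proof -
  have "(b \<ominus>\<^bsub>A\<^esub> b') \<otimes>\<^bsub>A\<^esub> U = b \<otimes>\<^bsub>A\<^esub> U \<ominus>\<^bsub>A\<^esub> b' \<otimes>\<^bsub>A\<^esub> U"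
    using assms by (simp add: a_minus_def alg.l_distr alg.l_minus)
  then have "(b \<ominus>\<^bsub>A\<^esub> b') \<otimes>\<^bsub>A\<^esub> U = \<zero>\<^bsub>A\<^esub>"
    using assms by (simp add: minus_eq_zero_iff)
  then show ?thesis
    using U_right_regular[of "b \<ominus>\<^bsub>A\<^esub> b'"] assms by (simp add: minus_eq_zero_iff)
qed

lemma E0_decomposition:
  assumes "f \<in> carrier (cont_alg X)" "b \<in> carrier A"
  shows "E0 (J f \<oplus>\<^bsub>A\<^esub> b \<otimes>\<^bsub>A\<^esub> U) = f"
  using assms by (auto simp: fun_eq_iff E0_add E0_mult_U E0_cont)

lemma tail_decomposition:
  assumes "f \<in> carrier (cont_alg X)" "b \<in> carrier A"
  shows "tail (J f \<oplus>\<^bsub>A\<^esub> b \<otimes>\<^bsub>A\<^esub> U) = b"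
  unfolding tail_def E0_decomposition[OF assms]
proof (rule the_equality)
  fix c
  assume "c \<in> carrier A \<and> J f \<oplus>\<^bsub>A\<^esub> b \<otimes>\<^bsub>A\<^esub> U = J f \<oplus>\<^bsub>A\<^esub> c \<otimes>\<^bsub>A\<^esub> U"
  then show "c = b"
    using assms mult_U_cancel[of c b] by (metis J_closed U_closed add_minus_cancel alg.m_closed)
qed (use assms in simp)

text \<open>The element a - E_0(a) lies in the kernel of \<open>E0\<close>, which is the set of
  right multiples of \<open>U\<close>. Right regularity of \<open>U\<close> makes the quotient
  unique and so identifies it with \<open>tail a\<close>.\<close>

lemma decomposition:
  assumes "a \<in> carrier A"
  shows "tail a \<in> carrier A" "a = J (E0 a) \<oplus>\<^bsub>A\<^esub> tail a \<otimes>\<^bsub>A\<^esub> U"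
proof -
  let ?f = "E0 a"
  have f: "?f \<in> carrier (cont_alg X)"
    using assms by (rule E0_closed)
  have "E0 (a \<ominus>\<^bsub>A\<^esub> J ?f) = (\<lambda>x. 0)"
    using assms f by (simp add: fun_eq_iff E0_minus E0_cont)
  then have "a \<ominus>\<^bsub>A\<^esub> J ?f \<in> {a \<in> carrier A. E0 a = \<zero>\<^bsub>cont_alg X\<^esub>}"
    using assms f by simp
  then obtain b where b: "b \<in> carrier A" "a \<ominus>\<^bsub>A\<^esub> J ?f = b \<otimes>\<^bsub>A\<^esub> U"
    unfolding E0_kernel by auto
  have "a = J ?f \<oplus>\<^bsub>A\<^esub> (a \<ominus>\<^bsub>A\<^esub> J ?f)"
    using assms f by (simp add: alg.ring_simprules)
  then have a: "a = J ?f \<oplus>\<^bsub>A\<^esub> b \<otimes>\<^bsub>A\<^esub> U"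
    using b by simp
  then have "tail a = b"
    using tail_decomposition[OF f b(1)] by simp
  then show "tail a \<in> carrier A" "a = J ?f \<oplus>\<^bsub>A\<^esub> tail a \<otimes>\<^bsub>A\<^esub> U"
    using a b by auto
qed

lemmas tail_closed [simp] = decomposition(1)

lemma tail_add:
  assumes "a \<in> carrier A" "b \<in> carrier A"
  shows "tail (a \<oplus>\<^bsub>A\<^esub> b) = tail a \<oplus>\<^bsub>A\<^esub> tail b"
proof -
  have "a \<oplus>\<^bsub>A\<^esub> b = (J (E0 a) \<oplus>\<^bsub>A\<^esub> tail a \<otimes>\<^bsub>A\<^esub> U) \<oplus>\<^bsub>A\<^esub> (J (E0 b) \<oplus>\<^bsub>A\<^esub> tail b \<otimes>\<^bsub>A\<^esub> U)"
    using assms decomposition(2) by metis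
  also have "\<dots> = J (\<lambda>x. E0 a x + E0 b x) \<oplus>\<^bsub>A\<^esub> (tail a \<oplus>\<^bsub>A\<^esub> tail b) \<otimes>\<^bsub>A\<^esub> U"
    using assms by (simp add: J_add E0_closed alg.ring_simprules)
  finally show ?thesis
    using assms by (simp add: tail_decomposition E0_closed cont_alg_add)
qed

lemma tail_smult:
  assumes "a \<in> carrier A"
  shows "tail (c \<odot>\<^bsub>A\<^esub> a) = c \<odot>\<^bsub>A\<^esub> tail a"
proof -
  have "c \<odot>\<^bsub>A\<^esub> a = c \<odot>\<^bsub>A\<^esub> (J (E0 a) \<oplus>\<^bsub>A\<^esub> tail a \<otimes>\<^bsub>A\<^esub> U)"
    using assms decomposition(2) by metis
  also have "\<dots> = J (\<lambda>x. c * E0 a x) \<oplus>\<^bsub>A\<^esub> (c \<odot>\<^bsub>A\<^esub> tail a) \<otimes>\<^bsub>A\<^esub> U"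
    using assms by (simp add: J_smult E0_closed smult_right_distrib smult_mult_left)
  finally show ?thesis
    using assms by (simp add: tail_decomposition E0_closed cont_alg_smult)
qed

lemma tail_J: "f \<in> carrier (cont_alg X) \<Longrightarrow> tail (J f) = \<zero>\<^bsub>A\<^esub>"
  using tail_decomposition[of f "\<zero>\<^bsub>A\<^esub>"] by simp

lemma tail_mult_U: "b \<in> carrier A \<Longrightarrow> tail (b \<otimes>\<^bsub>A\<^esub> U) = b"
  using tail_decomposition[of "\<lambda>x. 0" b] by simp

lemma tail_minus: "a \<in> carrier A \<Longrightarrow> b \<in> carrier A \<Longrightarrow> tail (a \<ominus>\<^bsub>A\<^esub> b) = tail a \<ominus>\<^bsub>A\<^esub> tail b"
  by (simp add: a_minus_def tail_add tail_smult flip: smult_minus1)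

lemma E_add: "a \<in> carrier A \<Longrightarrow> b \<in> carrier A \<Longrightarrow> E n (a \<oplus>\<^bsub>A\<^esub> b) x = E n a x + E n b x"
  by (induction n arbitrary: a b) (auto simp: E0_add E_Suc tail_add)

lemma E_smult: "a \<in> carrier A \<Longrightarrow> E n (c \<odot>\<^bsub>A\<^esub> a) x = c * E n a x"
  by (induction n arbitrary: a) (auto simp: E0_smult E_Suc tail_smult)

lemma E_zero: "E n \<zero>\<^bsub>A\<^esub> x = 0"
  using E_smult[of "\<zero>\<^bsub>A\<^esub>" n 0 x] by simp

lemma E_J: "f \<in> carrier (cont_alg X) \<Longrightarrow> E n (J f) x = (if n = 0 then f x else 0)"
  by (cases n) (auto simp: E0_cont E_Suc tail_J E_zero)

lemma E_mult_U: "b \<in> carrier A \<Longrightarrow> E n (b \<otimes>\<^bsub>A\<^esub> U) x = (if n = 0 then 0 else E (n - 1) b x)"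
  by (cases n) (auto simp: E0_mult_U E_Suc tail_mult_U)

text \<open>The extension of f |-> f o \<eta> from functions to the whole algebra, designed to
  satisfy U c = shift(c) U. It is read off from c = E_0(c) + tail(c) U by moving \<open>U\<close>
  past each term.\<close>

definition shift :: "'c \<Rightarrow> 'c" where
  "shift c = J (pullback X \<eta> (E0 c)) \<oplus>\<^bsub>A\<^esub> U \<otimes>\<^bsub>A\<^esub> tail c"

lemma pullback_E0: "c \<in> carrier A \<Longrightarrow> pullback X \<eta> (E0 c) \<in> carrier (cont_alg X)"
  using cont_alg_pullback[OF E0_closed continuous] .

lemma shift_closed [simp]: "c \<in> carrier A \<Longrightarrow> shift c \<in> carrier A"
  by (simp add: shift_def pullback_E0)

lemma U_mult: "c \<in> carrier A \<Longrightarrow> U \<otimes>\<^bsub>A\<^esub> c = shift c \<otimes>\<^bsub>A\<^esub> U"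
proof -
  assume c: "c \<in> carrier A"
  have "U \<otimes>\<^bsub>A\<^esub> c = U \<otimes>\<^bsub>A\<^esub> (J (E0 c) \<oplus>\<^bsub>A\<^esub> tail c \<otimes>\<^bsub>A\<^esub> U)"
    using c decomposition(2) by metis
  also have "\<dots> = shift c \<otimes>\<^bsub>A\<^esub> U"
    using c by (simp add: shift_def E0_closed alg.r_distr alg.l_distr U_J pullback_E0 alg.m_assoc)
  finally show ?thesis .
qed

lemma tail_U_mult: "c \<in> carrier A \<Longrightarrow> tail (U \<otimes>\<^bsub>A\<^esub> c) = shift c"
  by (simp add: U_mult tail_mult_U)

text \<open>Induction along the coefficients works because \<open>tail\<close> commutes with
  \<open>shift\<close>.\<close>

lemma E_shift:
  assumes "c \<in> carrier A" "x \<in> topspace X"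
  shows "E n (shift c) x = E n c (\<eta> x)"
  using assms(1)
proof (induction n arbitrary: c)
  case 0
  then show ?case
    using assms(2) by (simp add: shift_def pullback_E0 E0_add E0_cont E0_mult E0_U)
next
  case (Suc n)
  have "tail (shift c) = shift (tail c)"
    unfolding shift_def[of c]
    using Suc.prems by (simp add: tail_add pullback_E0 tail_J tail_U_mult)
  then show ?case
    using Suc by (simp add: E_Suc)
qed

text \<open>A twisted Leibniz rule: \<open>tail\<close> is a derivation with \<open>E0\<close>
  acting on the left and \<open>shift\<close> on the right.\<close>

lemma tail_mult:
  assumes a: "a \<in> carrier A" and c: "c \<in> carrier A"
  shows "tail (a \<otimes>\<^bsub>A\<^esub> c) = J (E0 a) \<otimes>\<^bsub>A\<^esub> tail c \<oplus>\<^bsub>A\<^esub> tail a \<otimes>\<^bsub>A\<^esub> shift c"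
proof -
  let ?f = "E0 a" and ?g = "E0 c"
  have "a \<otimes>\<^bsub>A\<^esub> c = (J ?f \<oplus>\<^bsub>A\<^esub> tail a \<otimes>\<^bsub>A\<^esub> U) \<otimes>\<^bsub>A\<^esub> c"
    using a decomposition(2) by metis
  also have "\<dots> = J ?f \<otimes>\<^bsub>A\<^esub> c \<oplus>\<^bsub>A\<^esub> (tail a \<otimes>\<^bsub>A\<^esub> shift c) \<otimes>\<^bsub>A\<^esub> U"
    using a c by (simp add: E0_closed alg.l_distr alg.m_assoc U_mult)
  also have "J ?f \<otimes>\<^bsub>A\<^esub> c = J ?f \<otimes>\<^bsub>A\<^esub> (J ?g \<oplus>\<^bsub>A\<^esub> tail c \<otimes>\<^bsub>A\<^esub> U)"
    using c decomposition(2) by metis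
  also have "\<dots> = J (\<lambda>x. ?f x * ?g x) \<oplus>\<^bsub>A\<^esub> (J ?f \<otimes>\<^bsub>A\<^esub> tail c) \<otimes>\<^bsub>A\<^esub> U"
    using a c by (simp add: E0_closed alg.r_distr alg.m_assoc J_mult)
  also have "\<dots> \<oplus>\<^bsub>A\<^esub> (tail a \<otimes>\<^bsub>A\<^esub> shift c) \<otimes>\<^bsub>A\<^esub> U =
      J (\<lambda>x. ?f x * ?g x) \<oplus>\<^bsub>A\<^esub> (J ?f \<otimes>\<^bsub>A\<^esub> tail c \<oplus>\<^bsub>A\<^esub> tail a \<otimes>\<^bsub>A\<^esub> shift c) \<otimes>\<^bsub>A\<^esub> U"
    using a c by (simp add: E0_closed alg.l_distr alg.a_assoc cont_alg_mult)
  finally show ?thesis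
    using a c by (simp add: tail_decomposition E0_closed cont_alg_mult)
qed

lemma E_J_mult:
  assumes "f \<in> carrier (cont_alg X)" "c \<in> carrier A"
  shows "E n (J f \<otimes>\<^bsub>A\<^esub> c) x = f x * E n c x"
  using assms(2)
proof (induction n arbitrary: c)
  case 0
  then show ?case
    using assms(1) by (simp add: E0_mult E0_cont)
next
  case (Suc n)
  then show ?case
    using assms(1) by (simp add: E_Suc tail_mult E0_cont tail_J)
qed

text \<open>The product formula for skew polynomials carries over to all elements by pure algebra:
  iterate the twisted Leibniz rule, each application of \<open>shift\<close> contributing one
  application of \<open>\<eta>\<close> to the argument.\<close>

lemma E_mult:
  assumes "a \<in> carrier A" "c \<in> carrier A" "x \<in> topspace X"
  shows "E n (a \<otimes>\<^bsub>A\<^esub> c) x = (\<Sum>k\<le>n. E k a x * E (n - k) c ((\<eta> ^^ k) x))"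
  using assms(1,2)
proof (induction n arbitrary: a c)
  case 0
  then show ?case
    by (simp add: E0_mult)
next
  case (Suc n)
  have "E (Suc n) (a \<otimes>\<^bsub>A\<^esub> c) x =
      E 0 a x * E (Suc n) c x + (\<Sum>k\<le>n. E k (tail a) x * E (n - k) (shift c) ((\<eta> ^^ k) x))"
    using Suc by (simp add: E_Suc tail_mult E_add E_J_mult E0_closed)
  also have "(\<Sum>k\<le>n. E k (tail a) x * E (n - k) (shift c) ((\<eta> ^^ k) x)) =
      (\<Sum>k\<le>n. E (Suc k) a x * E (Suc n - Suc k) c ((\<eta> ^^ Suc k) x))"
    using Suc.prems assms(3) by (simp add: E_Suc E_shift \<eta>_iter_closed)
  finally show ?case
    by (subst sum.atMost_Suc_shift) simp
qed

text \<open>The algebra is, as a vector space, C(X) plus a copy of itself. The corresponding sum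
  norm is complete because C(X) is closed, and it dominates the given norm, so the bounded inverse
  theorem makes the two equivalent.\<close>

lemma tail_bounded:
  obtains M where "\<And>a. a \<in> carrier A \<Longrightarrow> nrm A (tail a) \<le> M * nrm A a"
proof -
  define N where "N a = nrm A (J (E0 a)) + nrm A (tail a)" for a
  have JE0_minus: "J (E0 (a \<ominus>\<^bsub>A\<^esub> b)) = J (E0 a) \<ominus>\<^bsub>A\<^esub> J (E0 b)" if "a \<in> carrier A" "b \<in> carrier A" for a b
  proof -
    have "E0 (a \<ominus>\<^bsub>A\<^esub> b) = (\<lambda>x. E0 a x + (-1) * E0 b x)"
      using that by (simp add: fun_eq_iff E0_minus)
    then have "J (E0 (a \<ominus>\<^bsub>A\<^esub> b)) = J (E0 a) \<oplus>\<^bsub>A\<^esub> J (\<lambda>x. (-1) * E0 b x)"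
      using that J_add[of "E0 a" "\<lambda>x. (-1) * E0 b x"] cont_alg_smult[of "E0 b" X "-1"] E0_closed by simp
    also have "J (\<lambda>x. (-1) * E0 b x) = \<ominus>\<^bsub>A\<^esub> J (E0 b)"
      using that J_smult[of "E0 b" "-1"] by (simp add: E0_closed smult_minus1)
    finally show ?thesis
      by (simp add: a_minus_def)
  qed
  \<comment> \<open>The constant comes from the norm of E_0(a) + tail(a) U, where the two summands
    are weighted by 1 and by the norm of \<open>U\<close>.\<close>
  obtain M where M: "\<And>a. a \<in> carrier A \<Longrightarrow> N a \<le> M * nrm A a"
  proof (rule complete_norm_dominated[of N "max 1 (nrm A U)"])
    fix a b
    assume ab: "a \<in> carrier A" "b \<in> carrier A"
    show "N (a \<ominus>\<^bsub>A\<^esub> b) \<le> N a + N b"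
      using ab nrm_minus_le[of "J (E0 a)" "J (E0 b)"] nrm_minus_le[of "tail a" "tail b"]
      by (simp add: N_def JE0_minus tail_minus E0_closed)
  next
    fix c a
    assume a: "a \<in> carrier A"
    have "E0 (c \<odot>\<^bsub>A\<^esub> a) = (\<lambda>x. c * E0 a x)"
      using a by (simp add: fun_eq_iff E0_smult)
    then show "N (c \<odot>\<^bsub>A\<^esub> a) = cmod c * N a"
      using a by (simp add: N_def J_smult E0_closed tail_smult nrm_smult algebra_simps)
  next
    fix a
    assume a: "a \<in> carrier A"
    have "nrm A a = nrm A (J (E0 a) \<oplus>\<^bsub>A\<^esub> tail a \<otimes>\<^bsub>A\<^esub> U)"
      using a decomposition(2) by metis
    also have "\<dots> \<le> nrm A (J (E0 a)) + nrm A (tail a \<otimes>\<^bsub>A\<^esub> U)"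
      using a by (intro nrm_add) (auto simp: E0_closed)
    also have "nrm A (tail a \<otimes>\<^bsub>A\<^esub> U) \<le> nrm A (tail a) * nrm A U"
      using a by (simp add: nrm_mult)
    also have "nrm A (J (E0 a)) + nrm A (tail a) * nrm A U \<le>
        nrm A (J (E0 a)) * max 1 (nrm A U) + nrm A (tail a) * max 1 (nrm A U)"
      using a mult_left_mono[of 1 "max 1 (nrm A U)" "nrm A (J (E0 a))"]
      by (intro add_mono mult_left_mono) (auto simp: nrm_nonneg E0_closed)
    finally show "nrm A a \<le> max 1 (nrm A U) * N a"
      by (simp add: N_def algebra_simps)
  next
    fix s :: "nat \<Rightarrow> 'c"
    assume s: "\<And>n. s n \<in> carrier A" and summable: "summable (\<lambda>n. N (s (Suc n) \<ominus>\<^bsub>A\<^esub> s n))"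
    have "summable (\<lambda>n. nrm A (J (E0 (s (Suc n))) \<ominus>\<^bsub>A\<^esub> J (E0 (s n))))"
      by (rule summable_comparison_test'[OF summable])
        (use s in \<open>auto simp: N_def JE0_minus tail_minus nrm_nonneg E0_closed\<close>)
    then obtain g where g: "g \<in> carrier A" "(\<lambda>n. nrm A (J (E0 (s n)) \<ominus>\<^bsub>A\<^esub> g)) \<longlonglongrightarrow> 0"
      using convergent_if_summable[of "\<lambda>n. J (E0 (s n))"] s by (auto simp: E0_closed)
    have "summable (\<lambda>n. nrm A (tail (s (Suc n)) \<ominus>\<^bsub>A\<^esub> tail (s n)))"
      by (rule summable_comparison_test'[OF summable])
        (use s in \<open>auto simp: N_def JE0_minus tail_minus nrm_nonneg E0_closed\<close>)
    then obtain b where b: "b \<in> carrier A" "(\<lambda>n. nrm A (tail (s n) \<ominus>\<^bsub>A\<^esub> b)) \<longlonglongrightarrow> 0"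
      using convergent_if_summable[of "\<lambda>n. tail (s n)"] s by auto
    \<comment> \<open>The limit \<open>g\<close> of the zeroth coefficients is approximated by
      functions, and it is again a function because C(X) is closed in the algebra.\<close>
    have "\<exists>h\<in>J ` carrier (cont_alg X). nrm A (g \<ominus>\<^bsub>A\<^esub> h) < e" if "e > 0" for e
    proof -
      have "\<forall>\<^sub>F n in sequentially. nrm A (J (E0 (s n)) \<ominus>\<^bsub>A\<^esub> g) < e"
        using order_tendstoD(2)[OF g(2) that] .
      then obtain n where "nrm A (J (E0 (s n)) \<ominus>\<^bsub>A\<^esub> g) < e"
        by (auto simp: eventually_sequentially)
      then show ?thesis
        using s g(1) nrm_minus_commute[OF g(1), of "J (E0 (s n))"]
        by (intro bexI[of _ "J (E0 (s n))"] imageI) (simp_all add: E0_closed)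
    qed
    then obtain f where f: "f \<in> carrier (cont_alg X)" "g = J f"
      using cont_closed g(1) unfolding closedin_iff by auto
    show "\<exists>l\<in>carrier A. (\<lambda>n. N (s n \<ominus>\<^bsub>A\<^esub> l)) \<longlonglongrightarrow> 0"
    proof
      let ?l = "J f \<oplus>\<^bsub>A\<^esub> b \<otimes>\<^bsub>A\<^esub> U"
      show "?l \<in> carrier A"
        using f b by simp
      have "N (s n \<ominus>\<^bsub>A\<^esub> ?l) = nrm A (J (E0 (s n)) \<ominus>\<^bsub>A\<^esub> g) + nrm A (tail (s n) \<ominus>\<^bsub>A\<^esub> b)" for n
        using f b s by (simp add: N_def JE0_minus tail_minus E0_decomposition tail_decomposition)
      then show "(\<lambda>n. N (s n \<ominus>\<^bsub>A\<^esub> ?l)) \<longlonglongrightarrow> 0"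
        using tendsto_add[OF g(2) b(2)] by simp
    qed
  qed blast
  have "nrm A (tail a) \<le> M * nrm A a" if "a \<in> carrier A" for a
    using M[OF that] nrm_nonneg[of "J (E0 a)"] that by (simp add: N_def E0_closed)
  then show ?thesis
    using that by blast
qed

lemma E_bounded:
  obtains M where "M \<ge> 0" "\<And>a x. a \<in> carrier A \<Longrightarrow> cmod (E n a x) \<le> M * nrm A a"
proof -
  obtain T where "\<And>a. a \<in> carrier A \<Longrightarrow> nrm A (tail a) \<le> T * nrm A a"
    using tail_bounded by blast
  moreover have "T * nrm A a \<le> max 0 T * nrm A a" if "a \<in> carrier A" for a
    using that by (intro mult_right_mono) (auto simp: nrm_nonneg)
  ultimately have T: "\<And>a. a \<in> carrier A \<Longrightarrow> nrm A (tail a) \<le> max 0 T * nrm A a"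
    by force
  have "\<exists>M\<ge>0. \<forall>a\<in>carrier A. \<forall>x. cmod (E n a x) \<le> M * nrm A a"
  proof (induction n)
    case 0
    show ?case
      using E0_bound by (intro exI[of _ 1]) auto
  next
    case (Suc n)
    then obtain M where M: "M \<ge> 0" "\<forall>a\<in>carrier A. \<forall>x. cmod (E n a x) \<le> M * nrm A a"
      by blast
    have "cmod (E (Suc n) a x) \<le> M * max 0 T * nrm A a" if a: "a \<in> carrier A" for a x
    proof -
      have "cmod (E n (tail a) x) \<le> M * nrm A (tail a)"
        using M(2) a by simp
      also have "\<dots> \<le> M * (max 0 T * nrm A a)"
        using T[OF a] M(1) by (rule mult_left_mono)
      finally show ?thesis
        by (simp add: E_Suc mult.assoc)
    qed
    then show ?case
      using M(1) by (intro exI[of _ "M * max 0 T"]) auto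
  qed
  then show ?thesis
    using that by blast
qed

section \<open>Operator norms of the coefficient maps and the disc of convergence\<close>

lemma E_le_sup_norm:
  assumes "a \<in> carrier A" "x \<in> topspace X"
  shows "cmod (E n a x) \<le> sup_norm X (E n a)"
proof -
  obtain M where "M \<ge> 0" "\<And>a x. a \<in> carrier A \<Longrightarrow> cmod (E n a x) \<le> M * nrm A a"
    using E_bounded by blast
  then have "bdd_above (insert 0 ((\<lambda>x. cmod (E n a x)) ` topspace X))"
    using assms(1) by (auto intro!: bdd_aboveI[of _ "M * nrm A a"] simp: nrm_nonneg)
  then show ?thesis
    unfolding sup_norm_def using assms(2) by (auto intro: cSup_upper)
qed

text \<open>The operator norm is a supremum of reals and bounds the quotients only if these are
  bounded. This is what gives the growth condition its content.\<close>

lemma bdd_above_coeff: "bdd_above ((\<lambda>a. sup_norm X (E n a) / nrm A a) ` carrier A)"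
proof -
  obtain M where M: "M \<ge> 0" "\<And>a x. a \<in> carrier A \<Longrightarrow> cmod (E n a x) \<le> M * nrm A a"
    using E_bounded by blast
  have "sup_norm X (E n a) / nrm A a \<le> M" if a: "a \<in> carrier A" for a
  proof -
    have "sup_norm X (E n a) \<le> M * nrm A a"
      unfolding sup_norm_def using M a by (intro cSup_least) (auto simp: nrm_nonneg)
    then show ?thesis
      using M(1) nrm_nonneg[OF a] by (cases "nrm A a = 0") (auto simp: field_simps)
  qed
  then show ?thesis
    by (auto intro!: bdd_aboveI)
qed

lemma coeff_bound:
  assumes a: "a \<in> carrier A" and x: "x \<in> topspace X"
  shows "cmod (E n a x) \<le> coeff_bound n * nrm A a"
proof (cases "nrm A a = 0")
  case True
  then have "a = \<zero>\<^bsub>A\<^esub>"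
    using a nrm_eq_zero by simp
  then show ?thesis
    by (simp add: E_zero)
next
  case False
  have "sup_norm X (E n a) / nrm A a \<le> coeff_bound n"
    unfolding coeff_onorm_def using bdd_above_coeff a by (intro cSUP_upper)
  then have "sup_norm X (E n a) \<le> coeff_bound n * nrm A a"
    using False nrm_nonneg[OF a] by (simp add: field_simps)
  then show ?thesis
    using E_le_sup_norm[OF a x, of n] by linarith
qed

lemma coeff_bound_nonneg: "0 \<le> coeff_bound n"
  unfolding coeff_onorm_def by (rule cSUP_upper2[OF bdd_above_coeff alg.zero_closed]) simp

lemma character_power_le:
  assumes \<theta>: "character A \<theta>" and one: "\<theta> \<one>\<^bsub>A\<^esub> = 1"
  shows "cmod (\<theta> U) ^ n \<le> nrm A (U [^]\<^bsub>A\<^esub> n)"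
proof -
  have "\<theta> (U [^]\<^bsub>A\<^esub> n) = \<theta> U ^ n"
    by (induction n) (simp_all add: one character_mult[OF \<theta>])
  then show ?thesis
    using character_norm_le[OF \<theta>, of "U [^]\<^bsub>A\<^esub> n"] by (simp add: norm_power)
qed

text \<open>At such \<open>z\<close> the series of \<open>E n a x * z ^ n\<close> converges
  absolutely for every element \<open>a\<close> and every point \<open>x\<close>, with the same
  dominating series up to the factor \<open>nrm A a\<close>.\<close>

definition admissible :: "complex \<Rightarrow> bool" where
  "admissible z \<longleftrightarrow> summable (\<lambda>n. coeff_bound n * cmod z ^ n)"

lemma admissible_0: "admissible 0"
  unfolding admissible_def by (rule summable_finite[of "{0}"]) auto

text \<open>For every \<rho> > 1 the growth condition bounds the product of the norms of
  \<open>E n\<close> and \<open>U^n\<close> by \<rho>^n eventually, while automatic continuity gives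
  |\<theta>(U)|^n \<le> ||U^n||. Together, the norm of \<open>E n\<close> times |z|^n is at most
  (\<rho> |z| / |\<theta>(U)|)^n, a convergent geometric series if \<rho> is close to 1.\<close>

lemma admissible_if_less:
  assumes \<theta>: "character A \<theta>" and one: "\<theta> \<one>\<^bsub>A\<^esub> = 1" and less: "cmod z < cmod (\<theta> U)"
  shows "admissible z"
proof -
  define w where "w = cmod (\<theta> U)"
  have "w > 0"
    using less by (auto simp: w_def intro: le_less_trans[OF norm_ge_zero])
  \<comment> \<open>Any \<rho> strictly between 1 and w / |z| will do. For z = 0 the upper limit
    disappears.\<close>
  obtain \<rho> where \<rho>: "\<rho> > 1" "\<rho> * (cmod z / w) < 1"
  proof (cases "cmod z = 0")
    case True
    then show ?thesis
      using that[of 2] by simp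
  next
    case False
    then have "1 < w / cmod z"
      using less by (simp add: w_def)
    then obtain \<rho> where "1 < \<rho>" "\<rho> < w / cmod z"
      using dense by blast
    then show ?thesis
      using that[of \<rho>] False \<open>w > 0\<close> by (simp add: field_simps)
  qed
  let ?c = "\<lambda>n. coeff_bound n * nrm A (U [^]\<^bsub>A\<^esub> n)"
  have "limsup (\<lambda>n. ereal (root n (?c n))) < ereal \<rho>"
    by (rule le_less_trans[OF limsup_coeff]) (use \<rho>(1) in simp)
  then have ev: "\<forall>\<^sub>F n in sequentially. ereal (root n (?c n)) < ereal \<rho>"
    by (rule Limsup_lessD)
  have "\<forall>\<^sub>F n in sequentially. norm (coeff_bound n * cmod z ^ n) \<le> (\<rho> * (cmod z / w)) ^ n"
    using ev eventually_gt_at_top[of 0]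
  proof eventually_elim
    case (elim n)
    have nonneg: "0 \<le> ?c n"
      by (simp add: coeff_bound_nonneg nrm_nonneg)
    have "?c n = root n (?c n) ^ n"
      using elim(2) nonneg by simp
    also have "\<dots> \<le> \<rho> ^ n"
      using elim nonneg by (intro power_mono) auto
    finally have c: "?c n \<le> \<rho> ^ n" .
    have "coeff_bound n * cmod z ^ n = coeff_bound n * w ^ n * (cmod z / w) ^ n"
      using \<open>w > 0\<close> by (simp add: power_divide)
    also have "\<dots> \<le> ?c n * (cmod z / w) ^ n"
      using character_power_le[OF \<theta> one, of n] \<open>w > 0\<close>
      by (intro mult_right_mono mult_left_mono) (auto simp: w_def coeff_bound_nonneg)
    also have "\<dots> \<le> \<rho> ^ n * (cmod z / w) ^ n"
      using c \<open>w > 0\<close> by (intro mult_right_mono) auto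
    finally show ?case
      using coeff_bound_nonneg[of n] unfolding power_mult_distrib
      by (simp add: abs_mult del: times_divide_eq_right)
  qed
  moreover have "summable (\<lambda>n. (\<rho> * (cmod z / w)) ^ n)"
    using \<rho> \<open>w > 0\<close> by (intro summable_geometric) simp
  ultimately show ?thesis
    unfolding admissible_def by (rule summable_comparison_test_ev)
qed

end

section \<open>Characters of conjugacy algebras\<close>

context compact_conjugacy_algebra
begin

definition point_char :: "'a \<Rightarrow> complex \<Rightarrow> 'c \<Rightarrow> complex" where
  "point_char x z a = (\<Sum>n. E n a x * z ^ n)"

text \<open>For nonzero \<open>z\<close> this is the difference quotient (point_char(x, z) - E_0(x))
  / z; as a series it also has a value at z = 0, namely E_1 at x.\<close>

definition point_deriv :: "'a \<Rightarrow> complex \<Rightarrow> 'c \<Rightarrow> complex" where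
  "point_deriv x z a = (\<Sum>n. E (Suc n) a x * z ^ n)"

definition char_over :: "('c \<Rightarrow> complex) \<Rightarrow> 'a \<Rightarrow> bool" where
  "char_over \<theta> x \<longleftrightarrow> character A \<theta> \<and> x \<in> topspace X \<and> (\<forall>f\<in>carrier (cont_alg X). \<theta> (J f) = f x)"

lemma char_over_character: "char_over \<theta> x \<Longrightarrow> character A \<theta>"
  and char_over_topspace: "char_over \<theta> x \<Longrightarrow> x \<in> topspace X"
  and char_over_J: "char_over \<theta> x \<Longrightarrow> f \<in> carrier (cont_alg X) \<Longrightarrow> \<theta> (J f) = f x"
  by (simp_all add: char_over_def)

lemma char_over_one: "char_over \<theta> x \<Longrightarrow> \<theta> \<one>\<^bsub>A\<^esub> = 1"
  by (simp add: char_over_def flip: J_one)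

lemma summable_E:
  assumes "admissible z" "a \<in> carrier A" "x \<in> topspace X"
  shows "summable (\<lambda>n. norm (E n a x * z ^ n))"
proof (rule summable_comparison_test')
  show "summable (\<lambda>n. nrm A a * (coeff_bound n * cmod z ^ n))"
    using assms(1) unfolding admissible_def by (rule summable_mult)
  show "norm (norm (E n a x * z ^ n)) \<le> nrm A a * (coeff_bound n * cmod z ^ n)" for n
    using mult_right_mono[OF coeff_bound[OF assms(2,3), of n], of "cmod z ^ n"]
    by (simp add: norm_mult norm_power algebra_simps)
qed

lemma summable_E_Suc:
  assumes "admissible z" "a \<in> carrier A" "x \<in> topspace X"
  shows "summable (\<lambda>n. norm (E (Suc n) a x * z ^ n))"
proof (cases "z = 0")
  case True
  then show ?thesis
    by (intro summable_finite[of "{0}"]) auto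
next
  case False
  have "summable (\<lambda>n. norm (E (Suc n) a x * z ^ Suc n))"
    using summable_E[OF assms] by (subst summable_Suc_iff)
  then have "summable (\<lambda>n. norm (inverse z) * norm (E (Suc n) a x * z ^ Suc n))"
    by (rule summable_mult)
  moreover have "norm (inverse z) * norm (E (Suc n) a x * z ^ Suc n) = norm (E (Suc n) a x * z ^ n)" for n
    using False by (simp add: norm_mult norm_power norm_inverse)
  ultimately show ?thesis
    by (simp only:)
qed

lemma point_char_0: "point_char x 0 a = E0 a x"
  unfolding point_char_def by (subst powser_zero) simp

text \<open>At a fixed point all iterates of \<open>x\<close> coincide, and the skew product formula
  becomes the Cauchy product of power series. For z = 0 only multiplicativity of \<open>E0\<close>
  is at stake.\<close>

lemma char_over_point_char:
  assumes z: "admissible z" and x: "x \<in> topspace X" and fixed: "z = 0 \<or> \<eta> x = x"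
  shows "char_over (point_char x z) x"
proof -
  note summable = summable_norm_cancel[OF summable_E[OF z _ x]]
  have "point_char x z (a \<otimes>\<^bsub>A\<^esub> c) = point_char x z a * point_char x z c"
    if "a \<in> carrier A" "c \<in> carrier A" for a c
  proof (cases "z = 0")
    case True
    then show ?thesis
      using that by (simp add: point_char_0 E0_mult)
  next
    case False
    then have iter: "(\<eta> ^^ k) x = x" for k
      using fixed by (induction k) auto
    have "E n (a \<otimes>\<^bsub>A\<^esub> c) x * z ^ n = (\<Sum>k\<le>n. (E k a x * z ^ k) * (E (n - k) c x * z ^ (n - k)))" for n
      unfolding E_mult[OF that x] sum_distrib_right
      by (intro sum.cong refl) (simp add: iter algebra_simps flip: power_add)
    then show ?thesis
      unfolding point_char_def
      using Cauchy_product[OF summable_E[OF z that(1) x] summable_E[OF z that(2) x]] by simp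
  qed
  moreover have "point_char x z (a \<oplus>\<^bsub>A\<^esub> c) = point_char x z a + point_char x z c"
    if "a \<in> carrier A" "c \<in> carrier A" for a c
    unfolding point_char_def
    using suminf_add[OF summable[OF that(1)] summable[OF that(2)]] that
    by (simp add: E_add algebra_simps)
  moreover have "point_char x z (c \<odot>\<^bsub>A\<^esub> a) = c * point_char x z a" if "a \<in> carrier A" for c a
    unfolding point_char_def
    using suminf_mult[OF summable[OF that], of c] that by (simp add: E_smult algebra_simps)
  moreover have "point_char x z (J f) = f x" if "f \<in> carrier (cont_alg X)" for f
    unfolding point_char_def using suminf_finite[of "{0}" "\<lambda>n. E n (J f) x * z ^ n"] that
    by (simp add: E_J E0_cont)
  ultimately show ?thesis
    using x by (simp add: char_over_def character_def)
qed

lemma char_over_E0: "x \<in> topspace X \<Longrightarrow> char_over (\<lambda>a. E0 a x) x"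
  using char_over_point_char[OF admissible_0, of x] by (simp add: point_char_0[abs_def])

lemma E_U: "E n U x = (if n = 1 \<and> x \<in> topspace X then 1 else 0)"
proof -
  have "E n U x = E n (J (\<lambda>x. if x \<in> topspace X then 1 else 0) \<otimes>\<^bsub>A\<^esub> U) x"
    by (simp add: J_one)
  also have "\<dots> = (if n = 1 \<and> x \<in> topspace X then 1 else 0)"
    by (subst E_mult_U) (auto simp: E_J E0_cont)
  finally show ?thesis .
qed

lemma point_char_U: "x \<in> topspace X \<Longrightarrow> point_char x z U = z"
  unfolding point_char_def using suminf_finite[of "{1}" "\<lambda>n. E n U x * z ^ n"] by (simp add: E_U)

lemma point_deriv_add:
  assumes "admissible z" "x \<in> topspace X" "a \<in> carrier A" "c \<in> carrier A"
  shows "point_deriv x z (a \<oplus>\<^bsub>A\<^esub> c) = point_deriv x z a + point_deriv x z c"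
  unfolding point_deriv_def
  using suminf_add[OF summable_norm_cancel[OF summable_E_Suc[OF assms(1,3,2)]]
      summable_norm_cancel[OF summable_E_Suc[OF assms(1,4,2)]]] assms
  by (simp add: E_add algebra_simps)

text \<open>Splitting off the term k = 0 in the product formula leaves coefficients of
  \<open>c\<close> at the iterates of \<eta>(x). When \<eta>(x) is fixed these are all taken at
  \<eta>(x), and the remaining sum is a Cauchy product.\<close>

lemma point_deriv_mult:
  assumes z: "admissible z" and x: "x \<in> topspace X" and fixed: "z = 0 \<or> \<eta> (\<eta> x) = \<eta> x"
    and a: "a \<in> carrier A" and c: "c \<in> carrier A"
  shows "point_deriv x z (a \<otimes>\<^bsub>A\<^esub> c) =
    E0 a x * point_deriv x z c + point_deriv x z a * point_char (\<eta> x) z c"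
proof -
  let ?a = "\<lambda>n. E (Suc n) a x * z ^ n" and ?c = "\<lambda>n. E n c (\<eta> x) * z ^ n"
  \<comment> \<open>If z = 0, a term with k > 0 has n > 0 and so the factor 0, while for k = 0 the
    iterate is \<eta>(x) itself.\<close>
  have term_eq: "E (n - k) c ((\<eta> ^^ Suc k) x) * z ^ n = E (n - k) c (\<eta> x) * (z ^ k * z ^ (n - k))"
    if "k \<le> n" for n k
  proof -
    have "z ^ n = 0 \<or> (\<eta> ^^ Suc k) x = \<eta> x"
    proof (cases "z = 0")
      case False
      then show ?thesis
        using fixed by (induction k) auto
    next
      case True
      then show ?thesis
        using that by (cases k) auto
    qed
    then show ?thesis
      using that by (auto simp flip: power_add)
  qed
  have eq: "E (Suc n) (a \<otimes>\<^bsub>A\<^esub> c) x * z ^ n =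
      E0 a x * (E (Suc n) c x * z ^ n) + (\<Sum>k\<le>n. ?a k * ?c (n - k))" for n
  proof -
    have "E (Suc n) (a \<otimes>\<^bsub>A\<^esub> c) x =
        E0 a x * E (Suc n) c x + (\<Sum>k\<le>n. E (Suc k) a x * E (n - k) c ((\<eta> ^^ Suc k) x))"
      unfolding E_mult[OF a c x] by (subst sum.atMost_Suc_shift) simp
    moreover have "(\<Sum>k\<le>n. E (Suc k) a x * E (n - k) c ((\<eta> ^^ Suc k) x)) * z ^ n =
        (\<Sum>k\<le>n. ?a k * ?c (n - k))"
      unfolding sum_distrib_right
    proof (rule sum.cong[OF refl])
      fix k
      assume "k \<in> {..n}"
      then show "E (Suc k) a x * E (n - k) c ((\<eta> ^^ Suc k) x) * z ^ n = ?a k * ?c (n - k)"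
        using arg_cong[OF term_eq[of k n], of "\<lambda>v. E (Suc k) a x * v"] by (simp add: algebra_simps)
    qed
    ultimately show ?thesis
      by (simp add: algebra_simps)
  qed
  note sa = summable_E_Suc[OF z a x] and sc = summable_E[OF z c \<eta>_closed[OF x]]
  have s1: "summable (\<lambda>n. E0 a x * (E (Suc n) c x * z ^ n))"
    by (intro summable_mult summable_norm_cancel[OF summable_E_Suc[OF z c x]])
  have "point_deriv x z (a \<otimes>\<^bsub>A\<^esub> c) =
      (\<Sum>n. E0 a x * (E (Suc n) c x * z ^ n)) + (\<Sum>n. \<Sum>k\<le>n. ?a k * ?c (n - k))"
    unfolding point_deriv_def eq
    by (rule suminf_add[OF s1 summable_Cauchy_product[OF sa sc], symmetric])
  also have "(\<Sum>n. E0 a x * (E (Suc n) c x * z ^ n)) = E0 a x * point_deriv x z c"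
    unfolding point_deriv_def by (rule suminf_mult[OF summable_norm_cancel[OF summable_E_Suc[OF z c x]]])
  also have "(\<Sum>n. \<Sum>k\<le>n. ?a k * ?c (n - k)) = point_deriv x z a * point_char (\<eta> x) z c"
    unfolding point_deriv_def point_char_def by (rule Cauchy_product[OF sa sc, symmetric])
  finally show ?thesis .
qed

lemma point_deriv_J_mult_U:
  assumes "f \<in> carrier (cont_alg X)"
  shows "point_deriv x z (J f \<otimes>\<^bsub>A\<^esub> U) = f x"
  unfolding point_deriv_def
  using suminf_finite[of "{0}" "\<lambda>n. E (Suc n) (J f \<otimes>\<^bsub>A\<^esub> U) x * z ^ n"] assms
  by (simp add: E_mult_U E_J E0_cont)

lemma poly_approx:
  assumes "a \<in> carrier A" "e > 0"
  obtains p where "p \<in> carrier (skew_poly_alg X \<eta>)" "nrm A (a \<ominus>\<^bsub>A\<^esub> \<iota> p) < e"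
proof -
  have "\<iota> ` carrier (skew_poly_alg X \<eta>) \<subseteq> carrier A"
    using incl_closed by auto
  from in_closure_of_iff[OF this, of a] show ?thesis
    using assms incl_dense that by auto
qed

text \<open>Applying \<open>\<theta>\<close> to the covariance relation U f = (f o \<eta>) U gives
  \<theta>(U) f(x) = f(\<eta>(x)) \<theta>(U), and functions separate points.\<close>

lemma char_over_fixed:
  assumes \<theta>: "char_over \<theta> x" and "\<theta> U \<noteq> 0"
  shows "\<eta> x = x"
proof (rule ccontr)
  assume "\<eta> x \<noteq> x"
  then obtain f where f: "f \<in> carrier (cont_alg X)" "f (\<eta> x) = 1" "f x = 0"
    using vanishing_separates_points[OF compact Hausdorff closedin_empty, of "\<eta> x" x]
      \<eta>_closed char_over_topspace[OF \<theta>] by auto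
  have pb: "pullback X \<eta> f \<in> carrier (cont_alg X)"
    using f(1) continuous by (rule cont_alg_pullback)
  have "\<theta> U * f x = \<theta> (U \<otimes>\<^bsub>A\<^esub> J f)"
    using \<theta> f(1) by (simp add: character_mult[OF char_over_character] char_over_J)
  also have "\<dots> = f (\<eta> x) * \<theta> U"
    using \<theta> pb f(1)
    by (simp add: U_J character_mult[OF char_over_character] char_over_J char_over_topspace)
  finally show False
    using f assms(2) by simp
qed

text \<open>The value at \<open>U\<close> is a coordinate on the fibre over \<open>x\<close>: with
  evaluation at \<open>x\<close> it determines the character on polynomials, and these are dense
  while characters are continuous.\<close>

lemma char_over_eqI:
  assumes \<theta>: "char_over \<theta> x" and \<theta>': "char_over \<theta>' x" and U: "\<theta> U = \<theta>' U" and a: "a \<in> carrier A"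
  shows "\<theta> a = \<theta>' a"
proof -
  note ch = char_over_character[OF \<theta>] char_over_character[OF \<theta>']
  have poly: "\<theta> (\<iota> p) = \<theta>' (\<iota> p)" if "p \<in> carrier (skew_poly_alg X \<eta>)" for p
  proof (rule poly_induct[where K = "{}" and p = p])
    fix f b
    assume "f \<in> vanishing X {}" "b \<in> carrier A" "\<theta> b = \<theta>' b"
    then show "\<theta> (J f \<oplus>\<^bsub>A\<^esub> b \<otimes>\<^bsub>A\<^esub> U) = \<theta>' (J f \<oplus>\<^bsub>A\<^esub> b \<otimes>\<^bsub>A\<^esub> U)"
      using U \<theta> \<theta>' by (simp add: ch[THEN character_add] ch[THEN character_mult] char_over_J)
  qed (use that ch in \<open>auto simp: skew_poly_carrier_iff\<close>)
  have "cmod (\<theta> a - \<theta>' a) \<le> 0 + e" if e: "e > 0" for e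
  proof -
    obtain p where p: "p \<in> carrier (skew_poly_alg X \<eta>)" "nrm A (a \<ominus>\<^bsub>A\<^esub> \<iota> p) < e / 2"
      using poly_approx[OF a half_gt_zero[OF e]] by blast
    have "\<theta> a - \<theta>' a = (\<theta> a - \<theta> (\<iota> p)) - (\<theta>' a - \<theta>' (\<iota> p))"
      using poly[OF p(1)] by simp
    also have "cmod \<dots> \<le> cmod (\<theta> a - \<theta> (\<iota> p)) + cmod (\<theta>' a - \<theta>' (\<iota> p))"
      by (rule norm_triangle_ineq4)
    also have "\<dots> \<le> e"
      using character_diff_le[OF ch(1) a incl_closed[OF p(1)]]
        character_diff_le[OF ch(2) a incl_closed[OF p(1)]] p(2) by linarith
    finally show ?thesis
      by simp
  qed
  then have "cmod (\<theta> a - \<theta>' a) \<le> 0"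
    by (rule field_le_epsilon)
  then show ?thesis
    by simp
qed

text \<open>A character over \<^term>\<open>x\<close> that is not given by a power series in the interior of the disc
  of characters is still a radial limit of such characters.\<close>

lemma char_over_eq_E0_if_E_zero:
  assumes \<theta>: "char_over \<theta> x" and a: "a \<in> carrier A" and zero: "\<And>n. n > 0 \<Longrightarrow> E n a x = 0"
  shows "\<theta> a = E0 a x"
proof (cases "\<theta> U = 0")
  case True
  show ?thesis
    using char_over_E0[OF char_over_topspace[OF \<theta>]]
    by (rule char_over_eqI[OF \<theta> _ _ a]) (simp add: True E0_U)
next
  case False
  define z where "z = \<theta> U"
  note x = char_over_topspace[OF \<theta>] and ch = char_over_character[OF \<theta>]
  have fixed: "\<eta> x = x"
    using char_over_fixed[OF \<theta> False] .
  let ?z = "\<lambda>t. complex_of_real t * z"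
  have over: "char_over (point_char x (?z t)) x" if "0 < t" "t < 1" for t
  proof (rule char_over_point_char)
    have "cmod (?z t) < cmod z"
      using that False by (simp add: norm_mult z_def)
    then show "admissible (?z t)"
      unfolding z_def by (rule admissible_if_less[OF ch char_over_one[OF \<theta>]])
  qed (use x fixed in auto)
  have ev: "\<forall>\<^sub>F t::real in at_left 1. 0 < t \<and> t < 1"
    by (simp add: eventually_at_left_field) (metis zero_less_one)
  \<comment> \<open>On a polynomial the value of the character is a polynomial in its coordinate,
    hence continuous up to the boundary. The bound by the norm, common to all characters, then
    transfers the limit to \<open>a\<close>.\<close>
  have lim: "((\<lambda>t. point_char x (?z t) (\<iota> p)) \<longlongrightarrow> \<theta> (\<iota> p)) (at_left 1)"
    if "p \<in> carrier (skew_poly_alg X \<eta>)" for p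
  proof (rule poly_induct[where K = "{}" and p = p])
    have "\<forall>\<^sub>F t in at_left 1. point_char x (?z t) \<zero>\<^bsub>A\<^esub> = 0"
      using ev by eventually_elim (meson over char_over_character character_zero)
    then show "((\<lambda>t. point_char x (?z t) \<zero>\<^bsub>A\<^esub>) \<longlongrightarrow> \<theta> \<zero>\<^bsub>A\<^esub>) (at_left 1)"
      using ch by (simp add: tendsto_eventually)
  next
    fix f b
    assume f: "f \<in> vanishing X {}" and b: "b \<in> carrier A"
      and IH: "((\<lambda>t. point_char x (?z t) b) \<longlongrightarrow> \<theta> b) (at_left 1)"
    have "((\<lambda>t. f x + point_char x (?z t) b * ?z t) \<longlongrightarrow> f x + \<theta> b * ?z 1) (at_left 1)"
      by (intro tendsto_intros IH)
    moreover have "f x + \<theta> b * ?z 1 = \<theta> (J f \<oplus>\<^bsub>A\<^esub> b \<otimes>\<^bsub>A\<^esub> U)"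
      using \<theta> f b by (simp add: ch[THEN character_add] ch[THEN character_mult] char_over_J z_def)
    moreover have "\<forall>\<^sub>F t in at_left 1. f x + point_char x (?z t) b * ?z t =
        point_char x (?z t) (J f \<oplus>\<^bsub>A\<^esub> b \<otimes>\<^bsub>A\<^esub> U)"
      using ev
    proof eventually_elim
      case (elim t)
      then have "char_over (point_char x (?z t)) x"
        by (simp add: over)
      then show ?case
        using f b x by (simp add: char_over_character[THEN character_add]
            char_over_character[THEN character_mult] char_over_J point_char_U)
    qed
    ultimately show "((\<lambda>t. point_char x (?z t) (J f \<oplus>\<^bsub>A\<^esub> b \<otimes>\<^bsub>A\<^esub> U)) \<longlongrightarrow>
        \<theta> (J f \<oplus>\<^bsub>A\<^esub> b \<otimes>\<^bsub>A\<^esub> U)) (at_left 1)"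
      using Lim_transform_eventually by force
  qed (use that in \<open>auto simp: skew_poly_carrier_iff\<close>)
  have point_char_a: "point_char x w a = E0 a x" for w
    unfolding point_char_def using suminf_finite[of "{0}" "\<lambda>n. E n a x * w ^ n"] zero by simp
  have "cmod (\<theta> a - E0 a x) \<le> 0 + e" if e: "e > 0" for e
  proof -
    define d where "d = e / 3"
    have "d > 0"
      using e by (simp add: d_def)
    obtain p where p: "p \<in> carrier (skew_poly_alg X \<eta>)" "nrm A (a \<ominus>\<^bsub>A\<^esub> \<iota> p) < d"
      using poly_approx[OF a \<open>d > 0\<close>] by blast
    have "\<forall>\<^sub>F t in at_left 1. dist (point_char x (?z t) (\<iota> p)) (\<theta> (\<iota> p)) < d"
      using lim[OF p(1)] \<open>d > 0\<close> by (rule tendstoD)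
    with ev have "\<forall>\<^sub>F t in at_left (1::real). (0 < t \<and> t < 1) \<and>
        dist (point_char x (?z t) (\<iota> p)) (\<theta> (\<iota> p)) < d"
      by (rule eventually_conj)
    then obtain t where t: "0 < t" "t < 1" "dist (point_char x (?z t) (\<iota> p)) (\<theta> (\<iota> p)) < d"
      using eventually_happens[of _ "at_left (1::real)"] by (auto simp: trivial_limit_at_left_real)
    let ?t = "point_char x (?z t)"
    have "cmod (\<theta> a - E0 a x) = cmod ((\<theta> a - \<theta> (\<iota> p)) - (?t a - ?t (\<iota> p)) - (?t (\<iota> p) - \<theta> (\<iota> p)))"
      by (simp add: point_char_a)
    also have "\<dots> \<le> cmod (\<theta> a - \<theta> (\<iota> p)) + cmod (?t a - ?t (\<iota> p)) + cmod (?t (\<iota> p) - \<theta> (\<iota> p))"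
      by (meson norm_triangle_ineq4 norm_triangle_le_diff order_refl add_mono order_trans)
    also have "\<dots> \<le> d + d + d"
    proof (intro add_mono)
      show "cmod (\<theta> a - \<theta> (\<iota> p)) \<le> d"
        using character_diff_le[OF ch a incl_closed[OF p(1)]] p(2) by (rule order_trans[OF _ less_imp_le])
      show "cmod (?t a - ?t (\<iota> p)) \<le> d"
        using character_diff_le[OF char_over_character[OF over[OF t(1,2)]] a incl_closed[OF p(1)]] p(2)
        by (rule order_trans[OF _ less_imp_le])
      show "cmod (?t (\<iota> p) - \<theta> (\<iota> p)) \<le> d"
        using t(3) by (simp only: dist_norm less_imp_le)
    qed
    finally show ?thesis
      by (simp add: d_def)
  qed
  then have "cmod (\<theta> a - E0 a x) \<le> 0"
    by (rule field_le_epsilon)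
  then show ?thesis
    by simp
qed

end

section \<open>The ideal generated by the functions vanishing on an invariant set\<close>

definition vanishing_poly ::
  "'a topology \<Rightarrow> ('a \<Rightarrow> 'a) \<Rightarrow> 'a set \<Rightarrow> (nat \<Rightarrow> 'a \<Rightarrow> complex) set" where
  "vanishing_poly X \<eta> K = {p \<in> carrier (skew_poly_alg X \<eta>). \<forall>n. p n \<in> vanishing X K}"

lemma vanishing_poly_carrier: "p \<in> vanishing_poly X \<eta> K \<Longrightarrow> p \<in> carrier (skew_poly_alg X \<eta>)"
  by (simp add: vanishing_poly_def)

lemma vanishing_poly_empty: "vanishing_poly X \<eta> {} = carrier (skew_poly_alg X \<eta>)"
  by (auto simp: vanishing_poly_def skew_poly_carrier_iff)

lemma vanishing_polys_eq:
  "vanishing_polys X \<eta> = vanishing_poly (Alexandroff_compactification X) (map_option \<eta>) {None}"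
  by (auto simp: vanishing_polys_def vanishing_poly_def vanishing_def skew_poly_carrier_iff)

lemma skew_poly_mult_coeff:
  assumes "p \<in> carrier (skew_poly_alg X \<eta>)" "q \<in> carrier (skew_poly_alg X \<eta>)" "continuous_map X X \<eta>"
  shows "(p \<otimes>\<^bsub>skew_poly_alg X \<eta>\<^esub> q) n \<in> carrier (cont_alg X)"
proof -
  have "continuous_map X X (\<eta> ^^ k)" for k
  proof (induction k)
    case (Suc k)
    then show ?case
      using continuous_map_compose[OF Suc assms(3)] by (simp add: o_def)
  qed (simp add: id_def[symmetric])
  then have "(\<lambda>x. \<Sum>k\<le>n. p k x * pullback X (\<eta> ^^ k) (q (n - k)) x) \<in> carrier (cont_alg X)"
    using assms(1,2)
    by (intro cont_alg_sum[where I = "{..n}"] cont_alg_mult cont_alg_pullback)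
      (auto simp: skew_poly_carrier_iff)
  moreover have "p k x * pullback X (\<eta> ^^ k) (q (n - k)) x = p k x * q (n - k) ((\<eta> ^^ k) x)" for k x
    using assms(1) by (auto simp: skew_poly_carrier_iff cont_alg_iff pullback_def)
  ultimately show ?thesis
    by (simp add: skew_poly_mult)
qed

lemma skew_poly_mult_finite:
  assumes "finite {n. p n \<noteq> (\<lambda>x. 0)}" "finite {n. q n \<noteq> (\<lambda>x. 0)}"
  shows "finite {n. (p \<otimes>\<^bsub>skew_poly_alg X \<eta>\<^esub> q) n \<noteq> (\<lambda>x. 0)}"
proof -
  obtain N where "{n. p n \<noteq> (\<lambda>x. 0)} \<subseteq> {..<N}"
    using assms(1) finite_nat_iff_bounded by auto
  then have N: "p n = (\<lambda>x. 0)" if "n \<ge> N" for n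
    using that by (auto simp: subset_iff)
  obtain M where "{n. q n \<noteq> (\<lambda>x. 0)} \<subseteq> {..<M}"
    using assms(2) finite_nat_iff_bounded by auto
  then have M: "q n = (\<lambda>x. 0)" if "n \<ge> M" for n
    using that by (auto simp: subset_iff)
  have "(p \<otimes>\<^bsub>skew_poly_alg X \<eta>\<^esub> q) n = (\<lambda>x. 0)" if n: "n \<ge> N + M" for n
  proof
    fix x
    have "p k x * q (n - k) ((\<eta> ^^ k) x) = 0" for k
      using N[of k] M[of "n - k"] n by (cases "k \<ge> N") auto
    then show "(p \<otimes>\<^bsub>skew_poly_alg X \<eta>\<^esub> q) n x = 0"
      unfolding skew_poly_mult by (intro sum.neutral) blast
  qed
  then have "{n. (p \<otimes>\<^bsub>skew_poly_alg X \<eta>\<^esub> q) n \<noteq> (\<lambda>x. 0)} \<subseteq> {..<N + M}"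
    using leI by blast
  then show ?thesis
    using finite_subset by blast
qed

lemma skew_poly_mult_closed:
  assumes "p \<in> carrier (skew_poly_alg X \<eta>)" "q \<in> carrier (skew_poly_alg X \<eta>)" "continuous_map X X \<eta>"
  shows "p \<otimes>\<^bsub>skew_poly_alg X \<eta>\<^esub> q \<in> carrier (skew_poly_alg X \<eta>)"
proof -
  have "finite {n. p n \<noteq> (\<lambda>x. 0)}" "finite {n. q n \<noteq> (\<lambda>x. 0)}"
    using assms by (simp_all add: skew_poly_carrier_iff)
  from skew_poly_mult_finite[OF this, of X \<eta>] skew_poly_mult_coeff[OF assms] show ?thesis
    unfolding skew_poly_carrier_iff by blast
qed

lemma vanishing_poly_add:
  assumes "p \<in> vanishing_poly X \<eta> K" "q \<in> vanishing_poly X \<eta> K"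
  shows "p \<oplus>\<^bsub>skew_poly_alg X \<eta>\<^esub> q \<in> vanishing_poly X \<eta> K"
proof -
  have "{n. (\<lambda>x. p n x + q n x) \<noteq> (\<lambda>x. 0)} \<subseteq> {n. p n \<noteq> (\<lambda>x. 0)} \<union> {n. q n \<noteq> (\<lambda>x. 0)}"
    by (auto simp: fun_eq_iff)
  then have "finite {n. (\<lambda>x. p n x + q n x) \<noteq> (\<lambda>x. 0)}"
    by (rule finite_subset) (use assms in \<open>auto simp: vanishing_poly_def skew_poly_carrier_iff\<close>)
  then show ?thesis
    using assms by (auto simp: vanishing_poly_def skew_poly_alg_def vanishing_def)
qed

lemma vanishing_poly_smult:
  assumes "p \<in> vanishing_poly X \<eta> K"
  shows "c \<odot>\<^bsub>skew_poly_alg X \<eta>\<^esub> p \<in> vanishing_poly X \<eta> K"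
proof -
  have "{n. (\<lambda>x. c * p n x) \<noteq> (\<lambda>x. 0)} \<subseteq> {n. p n \<noteq> (\<lambda>x. 0)}"
    by (auto simp: fun_eq_iff)
  then have "finite {n. (\<lambda>x. c * p n x) \<noteq> (\<lambda>x. 0)}"
    by (rule finite_subset) (use assms in \<open>auto simp: vanishing_poly_def skew_poly_carrier_iff\<close>)
  then show ?thesis
    using assms by (auto simp: vanishing_poly_def skew_poly_alg_def vanishing_def)
qed

text \<open>The common form of both cases. Forward invariance of \<open>K\<close> makes the
  polynomials with coefficients vanishing on \<open>K\<close> a two-sided ideal of all polynomials;
  invariance of the complement lets \<open>\<eta>\<close> act on the points that the ideal
  sees.\<close>

locale conjugacy_ideal = compact_conjugacy_algebra X \<eta> A \<iota> E0
  for X :: "'a topology" and \<eta> :: "'a \<Rightarrow> 'a" and A :: "'c normed_alg"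
    and \<iota> :: "(nat \<Rightarrow> 'a \<Rightarrow> complex) \<Rightarrow> 'c" and E0 :: "'c \<Rightarrow> 'a \<Rightarrow> complex" +
  fixes K :: "'a set" and I :: "'c set"
  assumes closed_K: "closedin X K"
    and \<eta>_K_iff: "x \<in> topspace X \<Longrightarrow> \<eta> x \<in> K \<longleftrightarrow> x \<in> K"
    and I_eq: "I = closed_subalgebra_generated A (\<iota> ` vanishing_poly X \<eta> K)"
begin

abbreviation V :: "'c set" where
  "V \<equiv> \<iota> ` vanishing_poly X \<eta> K"

lemma V_carrier: "V \<subseteq> carrier A"
  using incl_closed vanishing_poly_carrier by blast

lemma V_induct [consumes 1, case_names zero step]:
  assumes "v \<in> V" "Q \<zero>\<^bsub>A\<^esub>"
    and "\<And>f b. f \<in> vanishing X K \<Longrightarrow> b \<in> carrier A \<Longrightarrow> Q b \<Longrightarrow> Q (J f \<oplus>\<^bsub>A\<^esub> b \<otimes>\<^bsub>A\<^esub> U)"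
  shows "Q v"
proof -
  obtain p where p: "p \<in> vanishing_poly X \<eta> K" "v = \<iota> p"
    using assms(1) by blast
  show ?thesis
    unfolding p(2)
  proof (rule poly_induct[where p = p and K = K])
    show "p n \<in> vanishing X K" "finite {n. p n \<noteq> (\<lambda>x. 0)}" for n
      using p(1) by (auto simp: vanishing_poly_def skew_poly_carrier_iff)
  qed (use assms in auto)
qed

lemma \<eta>_iter_K: "x \<in> topspace X \<Longrightarrow> x \<in> K \<Longrightarrow> (\<eta> ^^ k) x \<in> K"
  by (induction k) (auto simp: \<eta>_K_iff \<eta>_iter_closed)

lemma K_topspace: "x \<in> K \<Longrightarrow> x \<in> topspace X"
  using closedin_subset[OF closed_K] by blast

lemma V_mult_right:
  assumes "v \<in> V" "q \<in> carrier (skew_poly_alg X \<eta>)"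
  shows "v \<otimes>\<^bsub>A\<^esub> \<iota> q \<in> V"
proof -
  obtain p where p: "p \<in> vanishing_poly X \<eta> K" "v = \<iota> p"
    using assms(1) by blast
  have "p \<otimes>\<^bsub>skew_poly_alg X \<eta>\<^esub> q \<in> vanishing_poly X \<eta> K"
    using skew_poly_mult_closed[OF vanishing_poly_carrier[OF p(1)] assms(2) continuous] p(1)
    by (auto simp: vanishing_poly_def vanishing_def skew_poly_carrier_iff skew_poly_mult)
  then show ?thesis
    using incl_mult[OF vanishing_poly_carrier[OF p(1)] assms(2)] p(2) by (metis imageI)
qed

text \<open>The coefficients of q p are sums of q_k times a coefficient of p composed with an
  iterate of \<open>\<eta>\<close>, and the iterates map \<open>K\<close> into itself.\<close>

lemma V_mult_left:
  assumes "v \<in> V" "q \<in> carrier (skew_poly_alg X \<eta>)"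
  shows "\<iota> q \<otimes>\<^bsub>A\<^esub> v \<in> V"
proof -
  obtain p where p: "p \<in> vanishing_poly X \<eta> K" "v = \<iota> p"
    using assms(1) by blast
  have "q \<otimes>\<^bsub>skew_poly_alg X \<eta>\<^esub> p \<in> vanishing_poly X \<eta> K"
    using skew_poly_mult_closed[OF assms(2) vanishing_poly_carrier[OF p(1)] continuous] p(1)
    by (auto simp: vanishing_poly_def vanishing_def skew_poly_carrier_iff skew_poly_mult \<eta>_iter_K K_topspace)
  then show ?thesis
    using incl_mult[OF assms(2) vanishing_poly_carrier[OF p(1)]] p(2) by (metis imageI)
qed

lemma V_add:
  assumes "v \<in> V" "w \<in> V"
  shows "v \<oplus>\<^bsub>A\<^esub> w \<in> V"
proof -
  obtain p q where p: "p \<in> vanishing_poly X \<eta> K" "v = \<iota> p" and q: "q \<in> vanishing_poly X \<eta> K" "w = \<iota> q"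
    using assms by blast
  then show ?thesis
    using incl_add[OF vanishing_poly_carrier[OF p(1)] vanishing_poly_carrier[OF q(1)]]
      vanishing_poly_add[OF p(1) q(1)] by (metis imageI)
qed

lemma V_smult:
  assumes "v \<in> V"
  shows "c \<odot>\<^bsub>A\<^esub> v \<in> V"
proof -
  obtain p where p: "p \<in> vanishing_poly X \<eta> K" "v = \<iota> p"
    using assms by blast
  then show ?thesis
    using incl_smult[OF vanishing_poly_carrier[OF p(1)]] vanishing_poly_smult[OF p(1)]
    by (metis imageI)
qed

lemma J_in_V:
  assumes "f \<in> vanishing X K"
  shows "J f \<in> V"
proof -
  have "skew_monom 0 f n \<in> vanishing X K" for n
    using assms by (auto simp: skew_monom_def vanishing_def cont_alg_iff)
  then have "skew_monom 0 f \<in> vanishing_poly X \<eta> K"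
    using assms by (simp add: vanishing_poly_def skew_monom_carrier vanishing_carrier)
  then show ?thesis
    by blast
qed

abbreviation V_closure :: "'c set" where
  "V_closure \<equiv> norm_topology A closure_of V"

lemmas V_closure_iff = in_closure_of_iff[OF V_carrier]

lemma V_closure_carrier: "a \<in> V_closure \<Longrightarrow> a \<in> carrier A"
  using V_closure_iff by blast

lemma V_subset_closure: "V \<subseteq> V_closure"
  using V_carrier by (simp add: closure_of_subset)

text \<open>Translations are isometric, so the closure is reached in one summand at a time, first
  with the other one in \<open>V\<close>.\<close>

lemma V_closure_add:
  assumes a: "a \<in> V_closure" and b: "b \<in> V_closure"
  shows "a \<oplus>\<^bsub>A\<^esub> b \<in> V_closure"
proof -
  have add: "c \<oplus>\<^bsub>A\<^esub> x \<in> V_closure"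
    if c: "c \<in> carrier A" and x: "x \<in> V_closure" and V: "\<And>v. v \<in> V \<Longrightarrow> c \<oplus>\<^bsub>A\<^esub> v \<in> V_closure" for c x
  proof (rule closure_of_Lipschitz_image[OF V_carrier V_carrier _ _ V x, where L = 1])
    fix x y
    assume "x \<in> carrier A" "y \<in> carrier A"
    then have "(c \<oplus>\<^bsub>A\<^esub> x) \<ominus>\<^bsub>A\<^esub> (c \<oplus>\<^bsub>A\<^esub> y) = x \<ominus>\<^bsub>A\<^esub> y"
      using c add_minus_cancel[of c "x \<ominus>\<^bsub>A\<^esub> y"] by (simp add: alg.ring_simprules)
    then show "nrm A ((c \<oplus>\<^bsub>A\<^esub> x) \<ominus>\<^bsub>A\<^esub> (c \<oplus>\<^bsub>A\<^esub> y)) \<le> 1 * nrm A (x \<ominus>\<^bsub>A\<^esub> y)"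
      by simp
  qed (use c in auto)
  have "v \<oplus>\<^bsub>A\<^esub> a \<in> V_closure" if "v \<in> V" for v
    by (rule add) (use that a V_carrier V_subset_closure V_add in blast)+
  then have "a \<oplus>\<^bsub>A\<^esub> v \<in> V_closure" if "v \<in> V" for v
    using that alg.a_comm[OF V_closure_carrier[OF a], of v] V_carrier by auto
  then show ?thesis
    by (rule add[OF V_closure_carrier[OF a] b])
qed

lemma V_closure_smult:
  assumes "a \<in> V_closure"
  shows "c \<odot>\<^bsub>A\<^esub> a \<in> V_closure"
proof (rule closure_of_Lipschitz_image[OF V_carrier V_carrier _ _ _ assms, where L = "cmod c"])
  show "c \<odot>\<^bsub>A\<^esub> v \<in> V_closure" if "v \<in> V" for v
    using V_smult[OF that] V_subset_closure by blast
qed (auto simp: nrm_smult simp flip: smult_minus)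

lemma polys_carrier: "\<iota> ` carrier (skew_poly_alg X \<eta>) \<subseteq> carrier A"
  using incl_closed by auto

text \<open>Two approximations: the right factor by elements of \<open>V\<close>, then the left
  factor by polynomials, for which the product stays in \<open>V\<close>.\<close>

lemma V_closure_mult_left:
  assumes a: "a \<in> carrier A" and b: "b \<in> V_closure"
  shows "a \<otimes>\<^bsub>A\<^esub> b \<in> V_closure"
proof (rule closure_of_Lipschitz_image[OF V_carrier V_carrier _ mult_left_Lipschitz[OF a] _ b])
  fix v
  assume v: "v \<in> V"
  then have v': "v \<in> carrier A"
    using V_carrier by auto
  show "a \<otimes>\<^bsub>A\<^esub> v \<in> V_closure"
  proof (rule closure_of_Lipschitz_image[OF polys_carrier V_carrier _ mult_right_Lipschitz[OF v']])
    show "s \<otimes>\<^bsub>A\<^esub> v \<in> V_closure" if "s \<in> \<iota> ` carrier (skew_poly_alg X \<eta>)" for s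
      using that V_mult_left[OF v] V_subset_closure by blast
  qed (use a v' incl_dense in auto)
qed (use a in auto)

lemma V_closure_mult_right:
  assumes a: "a \<in> carrier A" and b: "b \<in> V_closure"
  shows "b \<otimes>\<^bsub>A\<^esub> a \<in> V_closure"
proof (rule closure_of_Lipschitz_image[OF V_carrier V_carrier _ mult_right_Lipschitz[OF a] _ b])
  fix v
  assume v: "v \<in> V"
  then have v': "v \<in> carrier A"
    using V_carrier by auto
  show "v \<otimes>\<^bsub>A\<^esub> a \<in> V_closure"
  proof (rule closure_of_Lipschitz_image[OF polys_carrier V_carrier _ mult_left_Lipschitz[OF v']])
    show "v \<otimes>\<^bsub>A\<^esub> s \<in> V_closure" if "s \<in> \<iota> ` carrier (skew_poly_alg X \<eta>)" for s
      using that V_mult_right[OF v] V_subset_closure by blast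
  qed (use a v' incl_dense in auto)
qed (use a in auto)

lemma J_in_V_closure: "f \<in> vanishing X K \<Longrightarrow> J f \<in> V_closure"
  using J_in_V V_subset_closure by blast

lemma is_subalgebra_V_closure: "is_subalgebra V_closure A"
  unfolding is_subalgebra_def
  using V_closure_add V_closure_smult V_closure_mult_left V_closure_carrier
    J_in_V_closure[OF vanishing_zero] by (auto simp: subset_iff)

text \<open>The closure of \<open>V\<close> is already a subalgebra, hence the least closed one. In
  this form the generated subalgebra is seen to be a two-sided ideal of the whole algebra.\<close>

lemma I_eq_closure: "I = V_closure"
proof
  show "I \<subseteq> V_closure"
    unfolding I_eq closed_subalgebra_generated_def
    using is_subalgebra_V_closure V_subset_closure by auto
  show "V_closure \<subseteq> I"
    unfolding I_eq closed_subalgebra_generated_def by (auto intro: closure_of_minimal[THEN subsetD])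
qed

lemma I_carrier: "a \<in> I \<Longrightarrow> a \<in> carrier A"
  by (simp add: I_eq_closure V_closure_carrier)

lemma I_add: "a \<in> I \<Longrightarrow> b \<in> I \<Longrightarrow> a \<oplus>\<^bsub>A\<^esub> b \<in> I"
  by (simp add: I_eq_closure V_closure_add)

lemma I_smult: "a \<in> I \<Longrightarrow> c \<odot>\<^bsub>A\<^esub> a \<in> I"
  by (simp add: I_eq_closure V_closure_smult)

lemma I_minus: "a \<in> I \<Longrightarrow> b \<in> I \<Longrightarrow> a \<ominus>\<^bsub>A\<^esub> b \<in> I"
  by (simp add: a_minus_def I_add I_smult I_carrier flip: smult_minus1)

lemma I_mult_left: "a \<in> carrier A \<Longrightarrow> b \<in> I \<Longrightarrow> a \<otimes>\<^bsub>A\<^esub> b \<in> I"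
  by (simp add: I_eq_closure V_closure_mult_left)

lemma I_mult_right: "b \<in> I \<Longrightarrow> a \<in> carrier A \<Longrightarrow> b \<otimes>\<^bsub>A\<^esub> a \<in> I"
  by (simp add: I_eq_closure V_closure_mult_right)

lemma J_in_I: "f \<in> vanishing X K \<Longrightarrow> J f \<in> I"
  by (simp add: I_eq_closure J_in_V_closure)

lemma JU_in_I: "f \<in> vanishing X K \<Longrightarrow> J f \<otimes>\<^bsub>A\<^esub> U \<in> I"
  by (simp add: J_in_I I_mult_right)

lemma pullback_vanishing:
  assumes "f \<in> vanishing X K"
  shows "pullback X \<eta> f \<in> vanishing X K"
  using cont_alg_pullback[OF vanishing_carrier[OF assms] continuous] assms K_topspace
  by (auto simp: vanishing_def \<eta>_K_iff)

lemma char_over_K_vanishes: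
  assumes \<theta>: "char_over \<theta> x" and "x \<in> K" "a \<in> I"
  shows "\<theta> a = 0"
proof (rule character_vanishes_on_closure[OF char_over_character[OF \<theta>] V_carrier])
  fix v
  assume "v \<in> V"
  then show "\<theta> v = 0"
  proof (induction rule: V_induct)
    case (step f b)
    then show ?case
      using assms by (simp add: char_over_character[OF \<theta>, THEN character_add] vanishing_carrier
          char_over_character[OF \<theta>, THEN character_mult] char_over_J) (simp add: vanishing_def)
  qed (use char_over_character[OF \<theta>] in simp)
qed (use assms in \<open>simp add: I_eq_closure\<close>)

lemma E0_vanishing:
  assumes "a \<in> I"
  shows "E0 a \<in> vanishing X K"
proof -
  have "E0 a x = 0" if "x \<in> K" for x
    using char_over_K_vanishes[OF char_over_E0 that assms] K_topspace[OF that] by simp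
  then show ?thesis
    using assms by (simp add: vanishing_def E0_closed I_carrier)
qed

text \<open>A character \<^term>\<open>\<theta>\<close> of the ideal with \<open>\<theta> e = 1\<close> extends to the algebra by \<open>a \<mapsto> \<theta> (a e)\<close>.\<close>

lemma character_extension:
  assumes \<theta>: "character (A\<lparr>carrier := I\<rparr>) \<theta>" and "e0 \<in> I" "\<theta> e0 \<noteq> 0"
  obtains \<theta>' y where "y \<notin> K" "char_over \<theta>' y" "\<And>a. a \<in> I \<Longrightarrow> \<theta>' a = \<theta> a"
proof -
  have add: "\<theta> (a \<oplus>\<^bsub>A\<^esub> b) = \<theta> a + \<theta> b" and mult: "\<theta> (a \<otimes>\<^bsub>A\<^esub> b) = \<theta> a * \<theta> b"
    and smult: "\<theta> (c \<odot>\<^bsub>A\<^esub> a) = c * \<theta> a" if "a \<in> I" "b \<in> I" for a b c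
    using \<theta> that by (auto simp: character_def)
  define e where "e = inverse (\<theta> e0) \<odot>\<^bsub>A\<^esub> e0"
  have e: "e \<in> I" "\<theta> e = 1"
    using assms(2,3) by (auto simp: e_def I_smult smult)
  note e' = I_carrier[OF e(1)]
  define \<theta>' where "\<theta>' a = \<theta> (a \<otimes>\<^bsub>A\<^esub> e)" for a
  \<comment> \<open>Evaluating e a e with either bracketing, both factors lying in the ideal,
    replaces commutation of \<open>a\<close> with \<open>e\<close>.\<close>
  have left: "\<theta> (e \<otimes>\<^bsub>A\<^esub> a) = \<theta> (a \<otimes>\<^bsub>A\<^esub> e)" if "a \<in> carrier A" for a
  proof -
    have "\<theta> (e \<otimes>\<^bsub>A\<^esub> a) = \<theta> ((e \<otimes>\<^bsub>A\<^esub> a) \<otimes>\<^bsub>A\<^esub> e)"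
      using e that by (simp add: mult I_mult_right)
    also have "\<dots> = \<theta> (e \<otimes>\<^bsub>A\<^esub> (a \<otimes>\<^bsub>A\<^esub> e))"
      using e' that by (simp add: alg.m_assoc)
    also have "\<dots> = \<theta> (a \<otimes>\<^bsub>A\<^esub> e)"
      using e that by (simp add: mult I_mult_left)
    finally show ?thesis .
  qed
  have "character A \<theta>'"
    unfolding character_def
  proof (intro conjI ballI allI)
    fix a b
    assume ab: "a \<in> carrier A" "b \<in> carrier A"
    show "\<theta>' (a \<oplus>\<^bsub>A\<^esub> b) = \<theta>' a + \<theta>' b"
      using ab e' by (simp add: \<theta>'_def alg.l_distr add I_mult_left e)
    \<comment> \<open>A further \<open>e\<close> on the left costs nothing, as \<theta>(e) = 1, and
      lets the product be split into the elements e a and b e of the ideal.\<close>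
    have "\<theta>' (a \<otimes>\<^bsub>A\<^esub> b) = \<theta> (e \<otimes>\<^bsub>A\<^esub> ((a \<otimes>\<^bsub>A\<^esub> b) \<otimes>\<^bsub>A\<^esub> e))"
      using ab e by (simp add: \<theta>'_def mult I_mult_left)
    also have "e \<otimes>\<^bsub>A\<^esub> ((a \<otimes>\<^bsub>A\<^esub> b) \<otimes>\<^bsub>A\<^esub> e) = (e \<otimes>\<^bsub>A\<^esub> a) \<otimes>\<^bsub>A\<^esub> (b \<otimes>\<^bsub>A\<^esub> e)"
      using ab e' by (simp add: alg.m_assoc)
    also have "\<theta> \<dots> = \<theta>' a * \<theta>' b"
      using ab e by (simp add: \<theta>'_def mult I_mult_left I_mult_right left)
    finally show "\<theta>' (a \<otimes>\<^bsub>A\<^esub> b) = \<theta>' a * \<theta>' b" .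
  next
    fix c a
    assume a: "a \<in> carrier A"
    then show "\<theta>' (c \<odot>\<^bsub>A\<^esub> a) = c * \<theta>' a"
      using e e' smult[of "a \<otimes>\<^bsub>A\<^esub> e" e c] by (simp add: \<theta>'_def smult_mult_left I_mult_left)
  qed
  have restrict: "\<theta>' a = \<theta> a" if "a \<in> I" for a
    using e that by (simp add: \<theta>'_def mult)
  have "character (cont_alg X) (\<lambda>f. \<theta>' (J f))"
    using \<open>character A \<theta>'\<close>
    by (simp add: character_def[of "cont_alg X"] J_add J_mult J_smult character_add character_mult
        character_smult)
  moreover have "\<theta>' (J (\<lambda>x. if x \<in> topspace X then 1 else 0)) = 1"
    using e e' by (simp add: J_one \<theta>'_def)
  ultimately obtain y where "y \<in> topspace X" "\<And>f. f \<in> carrier (cont_alg X) \<Longrightarrow> \<theta>' (J f) = f y"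
    using character_cont_alg[OF compact] by blast
  then have over: "char_over \<theta>' y"
    using \<open>character A \<theta>'\<close> by (simp add: char_over_def)
  \<comment> \<open>Characters over points of \<open>K\<close> vanish on the ideal, but this one is
    1 at \<open>e\<close>.\<close>
  moreover have "y \<notin> K"
    using char_over_K_vanishes[OF over _ e(1)] restrict[OF e(1)] e(2) by auto
  ultimately show ?thesis
    using that restrict by blast
qed

lemma vanishing_on_K_separates:
  assumes "y \<in> topspace X" "y \<notin> K"
  obtains f where "f \<in> vanishing X K" "f y = 1"
  using vanishing_separates[OF compact Hausdorff closed_K assms] .

lemma vanishing_on_K_separates_points:
  assumes "y \<in> topspace X" "y \<notin> K" "y' \<in> topspace X" "y \<noteq> y'"
  obtains f where "f \<in> vanishing X K" "f y = 1" "f y' = 0"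
  using vanishing_separates_points[OF compact Hausdorff closed_K assms] .

end

section \<open>Isomorphic ideals come from conjugate systems\<close>

text \<open>The isomorphism and its inverse are both parameters, so that every result also holds
  with the two systems exchanged.\<close>

locale isomorphic_ideals =
  L1: conjugacy_ideal X1 \<eta>1 A1 \<iota>1 E1 K1 I1 +
  L2: conjugacy_ideal X2 \<eta>2 A2 \<iota>2 E2 K2 I2
  for X1 :: "'a topology" and \<eta>1 and A1 :: "'c normed_alg" and \<iota>1 E1 K1 I1
    and X2 :: "'b topology" and \<eta>2 and A2 :: "'d normed_alg" and \<iota>2 E2 K2 I2 +
  fixes \<phi> :: "'c \<Rightarrow> 'd" and \<psi> :: "'d \<Rightarrow> 'c"
  assumes \<phi>: "\<phi> \<in> alg_hom (A1\<lparr>carrier := I1\<rparr>) (A2\<lparr>carrier := I2\<rparr>)"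
    and \<psi>: "\<psi> \<in> alg_hom (A2\<lparr>carrier := I2\<rparr>) (A1\<lparr>carrier := I1\<rparr>)"
    and \<psi>_\<phi>: "a \<in> I1 \<Longrightarrow> \<psi> (\<phi> a) = a"
    and \<phi>_\<psi>: "b \<in> I2 \<Longrightarrow> \<phi> (\<psi> b) = b"
begin

lemma swapped: "isomorphic_ideals X2 \<eta>2 A2 \<iota>2 E2 K2 I2 X1 \<eta>1 A1 \<iota>1 E1 K1 I1 \<psi> \<phi>"
  by unfold_locales (auto simp: \<phi> \<psi> \<psi>_\<phi> \<phi>_\<psi>)

lemma \<psi>_closed: "b \<in> I2 \<Longrightarrow> \<psi> b \<in> I1"
  and \<psi>_add: "b \<in> I2 \<Longrightarrow> b' \<in> I2 \<Longrightarrow> \<psi> (b \<oplus>\<^bsub>A2\<^esub> b') = \<psi> b \<oplus>\<^bsub>A1\<^esub> \<psi> b'"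
  and \<psi>_mult: "b \<in> I2 \<Longrightarrow> b' \<in> I2 \<Longrightarrow> \<psi> (b \<otimes>\<^bsub>A2\<^esub> b') = \<psi> b \<otimes>\<^bsub>A1\<^esub> \<psi> b'"
  and \<psi>_smult: "b \<in> I2 \<Longrightarrow> \<psi> (c \<odot>\<^bsub>A2\<^esub> b) = c \<odot>\<^bsub>A1\<^esub> \<psi> b"
  using \<psi> by (auto simp: alg_hom_def)

lemma \<phi>_closed: "a \<in> I1 \<Longrightarrow> \<phi> a \<in> I2"
  using \<phi> by (auto simp: alg_hom_def)

lemma \<psi>_carrier: "b \<in> I2 \<Longrightarrow> \<psi> b \<in> carrier A1"
  by (simp add: \<psi>_closed L1.I_carrier)

text \<open>The character composed with the isomorphism extends to the whole second algebra because
  it is nonzero: outside \<open>K1\<close> some function in the first ideal is 1 at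
  \<open>x\<close>.\<close>

lemma transport:
  assumes \<theta>: "L1.char_over \<theta> x" and x: "x \<notin> K1"
  obtains y \<theta>' where "y \<notin> K2" "L2.char_over \<theta>' y" "\<And>b. b \<in> I2 \<Longrightarrow> \<theta>' b = \<theta> (\<psi> b)"
proof -
  have "character (A2\<lparr>carrier := I2\<rparr>) (\<lambda>b. \<theta> (\<psi> b))"
    using L1.char_over_character[OF \<theta>]
    by (simp add: character_def \<psi>_add \<psi>_mult \<psi>_smult \<psi>_carrier)
  moreover obtain f where f: "f \<in> vanishing X1 K1" "f x = 1"
    using L1.vanishing_on_K_separates[OF L1.char_over_topspace[OF \<theta>] x] by blast
  then have "\<phi> (L1.J f) \<in> I2" "\<theta> (\<psi> (\<phi> (L1.J f))) \<noteq> 0"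
    using \<theta> by (simp_all add: \<phi>_closed \<psi>_\<phi> L1.J_in_I L1.char_over_J vanishing_carrier)
  ultimately show ?thesis
    using L2.character_extension[of "\<lambda>b. \<theta> (\<psi> b)"] that by blast
qed

lemma point_unique:
  assumes "y \<in> topspace X2" "y \<notin> K2" "y' \<in> topspace X2" "y' \<notin> K2"
    and "\<And>f. f \<in> vanishing X2 K2 \<Longrightarrow> f y = f y'"
  shows "y = y'"
proof (rule ccontr)
  assume "y \<noteq> y'"
  then obtain f where "f \<in> vanishing X2 K2" "f y = 1" "f y' = 0"
    using L2.vanishing_on_K_separates_points assms(1-3) by blast
  then show False
    using assms(5)[of f] by simp
qed

text \<open>The point below the transport of evaluation by \<open>E1\<close> at \<open>x\<close>. It
  is described by its effect on functions alone, which already determines it.\<close>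

definition dual :: "'a \<Rightarrow> 'b" where
  "dual x = (THE y. y \<in> topspace X2 \<and> y \<notin> K2 \<and> (\<forall>f\<in>vanishing X2 K2. f y = E1 (\<psi> (L2.J f)) x))"

lemma dual:
  assumes "x \<in> topspace X1" "x \<notin> K1"
  shows "dual x \<in> topspace X2 \<and> dual x \<notin> K2 \<and>
    (\<forall>f\<in>vanishing X2 K2. f (dual x) = E1 (\<psi> (L2.J f)) x)"
  unfolding dual_def
proof (rule theI')
  obtain y \<theta>' where y: "y \<notin> K2" "L2.char_over \<theta>' y" "\<And>b. b \<in> I2 \<Longrightarrow> \<theta>' b = E1 (\<psi> b) x"
    using transport[OF L1.char_over_E0[OF assms(1)] assms(2)] by blast
  have f: "f y = E1 (\<psi> (L2.J f)) x" if "f \<in> vanishing X2 K2" for f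
    using y(3)[OF L2.J_in_I[OF that]] y(2) that by (simp add: L2.char_over_J vanishing_carrier)
  show "\<exists>!y. y \<in> topspace X2 \<and> y \<notin> K2 \<and> (\<forall>f\<in>vanishing X2 K2. f y = E1 (\<psi> (L2.J f)) x)"
  proof (rule ex1I)
    show "y \<in> topspace X2 \<and> y \<notin> K2 \<and> (\<forall>f\<in>vanishing X2 K2. f y = E1 (\<psi> (L2.J f)) x)"
      using y f L2.char_over_topspace by auto
    show "y' = y"
      if "y' \<in> topspace X2 \<and> y' \<notin> K2 \<and> (\<forall>f\<in>vanishing X2 K2. f y' = E1 (\<psi> (L2.J f)) x)" for y'
      using that y f L2.char_over_topspace by (intro point_unique) auto
  qed
qed

lemma dual_topspace: "x \<in> topspace X1 \<Longrightarrow> x \<notin> K1 \<Longrightarrow> dual x \<in> topspace X2"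
  and dual_K: "x \<in> topspace X1 \<Longrightarrow> x \<notin> K1 \<Longrightarrow> dual x \<notin> K2"
  and dual_eq: "x \<in> topspace X1 \<Longrightarrow> x \<notin> K1 \<Longrightarrow> f \<in> vanishing X2 K2 \<Longrightarrow> E1 (\<psi> (L2.J f)) x = f (dual x)"
  using dual by auto

text \<open>The isomorphism respects the fibres of characters: over a fixed point, the coefficient
  functional \<^term>\<open>\<lambda>f. L1.E n (\<psi> (L2.J f)) x\<close> is a point derivation, hence zero, as soon as
  those of lower positive degree are zero.\<close>

lemma E_eq_0:
  assumes x: "x \<in> topspace X1" "x \<notin> K1" and fixed: "\<eta>1 x = x" and "n > 0" and f: "f \<in> vanishing X2 K2"
  shows "L1.E n (\<psi> (L2.J f)) x = 0"
  using \<open>n > 0\<close> f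
proof (induction n arbitrary: f rule: less_induct)
  case (less n)
  have iter: "(\<eta>1 ^^ k) x = x" for k
    using fixed by (induction k) auto
  show ?case
  proof (rule point_derivation_eq_0[OF L2.compact L2.Hausdorff L2.closed_K
        dual_topspace[OF x] dual_K[OF x], where D = "\<lambda>f. L1.E n (\<psi> (L2.J f)) x"])
    fix f g
    assume fg: "f \<in> vanishing X2 K2" "g \<in> vanishing X2 K2"
    show "L1.E n (\<psi> (L2.J (\<lambda>x. f x + g x))) x = L1.E n (\<psi> (L2.J f)) x + L1.E n (\<psi> (L2.J g)) x"
      using fg by (simp add: L2.J_add vanishing_carrier \<psi>_add L2.J_in_I L1.E_add \<psi>_carrier)
    have "L1.E n (\<psi> (L2.J (\<lambda>x. f x * g x))) x = L1.E n (\<psi> (L2.J f) \<otimes>\<^bsub>A1\<^esub> \<psi> (L2.J g)) x"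
      using fg by (simp add: L2.J_mult vanishing_carrier \<psi>_mult L2.J_in_I)
    also have "\<dots> = (\<Sum>k\<le>n. L1.E k (\<psi> (L2.J f)) x * L1.E (n - k) (\<psi> (L2.J g)) x)"
      using fg x by (simp add: L1.E_mult \<psi>_carrier L2.J_in_I iter)
    \<comment> \<open>Each intermediate term has a coefficient of positive degree below
      \<open>n\<close> as a factor. The two end terms form the Leibniz rule at
      \<open>dual x\<close>.\<close>
    also have "\<dots> = (\<Sum>k\<in>{0, n}. L1.E k (\<psi> (L2.J f)) x * L1.E (n - k) (\<psi> (L2.J g)) x)"
      using less.IH fg by (intro sum.mono_neutral_right) auto
    also have "\<dots> = f (dual x) * L1.E n (\<psi> (L2.J g)) x + L1.E n (\<psi> (L2.J f)) x * g (dual x)"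
      using less.prems(1) fg x by (simp add: dual_eq)
    finally show "L1.E n (\<psi> (L2.J (\<lambda>x. f x * g x))) x =
        f (dual x) * L1.E n (\<psi> (L2.J g)) x + L1.E n (\<psi> (L2.J f)) x * g (dual x)" .
  next
    fix c f
    assume "f \<in> vanishing X2 K2"
    then show "L1.E n (\<psi> (L2.J (\<lambda>x. c * f x))) x = c * L1.E n (\<psi> (L2.J f)) x"
      by (simp add: L2.J_smult vanishing_carrier \<psi>_smult L2.J_in_I L1.E_smult \<psi>_carrier)
  qed (fact less.prems(2))
qed

text \<open>On transported functions the whole fibre over \<open>x\<close> takes the same value. A
  character with \<theta>(U) = 0 equals evaluation by \<open>E1\<close>; otherwise \<open>x\<close>
  is fixed and all higher coefficients of \<psi>(f) vanish at \<open>x\<close>.\<close>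

lemma char_over_dual:
  assumes \<theta>: "L1.char_over \<theta> x" and x: "x \<notin> K1" and f: "f \<in> vanishing X2 K2"
  shows "\<theta> (\<psi> (L2.J f)) = f (dual x)"
proof -
  note x' = L1.char_over_topspace[OF \<theta>]
  have carrier: "\<psi> (L2.J f) \<in> carrier A1"
    using f by (simp add: \<psi>_carrier L2.J_in_I)
  have "\<theta> (\<psi> (L2.J f)) = E1 (\<psi> (L2.J f)) x"
  proof (cases "\<theta> L1.U = 0")
    case True
    show ?thesis
      by (rule L1.char_over_eqI[OF \<theta> L1.char_over_E0[OF x'] _ carrier]) (simp add: True L1.E0_U)
  next
    case False
    show ?thesis
      by (rule L1.char_over_eq_E0_if_E_zero[OF \<theta> carrier])
        (rule E_eq_0[OF x' x L1.char_over_fixed[OF \<theta> False] _ f])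
  qed
  then show ?thesis
    using dual_eq[OF x' x f] by simp
qed

lemma transport_dual:
  assumes \<theta>: "L1.char_over \<theta> x" and x: "x \<notin> K1"
  obtains \<theta>' where "L2.char_over \<theta>' (dual x)" "\<And>b. b \<in> I2 \<Longrightarrow> \<theta>' b = \<theta> (\<psi> b)"
proof -
  obtain y \<theta>' where y: "y \<notin> K2" "L2.char_over \<theta>' y" "\<And>b. b \<in> I2 \<Longrightarrow> \<theta>' b = \<theta> (\<psi> b)"
    using transport[OF assms] by blast
  have "y = dual x"
  proof (rule point_unique)
    fix f
    assume f: "f \<in> vanishing X2 K2"
    then show "f y = f (dual x)"
      using y(2) y(3)[OF L2.J_in_I[OF f]] char_over_dual[OF assms f]
      by (simp add: L2.char_over_J vanishing_carrier)
  qed (use y L2.char_over_topspace L1.char_over_topspace[OF \<theta>] x dual in auto)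
  then show ?thesis
    using that y by blast
qed

text \<open>The identity f(dual(x)) = E_0(\<psi>(f))(x) has a continuous right-hand side, and sets
  on which such an f is nonzero form a basis of neighbourhoods in the target.\<close>

lemma continuous_map_dual:
  "continuous_map (subtopology X1 (topspace X1 - K1)) (subtopology X2 (topspace X2 - K2)) dual"
proof -
  have "openin X1 {x \<in> topspace X1 - K1. dual x \<in> W}" if W: "openin X2 W" for W
  proof (subst openin_subopen, intro ballI)
    fix x0
    assume "x0 \<in> {x \<in> topspace X1 - K1. dual x \<in> W}"
    then have x0: "x0 \<in> topspace X1" "x0 \<notin> K1" "dual x0 \<in> W"
      by auto
    \<comment> \<open>A function vanishing on this set is nonzero only inside \<open>W\<close>, and
      it still belongs to the ideal.\<close>
    have "closedin X2 (K2 \<union> (topspace X2 - W))"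
      using W L2.closed_K by (intro closedin_Un) auto
    then obtain f where f: "f \<in> vanishing X2 (K2 \<union> (topspace X2 - W))" "f (dual x0) = 1"
      using vanishing_separates[OF L2.compact L2.Hausdorff, of "K2 \<union> (topspace X2 - W)" "dual x0"]
        dual_topspace dual_K x0 by auto
    then have f': "f \<in> vanishing X2 K2"
      by (auto simp: vanishing_def)
    let ?g = "E1 (\<psi> (L2.J f))"
    have "?g \<in> carrier (cont_alg X1)"
      using f' by (simp add: L1.E0_closed \<psi>_carrier L2.J_in_I)
    then have "openin X1 {x \<in> topspace X1. ?g x \<in> - {0}}"
      by (intro openin_continuous_map_preimage[of X1 euclidean]) (auto simp: cont_alg_iff)
    moreover have "openin X1 (topspace X1 - K1)"
      using L1.closed_K by auto
    ultimately have "openin X1 ({x \<in> topspace X1. ?g x \<in> - {0}} \<inter> (topspace X1 - K1))"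
      by (rule openin_Int)
    moreover have "dual x \<in> W" if x: "x \<in> topspace X1" "x \<notin> K1" "?g x \<noteq> 0" for x
      using dual_eq[OF x(1,2) f'] x(3) f(1) dual_topspace[OF x(1,2)] by (auto simp: vanishing_def)
    ultimately show "\<exists>T. openin X1 T \<and> x0 \<in> T \<and> T \<subseteq> {x \<in> topspace X1 - K1. dual x \<in> W}"
      using x0 f(2) dual_eq[OF x0(1,2) f']
      by (intro exI[of _ "{x \<in> topspace X1. ?g x \<in> - {0}} \<inter> (topspace X1 - K1)"]) auto
  qed
  then have "openin (subtopology X1 (topspace X1 - K1)) {x \<in> topspace X1 - K1. dual x \<in> W}"
    if "openin X2 W" for W
    using that by (subst openin_open_subtopology) (use L1.closed_K in auto)
  moreover have "topspace (subtopology X1 (topspace X1 - K1)) = topspace X1 - K1"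
    by auto
  ultimately have "continuous_map (subtopology X1 (topspace X1 - K1)) X2 dual"
    unfolding continuous_map_def by (simp add: dual_topspace Pi_iff)
  then show ?thesis
    by (rule continuous_map_into_subtopology) (auto simp: dual_topspace dual_K)
qed

end

section \<open>The inverse homeomorphism and the conjugacy relation\<close>

context isomorphic_ideals
begin

interpretation S: isomorphic_ideals X2 \<eta>2 A2 \<iota>2 E2 K2 I2 X1 \<eta>1 A1 \<iota>1 E1 K1 I1 \<psi> \<phi>
  by (rule swapped)

text \<open>The character transported back from \<open>y\<close> lies over \<open>S.dual y\<close>
  but need not be evaluation by \<open>E1\<close> there. This is why agreement along entire fibres,
  as in \<open>char_over_dual\<close>, is required to make the two maps inverse.\<close>

lemma dual_dual:
  assumes y: "y \<in> topspace X2" "y \<notin> K2"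
  shows "dual (S.dual y) = y"
proof -
  obtain \<theta>' where \<theta>': "L1.char_over \<theta>' (S.dual y)" "\<And>a. a \<in> I1 \<Longrightarrow> \<theta>' a = E2 (\<phi> a) y"
    using S.transport_dual[OF L2.char_over_E0[OF y(1)] y(2)] by blast
  have notin: "S.dual y \<notin> K1" and top: "S.dual y \<in> topspace X1"
    using S.dual y by auto
  show ?thesis
  proof (rule point_unique)
    fix f
    assume f: "f \<in> vanishing X2 K2"
    have "f (dual (S.dual y)) = \<theta>' (\<psi> (L2.J f))"
      using char_over_dual[OF \<theta>'(1) notin f] by simp
    also have "\<dots> = f y"
      using f by (simp add: \<theta>'(2) \<psi>_closed L2.J_in_I \<phi>_\<psi> L2.E0_cont vanishing_carrier)
    finally show "f (dual (S.dual y)) = f y" .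
  qed (use y dual[OF top notin] in auto)
qed

lemma homeomorphic_map_dual:
  "homeomorphic_map (subtopology X1 (topspace X1 - K1)) (subtopology X2 (topspace X2 - K2)) dual"
proof -
  have "S.dual (dual x) = x" if "x \<in> topspace X1" "x \<notin> K1" for x
    using that by (rule isomorphic_ideals.dual_dual[OF swapped])
  then have "homeomorphic_maps (subtopology X1 (topspace X1 - K1)) (subtopology X2 (topspace X2 - K2))
    dual S.dual"
    unfolding homeomorphic_maps_def
    using continuous_map_dual S.continuous_map_dual dual_dual by auto
  then show ?thesis
    using homeomorphic_maps_map by blast
qed

text \<open>The growth condition gives convergence only inside the disc over the point, so it has to
  be excluded that the value lies on the boundary. The disc over \<open>y\<close> is mapped
  injectively and holomorphically into the fibre over \<open>S.dual y\<close>, with the centre going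
  to the given value. The image is open, so some character has a value at \<open>U\<close> of larger
  modulus.\<close>

lemma transported_value_admissible:
  assumes y: "y \<in> topspace X2" "y \<notin> K2"
    and \<theta>: "L1.char_over \<theta> (S.dual y)" and \<theta>_eq: "\<And>a. a \<in> I1 \<Longrightarrow> \<theta> a = E2 (\<phi> a) y"
  shows "L1.admissible (\<theta> L1.U)"
proof (cases "\<theta> L1.U = 0")
  case True
  then show ?thesis
    by (simp add: L1.admissible_0)
next
  case False
  define z where "z = \<theta> L1.U"
  define x where "x = S.dual y"
  have x: "x \<in> topspace X1" "x \<notin> K1"
    using S.dual[OF y] by (auto simp: x_def)
  have "dual x = y"
    using dual_dual[OF y] by (simp add: x_def)
  obtain g where g: "g \<in> vanishing X1 K1" "g x = 1"
    using L1.vanishing_on_K_separates[OF x] by blast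
  \<comment> \<open>\<open>U\<close> need not lie in the ideal. Every character over
    \<open>x\<close> takes the same value at \<open>a\<close> as at \<open>U\<close>, because g(x) =
    1.\<close>
  define a where "a = L1.J g \<otimes>\<^bsub>A1\<^esub> L1.U"
  have a: "a \<in> I1"
    using g by (simp add: a_def L1.JU_in_I)
  have value_a: "\<theta>' a = \<theta>' L1.U" if "L1.char_over \<theta>' x" for \<theta>'
    using that g by (simp add: a_def L1.char_over_character[THEN character_mult] L1.char_over_J
        vanishing_carrier)
  \<comment> \<open>This character guarantees a disc of positive radius over \<open>y\<close>. If it
    were 0 at \<open>U\<close> it would be evaluation by \<open>E2\<close> at \<open>y\<close>, and
    comparing its value at \<phi>(a) computed through either algebra would give \<theta>(U) =
    0.\<close>
  obtain \<rho> where \<rho>: "L2.char_over \<rho> y" "\<And>b. b \<in> I2 \<Longrightarrow> \<rho> b = E1 (\<psi> b) x"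
    using transport_dual[OF L1.char_over_E0[OF x(1)] x(2)] \<open>dual x = y\<close> by metis
  have "\<rho> L2.U \<noteq> 0"
  proof
    assume "\<rho> L2.U = 0"
    then have "\<rho> (\<phi> a) = E2 (\<phi> a) y"
      using L2.char_over_eqI[OF \<rho>(1) L2.char_over_E0[OF y(1)]] L2.I_carrier[OF \<phi>_closed[OF a]]
      by (simp add: L2.E0_U)
    then have "E1 a x = \<theta> a"
      using a by (simp add: \<rho>(2) \<phi>_closed \<psi>_\<phi> \<theta>_eq)
    moreover have "E1 a x = 0"
      using g by (simp add: a_def L1.E0_mult_U vanishing_carrier)
    ultimately show False
      using False \<theta> value_a[of \<theta>] by (simp add: x_def)
  qed
  define r where "r = cmod (\<rho> L2.U)"
  have "r > 0"
    using \<open>\<rho> L2.U \<noteq> 0\<close> by (simp add: r_def)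
  have over2: "L2.char_over (L2.point_char y w) y" if "w \<in> ball 0 r" for w
  proof (rule L2.char_over_point_char[OF _ y(1)])
    show "L2.admissible w"
      using that L2.admissible_if_less[OF L2.char_over_character[OF \<rho>(1)] L2.char_over_one[OF \<rho>(1)]]
      by (simp add: r_def)
    show "w = 0 \<or> \<eta>2 y = y"
      using L2.char_over_fixed[OF \<rho>(1) \<open>\<rho> L2.U \<noteq> 0\<close>] by simp
  qed
  define F where "F w = L2.point_char y w (\<phi> a)" for w
  have over1: "\<exists>\<theta>'. L1.char_over \<theta>' x \<and> \<theta>' L1.U = F w \<and>
      (\<forall>b\<in>I2. \<theta>' (\<psi> b) = L2.point_char y w b)" if w: "w \<in> ball 0 r" for w
  proof -
    obtain \<theta>' where \<theta>': "L1.char_over \<theta>' x" "\<And>a. a \<in> I1 \<Longrightarrow> \<theta>' a = L2.point_char y w (\<phi> a)"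
      using S.transport_dual[OF over2[OF w] y(2)] unfolding x_def by blast
    then show ?thesis
      using value_a[OF \<theta>'(1)] a
      by (intro exI[of _ \<theta>']) (simp add: F_def \<psi>_closed \<phi>_\<psi>)
  qed
  obtain h where h: "h \<in> vanishing X2 K2" "h y = 1"
    using L2.vanishing_on_K_separates[OF y] by blast
  \<comment> \<open>The counterpart of \<open>a\<close> in the second algebra: it recovers the
    coordinate \<open>w\<close> from the character, which makes \<open>F\<close> injective.\<close>
  define b where "b = L2.J h \<otimes>\<^bsub>A2\<^esub> L2.U"
  have b: "b \<in> I2"
    using h by (simp add: b_def L2.JU_in_I)
  have value_b: "L2.point_char y w b = w" if "w \<in> ball 0 r" for w
    using over2[OF that] h y(1)
    by (simp add: b_def L2.char_over_character[THEN character_mult] L2.char_over_J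
        vanishing_carrier L2.point_char_U)
  have "inj_on F (ball 0 r)"
  proof (rule inj_onI)
    fix w w'
    assume w: "w \<in> ball 0 r" and w': "w' \<in> ball 0 r" and "F w = F w'"
    then obtain \<theta>1 \<theta>2 where "L1.char_over \<theta>1 x" "L1.char_over \<theta>2 x" "\<theta>1 L1.U = \<theta>2 L1.U"
      "\<theta>1 (\<psi> b) = w" "\<theta>2 (\<psi> b) = w'"
      using over1[OF w] over1[OF w'] b value_b[OF w] value_b[OF w'] by metis
    then show "w = w'"
      using L1.char_over_eqI[of \<theta>1 x \<theta>2 "\<psi> b"] b \<psi>_carrier by auto
  qed
  moreover have "F holomorphic_on ball 0 r"
  proof (rule power_series_holomorphic)
    fix w :: complex
    assume w: "w \<in> ball 0 r"
    have "L2.admissible w"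
      using w L2.admissible_if_less[OF L2.char_over_character[OF \<rho>(1)] L2.char_over_one[OF \<rho>(1)]]
      by (simp add: r_def)
    then have "summable (\<lambda>n. L2.E n (\<phi> a) y * w ^ n)"
      by (rule summable_norm_cancel[OF L2.summable_E[OF _ L2.I_carrier[OF \<phi>_closed[OF a]] y(1)]])
    then show "(\<lambda>n. L2.E n (\<phi> a) y * (w - 0) ^ n) sums F w"
      by (simp add: F_def L2.point_char_def summable_sums)
  qed
  ultimately have "open (F ` ball 0 r)"
    by (intro open_mapping_thm3) auto
  moreover have "F 0 = z"
    using a value_a[of \<theta>] \<theta> by (simp add: F_def L2.point_char_0 z_def \<theta>_eq x_def)
  then have "z \<in> F ` ball 0 r"
    using \<open>r > 0\<close> by (metis centre_in_ball imageI)
  ultimately obtain e where e: "e > 0" "ball z e \<subseteq> F ` ball 0 r"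
    using open_contains_ball by blast
  \<comment> \<open>Half of the available radius further out along the ray through
    \<open>z\<close>.\<close>
  define z' where "z' = z + complex_of_real (e / 2) * sgn z"
  have "z' = complex_of_real (cmod z + e / 2) * sgn z"
    using False by (simp add: z'_def z_def sgn_eq algebra_simps)
  then have norm_z': "cmod z' = cmod z + e / 2"
    using e(1) False by (simp add: norm_mult norm_sgn z_def del: of_real_add)
  have "z' \<in> ball z e"
    using e(1) False by (simp add: z'_def dist_norm norm_mult norm_sgn z_def)
  then obtain w where w: "w \<in> ball 0 r" "z' = F w"
    using e(2) by blast
  then obtain \<theta>' where \<theta>': "L1.char_over \<theta>' x" "\<theta>' L1.U = z'"
    using over1 by blast
  have "cmod z < cmod (\<theta>' L1.U)"
    using norm_z' e(1) by (simp add: \<theta>'(2))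
  then show ?thesis
    unfolding z_def by (rule L1.admissible_if_less[OF L1.char_over_character[OF \<theta>'(1)] L1.char_over_one[OF \<theta>'(1)]])
qed

text \<open>Over a pair of distinct points \<open>x\<close>, \<open>\<eta> x\<close> there is a derivation which is not a difference of
  characters. Transported to the second algebra and corrected by a multiple of the difference of
  characters, it vanishes on functions; by \<open>g U f = g (f \<circ> \<eta>2) U\<close> it can only be nonzero if the
  dual points are related by \<^term>\<open>\<eta>2\<close>.\<close>

lemma dual_intertwines_nonfixed:
  assumes x: "x \<in> topspace X1" "x \<notin> K1" and "\<eta>1 x \<noteq> x"
  shows "dual (\<eta>1 x) = \<eta>2 (dual x)"
proof (rule ccontr)
  assume neq: "dual (\<eta>1 x) \<noteq> \<eta>2 (dual x)"
  define x' where "x' = \<eta>1 x"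
  define y where "y = dual x"
  define y' where "y' = dual x'"
  have x': "x' \<in> topspace X1" "x' \<notin> K1"
    using x by (simp_all add: x'_def L1.\<eta>_closed L1.\<eta>_K_iff)
  have y: "y \<in> topspace X2" "y \<notin> K2" and y': "y' \<in> topspace X2" "y' \<notin> K2"
    using x x' by (simp_all add: y_def y'_def dual_topspace dual_K)
  have inverse: "S.dual y = x" "S.dual y' = x'"
    using isomorphic_ideals.dual_dual[OF swapped] x x' by (simp_all add: y_def y'_def)
  then have "y \<noteq> y'"
    using assms(3) by (auto simp: x'_def)
  \<comment> \<open>The character over \<eta>(x) is the transport of evaluation by \<open>E2\<close>
    at \<open>y'\<close>. Its value at \<open>U\<close> is therefore admissible, and the derivation
    built from it converges.\<close>
  obtain \<rho> where "L1.char_over \<rho> (S.dual y')"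
    and \<rho>_eq: "\<And>a. a \<in> I1 \<Longrightarrow> \<rho> a = E2 (\<phi> a) y'"
    using S.transport_dual[OF L2.char_over_E0[OF y'(1)] y'(2)] by blast
  then have \<rho>: "L1.char_over \<rho> x'"
    by (simp add: inverse)
  define z where "z = \<rho> L1.U"
  have z: "L1.admissible z"
    unfolding z_def using \<rho> \<rho>_eq by (intro transported_value_admissible[OF y']) (auto simp: inverse)
  have fixed: "z = 0 \<or> \<eta>1 x' = x'"
    using L1.char_over_fixed[OF \<rho>] by (auto simp: z_def)
  have \<rho>_point_char: "L1.point_char x' z a = \<rho> a" if "a \<in> carrier A1" for a
    using L1.char_over_eqI[OF L1.char_over_point_char[OF z x'(1) fixed] \<rho> _ that]
    by (simp add: L1.point_char_U x' z_def)
  let ?\<delta> = "L1.point_deriv x z"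
  have \<delta>_mult: "?\<delta> (a \<otimes>\<^bsub>A1\<^esub> b) = E1 a x * ?\<delta> b + ?\<delta> a * \<rho> b" if "a \<in> carrier A1" "b \<in> carrier A1" for a b
    using L1.point_deriv_mult[OF z x(1) _ that] fixed \<rho>_point_char[OF that(2)] by (simp add: x'_def)
  obtain h where h: "h \<in> vanishing X2 K2" "h y = 1" "h y' = 0"
    using L2.vanishing_on_K_separates_points[OF y y'(1) \<open>y \<noteq> y'\<close>] by blast
  \<comment> \<open>With h(y) = 1 and h(y') = 0 the difference of the two characters is 1 at
    \<open>h\<close>, so subtracting \<open>c\<close> times it makes \<open>D\<close> vanish
    there.\<close>
  define c where "c = ?\<delta> (\<psi> (L2.J h))"
  let ?\<theta> = "\<lambda>b. E1 (\<psi> b) x" and ?\<theta>' = "\<lambda>b. E2 b y'"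
  have \<rho>_\<psi>: "\<rho> (\<psi> b) = ?\<theta>' b" if "b \<in> I2" for b
    using that by (simp add: \<rho>_eq \<psi>_closed \<phi>_\<psi>)
  define D where "D b = ?\<delta> (\<psi> b) - c * (?\<theta> b - ?\<theta>' b)" for b
  have D_add: "D (b \<oplus>\<^bsub>A2\<^esub> b') = D b + D b'" if "b \<in> I2" "b' \<in> I2" for b b'
    using that z x
    by (simp add: D_def \<psi>_add \<psi>_carrier L1.point_deriv_add L1.E0_add L2.E0_add L2.I_carrier algebra_simps)
  have D_mult: "D (b \<otimes>\<^bsub>A2\<^esub> b') = ?\<theta> b * D b' + D b * ?\<theta>' b'" if "b \<in> I2" "b' \<in> I2" for b b'
    using that
    by (simp add: D_def \<psi>_mult \<psi>_carrier \<delta>_mult \<rho>_\<psi> L1.E0_mult L2.E0_mult L2.I_carrier algebra_simps)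
  have \<theta>_J: "?\<theta> (L2.J f) = f y" "?\<theta>' (L2.J f) = f y'" if "f \<in> vanishing X2 K2" for f
    using that x by (simp_all add: dual_eq y_def L2.E0_cont vanishing_carrier)
  \<comment> \<open>Functions commute: applying the derivation to f h = h f gives
    \<delta>(\<psi>(f)) = c (f(y) - f(y')), so on functions it is a multiple of the difference of
    the characters.\<close>
  have D_J: "D (L2.J f) = 0" if f: "f \<in> vanishing X2 K2" for f
  proof -
    have "\<psi> (L2.J f) \<otimes>\<^bsub>A1\<^esub> \<psi> (L2.J h) = \<psi> (L2.J h) \<otimes>\<^bsub>A1\<^esub> \<psi> (L2.J f)"
      using L2.J_mult[of f h] L2.J_mult[of h f] f h
      by (simp add: L2.J_in_I vanishing_carrier mult.commute flip: \<psi>_mult)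
    then have "?\<theta> (L2.J f) * ?\<delta> (\<psi> (L2.J h)) + ?\<delta> (\<psi> (L2.J f)) * ?\<theta>' (L2.J h) =
        ?\<theta> (L2.J h) * ?\<delta> (\<psi> (L2.J f)) + ?\<delta> (\<psi> (L2.J h)) * ?\<theta>' (L2.J f)"
      using \<delta>_mult[of "\<psi> (L2.J f)" "\<psi> (L2.J h)"] \<delta>_mult[of "\<psi> (L2.J h)" "\<psi> (L2.J f)"] f h
      by (simp add: \<psi>_carrier L2.J_in_I \<rho>_\<psi>)
    then show ?thesis
      using f h by (simp add: D_def \<theta>_J c_def algebra_simps)
  qed
  have D_JU: "D (L2.J g \<otimes>\<^bsub>A2\<^esub> L2.U) = 0" if g: "g \<in> vanishing X2 K2" for g
  proof -
    \<comment> \<open>As y' differs from \<eta>2(y), this f distinguishes the two sides of (g U) f =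
      (f o \<eta>2) (g U): \<open>D\<close> yields D(g U) on the left and 0 on the right.\<close>
    obtain f where f: "f \<in> vanishing X2 K2" "f y' = 1" "f (\<eta>2 y) = 0"
      using L2.vanishing_on_K_separates_points[OF y' L2.\<eta>_closed[OF y(1)]] neq
      by (auto simp: y_def y'_def x'_def)
    let ?f = "pullback X2 \<eta>2 f"
    have f': "?f \<in> vanishing X2 K2"
      using f(1) by (rule L2.pullback_vanishing)
    note carrier = f(1)[THEN vanishing_carrier] f'[THEN vanishing_carrier] g[THEN vanishing_carrier]
    have "(L2.J g \<otimes>\<^bsub>A2\<^esub> L2.U) \<otimes>\<^bsub>A2\<^esub> L2.J f = (L2.J g \<otimes>\<^bsub>A2\<^esub> L2.J ?f) \<otimes>\<^bsub>A2\<^esub> L2.U"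
      using carrier by (simp add: L2.alg.m_assoc L2.U_J)
    also have "L2.J g \<otimes>\<^bsub>A2\<^esub> L2.J ?f = L2.J ?f \<otimes>\<^bsub>A2\<^esub> L2.J g"
      using L2.J_mult[of g ?f] L2.J_mult[of ?f g] carrier by (simp add: mult.commute)
    finally have "D ((L2.J g \<otimes>\<^bsub>A2\<^esub> L2.U) \<otimes>\<^bsub>A2\<^esub> L2.J f) = D (L2.J ?f \<otimes>\<^bsub>A2\<^esub> (L2.J g \<otimes>\<^bsub>A2\<^esub> L2.U))"
      using carrier by (simp add: L2.alg.m_assoc)
    then show ?thesis
      using f f' g y(1) by (simp add: D_mult L2.J_in_I L2.JU_in_I D_J \<theta>_J)
  qed
  have D_0: "D b = 0" if b: "b \<in> I2" for b
  proof -
    define u where "u = L2.tail b \<otimes>\<^bsub>A2\<^esub> L2.U"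
    have b': "b \<in> carrier A2" and E2_b: "E2 b \<in> vanishing X2 K2"
      using b by (simp_all add: L2.I_carrier L2.E0_vanishing)
    have u_carrier: "u \<in> carrier A2"
      using b' by (simp add: u_def)
    have b_eq: "b = L2.J (E2 b) \<oplus>\<^bsub>A2\<^esub> u"
      using b' L2.decomposition(2) by (simp add: u_def)
    have "u = b \<ominus>\<^bsub>A2\<^esub> L2.J (E2 b)"
      using L2.add_minus_cancel[of "L2.J (E2 b)" u] E2_b u_carrier
      by (simp add: vanishing_carrier flip: b_eq)
    then have u: "u \<in> I2"
      using b E2_b by (simp add: L2.I_minus L2.J_in_I)
    obtain g where g: "g \<in> vanishing X2 K2" "g y' = 1"
      using L2.vanishing_on_K_separates[OF y'] by blast
    have pg: "pullback X2 \<eta>2 g \<in> vanishing X2 K2"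
      using g(1) by (rule L2.pullback_vanishing)
    \<comment> \<open>\<open>D\<close> is a derivation only on the ideal, to which the tail of
      \<open>b\<close> need not belong. Distributing the factors of g o \<eta>2 writes u g as a
      product (tail(b) k1) (k2 U) of two elements of the ideal.\<close>
    then obtain k1 k2 where k: "k1 \<in> carrier (cont_alg X2)" "k2 \<in> carrier (cont_alg X2)"
      "\<And>x. pullback X2 \<eta>2 g x = k1 x * k2 x" "\<And>x. pullback X2 \<eta>2 g x = 0 \<Longrightarrow> k1 x = 0 \<and> k2 x = 0"
      using cont_alg_factorization[OF vanishing_carrier[OF pg]] by metis
    have k_vanishing: "k1 \<in> vanishing X2 K2" "k2 \<in> vanishing X2 K2"
      using pg k(1,2,4) by (simp_all add: vanishing_def)
    have "u \<otimes>\<^bsub>A2\<^esub> L2.J g = L2.tail b \<otimes>\<^bsub>A2\<^esub> (L2.J (pullback X2 \<eta>2 g) \<otimes>\<^bsub>A2\<^esub> L2.U)"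
      using b' g(1) by (simp add: u_def L2.alg.m_assoc L2.U_J vanishing_carrier)
    also have "pullback X2 \<eta>2 g = (\<lambda>x. k1 x * k2 x)"
      using k(3) by blast
    finally have "u \<otimes>\<^bsub>A2\<^esub> L2.J g = (L2.tail b \<otimes>\<^bsub>A2\<^esub> L2.J k1) \<otimes>\<^bsub>A2\<^esub> (L2.J k2 \<otimes>\<^bsub>A2\<^esub> L2.U)"
      using b' k(1,2) by (simp add: L2.J_mult L2.alg.m_assoc)
    then have "D (u \<otimes>\<^bsub>A2\<^esub> L2.J g) = 0"
      using b' k(2) k_vanishing
      by (simp add: D_mult L2.I_mult_left L2.J_in_I L2.JU_in_I D_JU L2.E0_mult_U)
    then have "D u = 0"
      using u g by (simp add: D_mult L2.J_in_I D_J \<theta>_J)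
    then show ?thesis
      using D_add[OF L2.J_in_I[OF E2_b] u] D_J[OF E2_b] by (simp flip: b_eq)
  qed
  obtain g where g: "g \<in> vanishing X1 K1" "g x = 1" "g x' = 0"
    using L1.vanishing_on_K_separates_points[OF x x'(1)] assms(3) by (auto simp: x'_def)
  let ?a = "L1.J g \<otimes>\<^bsub>A1\<^esub> L1.U"
  have a: "?a \<in> I1"
    using g(1) by (rule L1.JU_in_I)
  \<comment> \<open>The derivation of g U is g(x) = 1, while both characters vanish there: the first
    because \<open>E1\<close> annihilates right multiples of \<open>U\<close>, the second because
    g(x') = 0.\<close>
  have "D (\<phi> ?a) = 1"
    using a g \<rho>_eq[OF a, symmetric] \<rho>
    by (simp add: D_def \<psi>_\<phi> L1.point_deriv_J_mult_U L1.E0_mult_U vanishing_carrier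
        L1.char_over_character[THEN character_mult] L1.char_over_J)
  then show False
    using D_0[OF \<phi>_closed[OF a]] by simp
qed

text \<open>A fixed point must go to a fixed point: otherwise the non-fixed case for the inverse map
  shows that its image and the image of that under \<eta>2 have the same preimage.\<close>

lemma dual_intertwines:
  assumes x: "x \<in> topspace X1" "x \<notin> K1"
  shows "dual (\<eta>1 x) = \<eta>2 (dual x)"
proof (cases "\<eta>1 x = x")
  case True
  let ?y = "dual x"
  have y: "?y \<in> topspace X2" "?y \<notin> K2"
    using x by (simp_all add: dual_topspace dual_K)
  have inverse: "S.dual ?y = x"
    using x by (rule isomorphic_ideals.dual_dual[OF swapped])
  have "\<eta>2 ?y = ?y"
  proof (rule ccontr)
    assume "\<eta>2 ?y \<noteq> ?y"
    from isomorphic_ideals.dual_intertwines_nonfixed[OF swapped y this] have "S.dual (\<eta>2 ?y) = x"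
      by (simp add: inverse True)
    then have "\<eta>2 ?y = dual x"
      using dual_dual[of "\<eta>2 ?y"] y by (simp add: L2.\<eta>_closed L2.\<eta>_K_iff)
    then show False
      using \<open>\<eta>2 ?y \<noteq> ?y\<close> by simp
  qed
  then show ?thesis
    by (simp add: True)
qed (rule dual_intertwines_nonfixed[OF x])

end

section \<open>The supremum norm\<close>

lemma sup_norm_bdd:
  assumes "compact_space X" "f \<in> carrier (cont_alg X)"
  shows "bdd_above (insert 0 ((\<lambda>x. cmod (f x)) ` topspace X))"
proof -
  have "compactin euclidean (f ` topspace X)"
    using assms by (intro image_compactin[of X]) (auto simp: cont_alg_iff compact_space_def)
  then have "bounded (f ` topspace X)"
    by (simp add: compact_imp_bounded)
  then show ?thesis
    unfolding bdd_above_insert by (auto simp: bounded_iff bdd_above_def)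
qed

lemma le_sup_norm:
  assumes "compact_space X" "f \<in> carrier (cont_alg X)"
  shows "cmod (f x) \<le> sup_norm X f"
proof (cases "x \<in> topspace X")
  case True
  then show ?thesis
    unfolding sup_norm_def by (intro cSup_upper sup_norm_bdd assms) auto
next
  case False
  then have "f x = 0"
    using assms(2) by (simp add: cont_alg_iff)
  then show ?thesis
    unfolding sup_norm_def by (intro cSup_upper sup_norm_bdd assms) auto
qed

lemma sup_norm_le: "0 \<le> M \<Longrightarrow> (\<And>x. x \<in> topspace X \<Longrightarrow> cmod (f x) \<le> M) \<Longrightarrow> sup_norm X f \<le> M"
  unfolding sup_norm_def by (rule cSup_least) auto

lemma sup_norm_nonneg:
  assumes "compact_space X" "f \<in> carrier (cont_alg X)"
  shows "0 \<le> sup_norm X f"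
  by (rule order_trans[OF norm_ge_zero le_sup_norm[OF assms, of undefined]])

lemma sup_norm_0 [simp]: "sup_norm X (\<lambda>x. 0) = 0"
  by (simp add: sup_norm_def image_constant_conv)

lemma sup_norm_eq_0_iff:
  assumes "compact_space X" "f \<in> carrier (cont_alg X)"
  shows "sup_norm X f = 0 \<longleftrightarrow> f = (\<lambda>x. 0)"
proof
  assume "sup_norm X f = 0"
  then show "f = (\<lambda>x. 0)"
    using le_sup_norm[OF assms] by fastforce
qed simp

lemma sup_norm_add:
  assumes "compact_space X" "f \<in> carrier (cont_alg X)" "g \<in> carrier (cont_alg X)"
  shows "sup_norm X (\<lambda>x. f x + g x) \<le> sup_norm X f + sup_norm X g"
  using assms
  by (intro sup_norm_le add_nonneg_nonneg sup_norm_nonneg norm_triangle_le add_mono le_sup_norm)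

lemma sup_norm_smult:
  assumes "compact_space X" "f \<in> carrier (cont_alg X)"
  shows "sup_norm X (\<lambda>x. c * f x) = cmod c * sup_norm X f"
proof -
  have le: "sup_norm X (\<lambda>x. d * g x) \<le> cmod d * sup_norm X g" if "g \<in> carrier (cont_alg X)" for d g
    using assms(1) that
    by (intro sup_norm_le) (auto simp: norm_mult sup_norm_nonneg intro: mult_left_mono le_sup_norm)
  show ?thesis
  proof (cases "c = 0")
    case False
    have "f = (\<lambda>x. inverse c * (c * f x))"
      using False by (simp add: fun_eq_iff)
    then have "sup_norm X f \<le> cmod (inverse c) * sup_norm X (\<lambda>x. c * f x)"
      using le[of "\<lambda>x. c * f x" "inverse c"] assms(2) cont_alg_smult by metis
    then have "cmod c * sup_norm X f \<le> sup_norm X (\<lambda>x. c * f x)"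
      using False by (simp add: norm_divide field_simps)
    then show ?thesis
      using le[OF assms(2), of c] by simp
  qed simp
qed

lemma sup_norm_minus:
  "sup_norm X (\<lambda>x. f x - g x) = sup_norm X (\<lambda>x. g x - f x)"
  by (simp add: sup_norm_def norm_minus_commute)

lemma cont_alg_minus [intro]:
  assumes "f \<in> carrier (cont_alg X)" "g \<in> carrier (cont_alg X)"
  shows "(\<lambda>x. f x - g x) \<in> carrier (cont_alg X)"
  using cont_alg_add[OF assms(1) cont_alg_smult[OF assms(2), of "-1"]] by simp

lemma sup_norm_minus_triangle:
  assumes "compact_space X" "f \<in> carrier (cont_alg X)" "g \<in> carrier (cont_alg X)" "h \<in> carrier (cont_alg X)"
  shows "sup_norm X (\<lambda>x. f x - h x) \<le> sup_norm X (\<lambda>x. f x - g x) + sup_norm X (\<lambda>x. g x - h x)"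
  using sup_norm_add[OF assms(1) cont_alg_minus[OF assms(2,3)] cont_alg_minus[OF assms(3,4)]] by simp

lemma sup_norm_complete:
  assumes compact: "compact_space X" and f: "\<And>k. f k \<in> carrier (cont_alg X)"
    and Cauchy: "\<And>e. e > 0 \<Longrightarrow> \<exists>N. \<forall>k\<ge>N. \<forall>l\<ge>N. sup_norm X (\<lambda>x. f k x - f l x) < e"
  obtains g where "g \<in> carrier (cont_alg X)" "(\<lambda>k. sup_norm X (\<lambda>x. f k x - g x)) \<longlonglongrightarrow> 0"
proof -
  have diff: "cmod (f k x - f l x) \<le> sup_norm X (\<lambda>x. f k x - f l x)" for k l x
    using le_sup_norm[OF compact cont_alg_minus[OF f f]] .
  have "Cauchy (\<lambda>k. f k x)" for x
    unfolding Cauchy_def dist_norm using Cauchy diff by (meson le_less_trans)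
  then have lim: "(\<lambda>k. f k x) \<longlonglongrightarrow> lim (\<lambda>k. f k x)" for x
    by (simp add: Cauchy_convergent_iff convergent_LIMSEQ_iff)
  define g where "g x = lim (\<lambda>k. f k x)" for x
  note lim = lim[folded g_def]
  have close: "\<exists>N. \<forall>k\<ge>N. \<forall>x. cmod (f k x - g x) \<le> e" if e: "e > 0" for e
  proof -
    obtain N where N: "\<And>k l. k \<ge> N \<Longrightarrow> l \<ge> N \<Longrightarrow> sup_norm X (\<lambda>x. f k x - f l x) < e"
      using Cauchy[OF e] by blast
    have "cmod (f k x - g x) \<le> e" if "k \<ge> N" for k x
    proof (rule LIMSEQ_le_const2)
      show "(\<lambda>l. cmod (f k x - f l x)) \<longlonglongrightarrow> cmod (f k x - g x)"
        by (intro tendsto_intros lim)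
      show "\<exists>M. \<forall>l\<ge>M. cmod (f k x - f l x) \<le> e"
        using N[OF that] diff by (meson less_imp_le order_trans)
    qed
    then show ?thesis
      by blast
  qed
  have "continuous_map X Met_TC.mtopology g"
  proof (rule Met_TC.continuous_map_uniform_limit[where F = sequentially and f = f])
    show "\<forall>\<^sub>F k in sequentially. continuous_map X Met_TC.mtopology (f k)"
      using f by (simp add: cont_alg_iff)
    fix e :: real
    assume "e > 0"
    then obtain N where N: "\<And>k x. k \<ge> N \<Longrightarrow> cmod (f k x - g x) \<le> e / 2"
      using close[of "e / 2"] by auto
    have "dist (f k x) (g x) < e" if "k \<ge> N" for k x
      using N[OF that, of x] \<open>e > 0\<close> by (simp add: dist_norm)
    then have "\<forall>k\<ge>N. \<forall>x\<in>topspace X. g x \<in> UNIV \<and> dist (f k x) (g x) < e"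
      by simp
    then show "\<forall>\<^sub>F k in sequentially. \<forall>x\<in>topspace X. g x \<in> UNIV \<and> dist (f k x) (g x) < e"
      unfolding eventually_sequentially by blast
  qed simp
  moreover have "g x = 0" if "x \<notin> topspace X" for x
  proof -
    have "(\<lambda>k. f k x) = (\<lambda>k. 0)"
      using f that by (simp add: cont_alg_iff)
    then show ?thesis
      using LIMSEQ_unique[OF lim[of x], of 0] by simp
  qed
  ultimately have g: "g \<in> carrier (cont_alg X)"
    by (simp add: cont_alg_iff)
  have "(\<lambda>k. sup_norm X (\<lambda>x. f k x - g x)) \<longlonglongrightarrow> 0"
  proof (rule LIMSEQ_I)
    fix e :: real
    assume "e > 0"
    then obtain N where N: "\<And>k x. k \<ge> N \<Longrightarrow> cmod (f k x - g x) \<le> e / 2"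
      using close[of "e / 2"] by auto
    have "norm (sup_norm X (\<lambda>x. f k x - g x) - 0) < e" if "k \<ge> N" for k
    proof -
      have "sup_norm X (\<lambda>x. f k x - g x) \<le> e / 2"
        using N[OF that] \<open>e > 0\<close> by (intro sup_norm_le) auto
      then show ?thesis
        using sup_norm_nonneg[OF compact cont_alg_minus[OF f g]] \<open>e > 0\<close> by (simp add: abs_of_nonneg)
    qed
    then show "\<exists>N. \<forall>k\<ge>N. norm (sup_norm X (\<lambda>x. f k x - g x) - 0) < e"
      by blast
  qed
  then show ?thesis
    using that g by blast
qed

section \<open>The algebra of absolutely summable skew power series\<close>

text \<open>Iterates of \<open>\<eta>\<close> add up along the exponents, so the interchange of
  triangular sums that proves associativity for formal power series applies at each point.\<close>

lemma skew_mult_assoc: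
  "(\<lambda>n x. \<Sum>k\<le>n. (\<Sum>j\<le>k. p j x * q (k - j) ((\<eta> ^^ j) x)) * r (n - k) ((\<eta> ^^ k) x)) =
   (\<lambda>n x. \<Sum>j\<le>n. p j x * (\<Sum>m\<le>n - j. q m ((\<eta> ^^ j) x) * (r (n - j - m) ((\<eta> ^^ m) ((\<eta> ^^ j) x)) :: complex)))"
proof (intro ext)
  fix n x
  let ?f = "\<lambda>i m l. p i x * (q m ((\<eta> ^^ i) x) * r l ((\<eta> ^^ (m + i)) x))"
  have "(\<Sum>k\<le>n. (\<Sum>j\<le>k. p j x * q (k - j) ((\<eta> ^^ j) x)) * r (n - k) ((\<eta> ^^ k) x)) =
      (\<Sum>k=0..n. \<Sum>j=0..k. ?f j (k - j) (n - k))"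
    unfolding sum_distrib_right atMost_atLeast0 by (intro sum.cong refl) (simp add: mult.assoc)
  also have "\<dots> = (\<Sum>j=0..n. \<Sum>m=0..n - j. ?f j m (n - j - m))"
    by (rule fps_mult_assoc_lemma)
  also have "\<dots> = (\<Sum>j\<le>n. p j x * (\<Sum>m\<le>n - j. q m ((\<eta> ^^ j) x) * r (n - j - m) ((\<eta> ^^ m) ((\<eta> ^^ j) x))))"
    unfolding sum_distrib_left atMost_atLeast0 by (intro sum.cong refl) (simp add: funpow_add)
  finally show "(\<Sum>k\<le>n. (\<Sum>j\<le>k. p j x * q (k - j) ((\<eta> ^^ j) x)) * r (n - k) ((\<eta> ^^ k) x)) =
      (\<Sum>j\<le>n. p j x * (\<Sum>m\<le>n - j. q m ((\<eta> ^^ j) x) * r (n - j - m) ((\<eta> ^^ m) ((\<eta> ^^ j) x))))" .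
qed

locale summable_series =
  fixes X :: "'a topology" and \<eta> :: "'a \<Rightarrow> 'a"
    and enc :: "(nat \<Rightarrow> 'a \<Rightarrow> complex) \<Rightarrow> 'c" and dec :: "'c \<Rightarrow> nat \<Rightarrow> 'a \<Rightarrow> complex"
  assumes compact: "compact_space X" and Hausdorff: "Hausdorff_space X"
    and continuous: "continuous_map X X \<eta>" and dec_enc [simp]: "dec (enc p) = p"
begin

definition series :: "(nat \<Rightarrow> 'a \<Rightarrow> complex) set" where
  "series = {p. (\<forall>n. p n \<in> carrier (cont_alg X)) \<and> summable (\<lambda>n. sup_norm X (p n))}"

definition total :: "(nat \<Rightarrow> 'a \<Rightarrow> complex) \<Rightarrow> real" where
  "total p = (\<Sum>n. sup_norm X (p n))"

text \<open>The maps \<open>enc\<close> and \<open>dec\<close> only serve to place the algebra in a prescribed type.\<close>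

definition l1 :: "'c normed_alg" where
  "l1 = \<lparr>carrier = enc ` series,
    mult = (\<lambda>a b. enc (dec a \<otimes>\<^bsub>skew_poly_alg X \<eta>\<^esub> dec b)),
    one = enc \<one>\<^bsub>skew_poly_alg X \<eta>\<^esub>,
    zero = enc \<zero>\<^bsub>skew_poly_alg X \<eta>\<^esub>,
    add = (\<lambda>a b. enc (dec a \<oplus>\<^bsub>skew_poly_alg X \<eta>\<^esub> dec b)),
    smult = (\<lambda>c a. enc (c \<odot>\<^bsub>skew_poly_alg X \<eta>\<^esub> dec a)),
    nrm = (\<lambda>a. total (dec a))\<rparr>"

lemma l1_simps [simp]:
  "carrier l1 = enc ` series"
  "a \<otimes>\<^bsub>l1\<^esub> b = enc (\<lambda>n x. \<Sum>k\<le>n. dec a k x * dec b (n - k) ((\<eta> ^^ k) x))"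
  "\<one>\<^bsub>l1\<^esub> = enc (\<lambda>n x. if n = 0 \<and> x \<in> topspace X then 1 else 0)"
  "\<zero>\<^bsub>l1\<^esub> = enc (\<lambda>n x. 0)"
  "a \<oplus>\<^bsub>l1\<^esub> b = enc (\<lambda>n x. dec a n x + dec b n x)"
  "c \<odot>\<^bsub>l1\<^esub> a = enc (\<lambda>n x. c * dec a n x)"
  "nrm l1 a = total (dec a)"
  by (simp_all add: l1_def skew_poly_alg_def)

lemma \<eta>_iter_continuous: "continuous_map X X (\<eta> ^^ k)"
proof (induction k)
  case (Suc k)
  then show ?case
    using continuous_map_compose[OF Suc continuous] by (simp add: o_def)
qed (simp add: id_def[symmetric])

lemma \<eta>_iter_closed: "x \<in> topspace X \<Longrightarrow> (\<eta> ^^ k) x \<in> topspace X"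
  using continuous_map_funspace[OF \<eta>_iter_continuous] by auto

lemma series_coeff: "p \<in> series \<Longrightarrow> p n \<in> carrier (cont_alg X)"
  and series_summable: "p \<in> series \<Longrightarrow> summable (\<lambda>n. sup_norm X (p n))"
  by (simp_all add: series_def)

lemma coeff_nonneg: "p \<in> series \<Longrightarrow> 0 \<le> sup_norm X (p n)"
  by (simp add: sup_norm_nonneg compact series_coeff)

lemma coeff_le: "p \<in> series \<Longrightarrow> cmod (p n x) \<le> sup_norm X (p n)"
  by (simp add: le_sup_norm compact series_coeff)

lemma coeff_le_total: "p \<in> series \<Longrightarrow> sup_norm X (p n) \<le> total p"
  unfolding total_def using sum_le_suminf[of "\<lambda>n. sup_norm X (p n)" "{n}"]
  by (simp add: series_summable coeff_nonneg)

lemma seriesI: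
  assumes "\<And>n. p n \<in> carrier (cont_alg X)" "\<And>n. sup_norm X (p n) \<le> b n" "summable b"
  shows "p \<in> series"
  using assms summable_comparison_test'[of b 0 "\<lambda>n. sup_norm X (p n)"]
  by (simp add: series_def sup_norm_nonneg compact)

lemma totalI:
  assumes "p \<in> series" "\<And>n. sup_norm X (p n) \<le> b n" "summable b"
  shows "total p \<le> suminf b"
  unfolding total_def by (rule suminf_le[OF assms(2) series_summable[OF assms(1)] assms(3)])

lemma series_add:
  assumes "p \<in> series" "q \<in> series"
  shows "(\<lambda>n x. p n x + q n x) \<in> series" "total (\<lambda>n x. p n x + q n x) \<le> total p + total q"
proof -
  note le = sup_norm_add[OF compact assms[THEN series_coeff]]
  have summable: "summable (\<lambda>n. sup_norm X (p n) + sup_norm X (q n))"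
    using assms by (intro summable_add series_summable)
  show "(\<lambda>n x. p n x + q n x) \<in> series"
    using assms series_coeff by (intro seriesI[OF _ le summable]) auto
  from totalI[OF this le summable] show "total (\<lambda>n x. p n x + q n x) \<le> total p + total q"
    using assms by (simp add: total_def suminf_add series_summable)
qed

lemma series_smult:
  assumes "p \<in> series"
  shows "(\<lambda>n x. c * p n x) \<in> series" "total (\<lambda>n x. c * p n x) = cmod c * total p"
proof -
  have eq: "sup_norm X (\<lambda>x. c * p n x) = cmod c * sup_norm X (p n)" for n
    using assms by (simp add: sup_norm_smult compact series_coeff)
  then show "(\<lambda>n x. c * p n x) \<in> series"
    using assms by (intro seriesI[of _ "\<lambda>n. cmod c * sup_norm X (p n)"])
      (auto intro: summable_mult series_summable series_coeff)
  show "total (\<lambda>n x. c * p n x) = cmod c * total p"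
    using assms by (simp add: total_def eq suminf_mult series_summable)
qed

lemma series_minus:
  assumes "p \<in> series" "q \<in> series"
  shows "(\<lambda>n x. p n x - q n x) \<in> series"
  using series_add(1)[OF assms(1) series_smult(1)[OF assms(2), of "-1"]] by simp

text \<open>Composition with iterates of \<open>\<eta>\<close> does not increase suprema, so the
  Cauchy product of the sequences of coefficient norms dominates.\<close>

lemma series_mult:
  assumes "p \<in> series" "q \<in> series"
  shows "(\<lambda>n x. \<Sum>k\<le>n. p k x * q (n - k) ((\<eta> ^^ k) x)) \<in> series"
    "total (\<lambda>n x. \<Sum>k\<le>n. p k x * q (n - k) ((\<eta> ^^ k) x)) \<le> total p * total q"
proof -
  let ?s = "\<lambda>p n. sup_norm X (p n)"
  have coeff: "(\<lambda>x. p k x * q m ((\<eta> ^^ k) x)) \<in> carrier (cont_alg X)" for k m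
  proof -
    have "(\<lambda>x. p k x * pullback X (\<eta> ^^ k) (q m) x) \<in> carrier (cont_alg X)"
      using assms series_coeff \<eta>_iter_continuous by (intro cont_alg_mult cont_alg_pullback) auto
    moreover have "p k x * pullback X (\<eta> ^^ k) (q m) x = p k x * q m ((\<eta> ^^ k) x)" for x
      using series_coeff[OF assms(1), of k] by (auto simp: cont_alg_iff pullback_def)
    ultimately show ?thesis
      by simp
  qed
  have le: "sup_norm X (\<lambda>x. \<Sum>k\<le>n. p k x * q (n - k) ((\<eta> ^^ k) x)) \<le> (\<Sum>k\<le>n. ?s p k * ?s q (n - k))" for n
  proof (rule sup_norm_le)
    show "0 \<le> (\<Sum>k\<le>n. ?s p k * ?s q (n - k))"
      using assms by (intro sum_nonneg mult_nonneg_nonneg coeff_nonneg)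
    show "cmod (\<Sum>k\<le>n. p k x * q (n - k) ((\<eta> ^^ k) x)) \<le> (\<Sum>k\<le>n. ?s p k * ?s q (n - k))" for x
      using assms unfolding norm_mult
      by (intro sum_norm_le) (simp add: norm_mult mult_mono coeff_le coeff_nonneg)
  qed
  have norms: "summable (\<lambda>n. norm (?s r n))" if "r \<in> series" for r
    using that by (simp add: coeff_nonneg series_summable)
  note summable = summable_Cauchy_product[OF norms[OF assms(1)] norms[OF assms(2)]]
  show *: "(\<lambda>n x. \<Sum>k\<le>n. p k x * q (n - k) ((\<eta> ^^ k) x)) \<in> series"
    by (rule seriesI[OF _ le summable]) (rule cont_alg_sum, rule coeff)
  show "total (\<lambda>n x. \<Sum>k\<le>n. p k x * q (n - k) ((\<eta> ^^ k) x)) \<le> total p * total q"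
    using totalI[OF * le summable] Cauchy_product[OF norms[OF assms(1)] norms[OF assms(2)]]
    by (simp add: total_def)
qed

lemma poly_series:
  assumes "p \<in> carrier (skew_poly_alg X \<eta>)"
  shows "p \<in> series"
proof -
  have "finite {n. sup_norm X (p n) \<noteq> 0}"
    using assms
    by (auto simp: skew_poly_carrier_iff sup_norm_eq_0_iff compact elim!: rev_finite_subset)
  then show ?thesis
    using assms summable_finite[of "{n. sup_norm X (p n) \<noteq> 0}"]
    by (auto simp: series_def skew_poly_carrier_iff)
qed

lemma series_one: "(\<lambda>n x. if n = 0 \<and> x \<in> topspace X then 1 else 0) \<in> series"
proof -
  have "(\<lambda>n x. if n = 0 \<and> x \<in> topspace X then 1 else 0) = skew_monom 0 \<one>\<^bsub>cont_alg X\<^esub>"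
    by (auto simp: skew_monom_def fun_eq_iff)
  then show ?thesis
    using poly_series[OF skew_monom_carrier[of "\<one>\<^bsub>cont_alg X\<^esub>" X 0]] by simp
qed

lemma series_zero: "(\<lambda>n x. 0) \<in> series"
  by (simp add: series_def)

lemma total_nonneg: "p \<in> series \<Longrightarrow> 0 \<le> total p"
  unfolding total_def by (intro suminf_nonneg series_summable coeff_nonneg)

lemma total_eq_0_iff: "p \<in> series \<Longrightarrow> total p = 0 \<longleftrightarrow> p = (\<lambda>n x. 0)"
  unfolding total_def
  by (subst suminf_eq_zero_iff)
    (auto simp: series_summable coeff_nonneg sup_norm_eq_0_iff compact series_coeff fun_eq_iff)

section \<open>The Banach algebra structure on summable series\<close>

lemma abelian_group_l1: "abelian_group l1"
proof (rule abelian_groupI)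
  fix a
  assume "a \<in> carrier l1"
  then have "enc (\<lambda>n x. - 1 * dec a n x) \<in> carrier l1"
    using series_smult(1)[of "dec a" "-1"] by auto
  then show "\<exists>b\<in>carrier l1. b \<oplus>\<^bsub>l1\<^esub> a = \<zero>\<^bsub>l1\<^esub>"
    by (rule rev_bexI) simp
qed (auto simp: series_add series_zero algebra_simps)

lemma ring_l1: "ring l1"
proof (rule ringI)
  show "monoid l1"
  proof (rule monoidI)
    fix a b c
    show "a \<otimes>\<^bsub>l1\<^esub> b \<otimes>\<^bsub>l1\<^esub> c = a \<otimes>\<^bsub>l1\<^esub> (b \<otimes>\<^bsub>l1\<^esub> c)"
      using skew_mult_assoc[of "dec a" "dec b" \<eta> "dec c"] by simp
  next
    fix a
    assume "a \<in> carrier l1"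
    then obtain p where p: "p \<in> series" "a = enc p"
      by auto
    then have outside: "p n x = 0" if "x \<notin> topspace X" for n x
      using series_coeff that by (auto simp: cont_alg_iff)
    have "(\<Sum>k\<le>n. (if k = 0 \<and> x \<in> topspace X then 1 else 0) * p (n - k) ((\<eta> ^^ k) x)) =
        (\<Sum>k\<le>n. if k = 0 then p n x else 0)" for n x
      by (intro sum.cong refl) (auto simp: outside)
    then show "\<one>\<^bsub>l1\<^esub> \<otimes>\<^bsub>l1\<^esub> a = a"
      by (simp add: p(2))
    have "(\<Sum>k\<le>n. p k x * (if n - k = 0 \<and> (\<eta> ^^ k) x \<in> topspace X then 1 else 0)) =
        (\<Sum>k\<le>n. if k = n then p n x else 0)" for n x
      using \<eta>_iter_closed[of x n] outside[of x n] by (intro sum.cong refl) auto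
    then show "a \<otimes>\<^bsub>l1\<^esub> \<one>\<^bsub>l1\<^esub> = a"
      by (simp add: p(2))
  qed (auto simp: series_mult series_one)
qed (auto simp: abelian_group_l1 algebra_simps sum.distrib)

lemma module_l1: "Module.module complex_ring l1"
proof (rule moduleI[OF _ abelian_group_l1])
  show "cring complex_ring"
  proof (rule cringI)
    show "abelian_group complex_ring"
      by (rule abelian_groupI)
        (auto simp: complex_ring_def algebra_simps intro: exI[of _ "- x" for x])
    show "Group.comm_monoid complex_ring"
      by (rule comm_monoidI) (auto simp: complex_ring_def)
  qed (simp add: complex_ring_def algebra_simps)
qed (auto simp: complex_ring_def series_smult algebra_simps)

lemma dec_minus:
  assumes "a \<in> carrier l1" "b \<in> carrier l1"
  shows "dec (a \<ominus>\<^bsub>l1\<^esub> b) = (\<lambda>n x. dec a n x - dec b n x)"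
proof -
  interpret ring l1
    by (rule ring_l1)
  have b: "enc (\<lambda>n x. - 1 * dec b n x) \<in> carrier l1"
    using assms series_smult(1)[of "dec b" "-1"] by auto
  have "\<ominus>\<^bsub>l1\<^esub> b = enc (\<lambda>n x. - 1 * dec b n x)"
    by (rule minus_equality[OF _ assms(2) b]) simp
  then show ?thesis
    by (simp add: a_minus_def)
qed

text \<open>The usual completeness proof for l^1: coefficients converge uniformly, and estimates on
  partial sums pass to the limit before the number of terms does.\<close>

lemma limit_series:
  assumes s: "\<And>k. s k \<in> series"
    and Cauchy: "\<And>e. e > 0 \<Longrightarrow> \<exists>N. \<forall>k\<ge>N. \<forall>l\<ge>N. total (\<lambda>n x. s k n x - s l n x) < e"
  obtains p where "p \<in> series" "(\<lambda>k. total (\<lambda>n x. s k n x - p n x)) \<longlonglongrightarrow> 0"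
proof -
  have "\<exists>g\<in>carrier (cont_alg X). (\<lambda>k. sup_norm X (\<lambda>x. s k n x - g x)) \<longlonglongrightarrow> 0" for n
  proof (rule sup_norm_complete[OF compact, of "\<lambda>k. s k n"])
    show "s k n \<in> carrier (cont_alg X)" for k
      using s by (rule series_coeff)
    show "\<exists>N. \<forall>k\<ge>N. \<forall>l\<ge>N. sup_norm X (\<lambda>x. s k n x - s l n x) < e" if "e > 0" for e
      using Cauchy[OF that] coeff_le_total[OF series_minus[OF s s]] by (meson le_less_trans)
  qed blast
  then obtain p where p: "\<And>n. p n \<in> carrier (cont_alg X)"
    and lim: "\<And>n. (\<lambda>k. sup_norm X (\<lambda>x. s k n x - p n x)) \<longlonglongrightarrow> 0"
    by metis
  have partial: "\<exists>N. \<forall>k\<ge>N. \<forall>M. (\<Sum>n<M. sup_norm X (\<lambda>x. s k n x - p n x)) \<le> e" if e: "e > 0" for e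
  proof -
    obtain N where N: "\<And>k l. k \<ge> N \<Longrightarrow> l \<ge> N \<Longrightarrow> total (\<lambda>n x. s k n x - s l n x) < e"
      using Cauchy[OF e] by blast
    have "(\<Sum>n<M. sup_norm X (\<lambda>x. s k n x - p n x)) \<le> e" if k: "k \<ge> N" for k M
    proof (rule LIMSEQ_le_const)
      \<comment> \<open>For fixed \<open>M\<close> insert \<open>s l\<close> between
        \<open>s k\<close> and \<open>p\<close>. The first part is bounded by the Cauchy condition,
        and the second is a finite sum of null sequences in \<open>l\<close>.\<close>
      have "(\<lambda>l. \<Sum>n<M. sup_norm X (\<lambda>x. s l n x - p n x)) \<longlonglongrightarrow> 0"
        by (intro tendsto_null_sum lim)
      then show "(\<lambda>l. e + (\<Sum>n<M. sup_norm X (\<lambda>x. s l n x - p n x))) \<longlonglongrightarrow> e"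
        using tendsto_add[OF tendsto_const, of _ 0 _ e] by fastforce
      have "(\<Sum>n<M. sup_norm X (\<lambda>x. s k n x - p n x)) \<le> e + (\<Sum>n<M. sup_norm X (\<lambda>x. s l n x - p n x))"
        if l: "l \<ge> N" for l
      proof -
        have "(\<Sum>n<M. sup_norm X (\<lambda>x. s k n x - p n x)) \<le>
            (\<Sum>n<M. sup_norm X (\<lambda>x. s k n x - s l n x) + sup_norm X (\<lambda>x. s l n x - p n x))"
          using s p series_coeff by (intro sum_mono sup_norm_minus_triangle compact) auto
        also have "\<dots> = (\<Sum>n<M. sup_norm X (\<lambda>x. s k n x - s l n x)) +
            (\<Sum>n<M. sup_norm X (\<lambda>x. s l n x - p n x))"
          by (rule sum.distrib)
        also have "(\<Sum>n<M. sup_norm X (\<lambda>x. s k n x - s l n x)) \<le> total (\<lambda>n x. s k n x - s l n x)"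
          unfolding total_def using series_minus[OF s s]
          by (intro sum_le_suminf) (auto intro: series_summable coeff_nonneg)
        also have "\<dots> \<le> e"
          using N[OF k l] by simp
        finally show ?thesis
          by simp
      qed
      then show "\<exists>L. \<forall>l\<ge>L. (\<Sum>n<M. sup_norm X (\<lambda>x. s k n x - p n x)) \<le>
          e + (\<Sum>n<M. sup_norm X (\<lambda>x. s l n x - p n x))"
        by blast
    qed
    then show ?thesis
      by blast
  qed
  have diff_nonneg: "0 \<le> sup_norm X (\<lambda>x. s k n x - p n x)" for k n
    by (intro sup_norm_nonneg compact cont_alg_minus series_coeff[OF s] p)
  have bound: "(\<lambda>n x. s k n x - p n x) \<in> series \<and> total (\<lambda>n x. s k n x - p n x) \<le> e"
    if "\<And>M. (\<Sum>n<M. sup_norm X (\<lambda>x. s k n x - p n x)) \<le> e" for k e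
  proof -
    have "summable (\<lambda>n. sup_norm X (\<lambda>x. s k n x - p n x))"
      using that diff_nonneg by (intro summableI_nonneg_bounded)
    then show ?thesis
      using suminf_le_const[OF _ that] cont_alg_minus[OF series_coeff[OF s] p]
      by (simp add: series_def total_def)
  qed
  obtain N where "\<And>M. (\<Sum>n<M. sup_norm X (\<lambda>x. s N n x - p n x)) \<le> 1"
    using partial[of 1] by auto
  then have "(\<lambda>n x. s N n x - p n x) \<in> series"
    using bound by blast
  \<comment> \<open>Summability of the limit is obtained from p = s_N - (s_N - p).\<close>
  then have "(\<lambda>n x. s N n x - (s N n x - p n x)) \<in> series"
    by (rule series_minus[OF s])
  then have "p \<in> series"
    by simp
  moreover have "(\<lambda>k. total (\<lambda>n x. s k n x - p n x)) \<longlonglongrightarrow> 0"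
  proof (rule LIMSEQ_I)
    fix e :: real
    assume "e > 0"
    then obtain N where N: "\<And>k M. k \<ge> N \<Longrightarrow> (\<Sum>n<M. sup_norm X (\<lambda>x. s k n x - p n x)) \<le> e / 2"
      using partial[of "e / 2"] by auto
    have "norm (total (\<lambda>n x. s k n x - p n x) - 0) < e" if "k \<ge> N" for k
      using bound[OF N[OF that]] total_nonneg[of "\<lambda>n x. s k n x - p n x"] \<open>e > 0\<close> by simp
    then show "\<exists>N. \<forall>k\<ge>N. norm (total (\<lambda>n x. s k n x - p n x) - 0) < e"
      by blast
  qed
  ultimately show ?thesis
    using that by blast
qed

lemma complete_l1: "Metric_space.mcomplete (carrier l1) (alg_dist l1)"
proof -
  have dist: "alg_dist l1 a b = (if a \<in> carrier l1 \<and> b \<in> carrier l1 then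
      total (\<lambda>n x. dec a n x - dec b n x) else 0)" for a b
    unfolding alg_dist_def using dec_minus[of a b] by simp
  have series: "dec a \<in> series" if "a \<in> carrier l1" for a
    using that by auto
  have total_minus: "total (\<lambda>n x. p n x - q n x) = total (\<lambda>n x. q n x - p n x)" for p q
    unfolding total_def by (intro suminf_cong sup_norm_minus)
  interpret Metric_space "carrier l1" "alg_dist l1"
  proof
    fix a b c
    show "0 \<le> alg_dist l1 a b"
      using series by (auto simp: dist intro: total_nonneg series_minus)
    show "alg_dist l1 a b = alg_dist l1 b a"
      using total_minus[of "dec a" "dec b"] by (simp add: dist)
    assume ab: "a \<in> carrier l1" "b \<in> carrier l1"
    then obtain p q where pq: "p \<in> series" "q \<in> series" "a = enc p" "b = enc q"
      by auto
    have "(\<lambda>n x. p n x - q n x) = (\<lambda>n x. 0) \<longleftrightarrow> p = q"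
      by (auto simp: fun_eq_iff)
    moreover have "enc p = enc q \<longleftrightarrow> p = q"
      by (metis dec_enc)
    ultimately show "alg_dist l1 a b = 0 \<longleftrightarrow> a = b"
      using ab total_eq_0_iff[OF series_minus[OF pq(1,2)]] by (simp add: dist pq)
    assume c: "c \<in> carrier l1"
    show "alg_dist l1 a c \<le> alg_dist l1 a b + alg_dist l1 b c"
      using series_add(2)[OF series_minus series_minus, of "dec a" "dec b" "dec b" "dec c"]
        series[OF ab(1)] series[OF ab(2)] series[OF c] ab c by (simp add: dist)
  qed
  show ?thesis
    unfolding mcomplete_def
  proof (intro allI impI)
    fix \<sigma>
    assume "MCauchy \<sigma>"
    then have \<sigma>: "\<And>k. \<sigma> k \<in> carrier l1"
      and Cauchy: "\<And>e. e > 0 \<Longrightarrow> \<exists>N. \<forall>k l. N \<le> k \<longrightarrow> N \<le> l \<longrightarrow> alg_dist l1 (\<sigma> k) (\<sigma> l) < e"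
      by (auto simp: MCauchy_def simp del: l1_simps(1))
    obtain p where p: "p \<in> series" "(\<lambda>k. total (\<lambda>n x. dec (\<sigma> k) n x - p n x)) \<longlonglongrightarrow> 0"
    proof (rule limit_series[of "\<lambda>k. dec (\<sigma> k)"])
      show "\<exists>N. \<forall>k\<ge>N. \<forall>l\<ge>N. total (\<lambda>n x. dec (\<sigma> k) n x - dec (\<sigma> l) n x) < e" if "e > 0" for e
        using Cauchy[OF that] \<sigma> by (auto simp: dist simp del: l1_simps(1))
    qed (use series \<sigma> in auto)
    have "limitin mtopology \<sigma> (enc p) sequentially"
      using p \<sigma> by (simp add: limitin_metric_dist_null dist del: l1_simps(1)) simp
    then show "\<exists>x. limitin mtopology \<sigma> x sequentially"
      by blast
  qed
qed

lemma complex_banach_algebra_l1: "complex_banach_algebra l1"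
proof (rule complex_banach_algebra.intro[OF ring_l1 module_l1])
  fix a b
  assume "a \<in> carrier l1" "b \<in> carrier l1"
  then have ab: "dec a \<in> series" "dec b \<in> series"
    by auto
  show "nrm l1 (a \<oplus>\<^bsub>l1\<^esub> b) \<le> nrm l1 a + nrm l1 b"
    using series_add(2)[OF ab] by simp
  show "nrm l1 (a \<otimes>\<^bsub>l1\<^esub> b) \<le> nrm l1 a * nrm l1 b"
    using series_mult(2)[OF ab] by simp
next
  fix a
  assume "a \<in> carrier l1"
  then show "nrm l1 a = 0 \<longleftrightarrow> a = \<zero>\<^bsub>l1\<^esub>"
    using total_eq_0_iff by (auto dest: arg_cong[of _ _ dec])
next
  show "Metric_space.mcomplete (carrier l1) (alg_dist l1)"
    by (rule complete_l1)
qed (auto simp: series_smult total_nonneg sum_distrib_left mult.assoc mult.left_commute)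

sublocale l1: complex_banach_algebra l1
  by (rule complex_banach_algebra_l1)

section \<open>The axioms of a conjugacy algebra for summable series\<close>

lemma mult_U:
  assumes "b \<in> carrier l1"
  shows "b \<otimes>\<^bsub>l1\<^esub> enc (skew_U X) = enc (\<lambda>n x. if n = 0 then 0 else dec b (n - 1) x)"
proof -
  define p where "p n = (if n = 0 then (\<lambda>x. 0) else dec b (n - 1))" for n
  have "dec b n \<in> carrier (cont_alg X)" for n
    using assms series_coeff by auto
  then have "p n \<in> carrier (cont_alg X)" for n
    by (simp add: p_def)
  then have "(\<lambda>n. p (Suc n)) \<otimes>\<^bsub>skew_poly_alg X \<eta>\<^esub> skew_U X = (\<lambda>n x. if n = 0 then 0 else p n x)"
    by (rule skew_poly_mult_U[OF _ continuous])
  moreover have "(\<lambda>n x. if n = 0 then 0 else p n x) = (\<lambda>n x. if n = 0 then 0 else dec b (n - 1) x)"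
    by (simp add: p_def fun_eq_iff)
  ultimately show ?thesis
    by (simp add: skew_poly_mult p_def)
qed

lemma tail_series:
  assumes "p \<in> series"
  shows "(\<lambda>n. p (Suc n)) \<in> series"
  using assms summable_Suc_iff[of "\<lambda>n. sup_norm X (p n)"] by (simp add: series_def)

lemma l1_decomposition:
  assumes "a \<in> carrier l1"
  shows "a = enc (skew_monom 0 (dec a 0)) \<oplus>\<^bsub>l1\<^esub> enc (\<lambda>n. dec a (Suc n)) \<otimes>\<^bsub>l1\<^esub> enc (skew_U X)"
proof -
  obtain p where p: "p \<in> series" "a = enc p"
    using assms by auto
  let ?t = "enc (\<lambda>n. p (Suc n))"
  have "?t \<in> carrier l1"
    using p(1) tail_series by simp
  moreover have "(\<lambda>n x. if n = 0 then 0 else dec ?t (n - 1) x) = (\<lambda>n x. if n = 0 then 0 else p n x)"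
    by (auto simp: fun_eq_iff)
  ultimately have "?t \<otimes>\<^bsub>l1\<^esub> enc (skew_U X) = enc (\<lambda>n x. if n = 0 then 0 else p n x)"
    by (simp only: mult_U)
  moreover have "(\<lambda>n x. skew_monom 0 (p 0) n x + (if n = 0 then 0 else p n x)) = p"
    by (auto simp: skew_monom_def fun_eq_iff)
  ultimately show ?thesis
    unfolding p(2) dec_enc by (simp only: l1_simps(5) dec_enc)
qed

lemma mult_U_cancel_l1:
  assumes "b \<in> carrier l1" "c \<in> carrier l1"
    and "\<forall>n. dec (b \<otimes>\<^bsub>l1\<^esub> enc (skew_U X)) (Suc n) = dec (c \<otimes>\<^bsub>l1\<^esub> enc (skew_U X)) (Suc n)"
  shows "b = c"
proof -
  have "dec b = dec c"
    using assms by (simp add: mult_U fun_eq_iff del: l1_simps(1,2))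
  then show ?thesis
    using assms(1,2) by auto
qed

text \<open>Comparing coefficients shows that the shifted series is the only possible quotient by
  \<open>U\<close>, so the abstract coefficient maps are the evident ones.\<close>

lemma coeff_map_l1:
  "a \<in> carrier l1 \<Longrightarrow> coeff_map X l1 enc (\<lambda>a. dec a 0) n a = dec a n"
proof (induction n arbitrary: a)
  case (Suc n)
  let ?t = "enc (\<lambda>n. dec a (Suc n))"
  have t: "?t \<in> carrier l1"
    using Suc.prems tail_series by auto
  have "(THE b. b \<in> carrier l1 \<and> a = enc (skew_monom 0 (dec a 0)) \<oplus>\<^bsub>l1\<^esub> b \<otimes>\<^bsub>l1\<^esub> enc (skew_U X)) = ?t"
  proof (rule the_equality)
    show "?t \<in> carrier l1 \<and> a = enc (skew_monom 0 (dec a 0)) \<oplus>\<^bsub>l1\<^esub> ?t \<otimes>\<^bsub>l1\<^esub> enc (skew_U X)"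
      using t l1_decomposition[OF Suc.prems] by blast
  next
    fix b
    assume b: "b \<in> carrier l1 \<and> a = enc (skew_monom 0 (dec a 0)) \<oplus>\<^bsub>l1\<^esub> b \<otimes>\<^bsub>l1\<^esub> enc (skew_U X)"
    from arg_cong[OF conjunct2[OF this], of dec]
    have eq: "dec a = (\<lambda>n x. skew_monom 0 (dec a 0) n x + dec (b \<otimes>\<^bsub>l1\<^esub> enc (skew_U X)) n x)"
      by (simp only: l1_simps(5) dec_enc)
    have "dec a (Suc n) x = dec (b \<otimes>\<^bsub>l1\<^esub> enc (skew_U X)) (Suc n) x" for n x
      using fun_cong[OF fun_cong[OF eq, of "Suc n"], of x] by (simp add: skew_monom_def del: l1_simps(2))
    moreover have "dec a (Suc n) x = dec (?t \<otimes>\<^bsub>l1\<^esub> enc (skew_U X)) (Suc n) x" for n x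
      using t by (simp add: mult_U del: l1_simps(1,2))
    ultimately show "b = ?t"
      using b t by (intro mult_U_cancel_l1) (auto simp: fun_eq_iff simp del: l1_simps(1,2))
  qed
  then show ?case
    using Suc.IH[OF t] by simp
qed simp

definition truncate :: "nat \<Rightarrow> (nat \<Rightarrow> 'a \<Rightarrow> complex) \<Rightarrow> nat \<Rightarrow> 'a \<Rightarrow> complex" where
  "truncate M p = (\<lambda>n. if n < M then p n else (\<lambda>x. 0))"

lemma truncate_poly: "p \<in> series \<Longrightarrow> truncate M p \<in> carrier (skew_poly_alg X \<eta>)"
  using finite_subset[of "{n. truncate M p n \<noteq> (\<lambda>x. 0)}" "{..<M}"]
  by (auto simp: skew_poly_carrier_iff truncate_def series_coeff)

lemma truncate_approx:
  assumes "p \<in> series" "e > 0"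
  obtains M where "total (\<lambda>n x. p n x - truncate M p n x) < e"
proof -
  obtain M where M: "norm (\<Sum>i. sup_norm X (p (i + M))) < e"
    using suminf_exist_split[OF assms(2) series_summable[OF assms(1)]] by auto
  let ?d = "\<lambda>n x. p n x - truncate M p n x"
  have "?d \<in> series"
    by (rule series_minus[OF assms(1) poly_series[OF truncate_poly[OF assms(1)]]])
  then have "total ?d = (\<Sum>i. sup_norm X (?d (i + M))) + (\<Sum>i<M. sup_norm X (?d i))"
    unfolding total_def by (intro suminf_split_initial_segment series_summable)
  also have "\<dots> = (\<Sum>i. sup_norm X (p (i + M)))"
    by (simp add: truncate_def)
  finally show ?thesis
    using that[of M] M by simp
qed

lemma nrm_U_power_le: "nrm l1 (enc (skew_U X) [^]\<^bsub>l1\<^esub> (n :: nat)) \<le> 1"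
proof -
  have total_le: "total p \<le> 1" if "p \<in> series" "\<And>n. p n = (if n = m then \<one>\<^bsub>cont_alg X\<^esub> else (\<lambda>x. 0))" for p m
  proof -
    have "sup_norm X \<one>\<^bsub>cont_alg X\<^esub> \<le> 1"
      by (rule sup_norm_le) auto
    then have "(\<Sum>n\<in>{m}. sup_norm X (p n)) \<le> 1"
      using that(2) by simp
    moreover have "total p = (\<Sum>n\<in>{m}. sup_norm X (p n))"
      unfolding total_def by (rule suminf_finite) (auto simp: that(2))
    ultimately show ?thesis
      by simp
  qed
  have U: "enc (skew_U X) \<in> carrier l1"
    using poly_series[OF skew_U_carrier] by simp
  show ?thesis
  proof (induction n)
    case 0
    have "total (\<lambda>n x. if n = 0 \<and> x \<in> topspace X then 1 else 0) \<le> 1"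
      by (rule total_le[OF series_one, of 0]) auto
    then show ?case
      by simp
  next
    case (Suc n)
    have "total (skew_U X) \<le> 1"
      by (rule total_le[OF poly_series[OF skew_U_carrier], of 1]) (auto simp: skew_U_def skew_monom_def)
    then have "nrm l1 (enc (skew_U X)) \<le> 1"
      by simp
    moreover have "nrm l1 (enc (skew_U X) [^]\<^bsub>l1\<^esub> Suc n) \<le>
        nrm l1 (enc (skew_U X) [^]\<^bsub>l1\<^esub> n) * nrm l1 (enc (skew_U X))"
      unfolding l1.alg.nat_pow_Suc using U by (intro l1.nrm_mult l1.alg.nat_pow_closed)
    moreover have "0 \<le> nrm l1 (enc (skew_U X))" "0 \<le> nrm l1 (enc (skew_U X) [^]\<^bsub>l1\<^esub> n)"
      using U by (intro l1.nrm_nonneg l1.alg.nat_pow_closed; assumption)+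
    ultimately show ?case
      using Suc.IH mult_le_one[of "nrm l1 (enc (skew_U X) [^]\<^bsub>l1\<^esub> n)" "nrm l1 (enc (skew_U X))"]
      by linarith
  qed
qed

lemma coeff_onorm_le:
  "coeff_onorm X l1 (coeff_map X l1 enc (\<lambda>a. dec a 0) n) \<le> 1"
  unfolding coeff_onorm_def
proof (rule cSUP_least)
  fix a
  assume a: "a \<in> carrier l1"
  then have "dec a \<in> series"
    by auto
  then have "sup_norm X (dec a n) \<le> total (dec a)" "0 \<le> total (dec a)"
    by (simp_all add: coeff_le_total total_nonneg)
  then show "sup_norm X (coeff_map X l1 enc (\<lambda>a. dec a 0) n a) / nrm l1 a \<le> 1"
    unfolding coeff_map_l1[OF a] by (auto simp: divide_le_eq_1)
qed (use series_zero in auto)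

text \<open>Truncations give density, and coefficients depend continuously on the series. In this
  norm both the coefficient maps and the powers of \<open>U\<close> have norm at most 1, which
  settles the growth condition.\<close>

lemma compact_conjugacy_algebra_l1: "compact_conjugacy_algebra X \<eta> l1 enc (\<lambda>a. dec a 0)"
proof (intro compact_conjugacy_algebra.intro complex_banach_algebra_l1
    compact_conjugacy_algebra_axioms.intro)
  let ?P = "skew_poly_alg X \<eta>"
  show "enc \<in> alg_hom ?P l1"
    by (auto simp: alg_hom_def poly_series) (simp_all add: skew_poly_alg_def)
  show "inj_on enc (carrier ?P)"
    by (metis dec_enc inj_onI)
  show "norm_topology l1 closure_of (enc ` carrier ?P) = carrier l1"
  proof -
    have sub: "enc ` carrier ?P \<subseteq> carrier l1"
      by (auto simp: poly_series)
    have "\<exists>s\<in>enc ` carrier ?P. nrm l1 (a \<ominus>\<^bsub>l1\<^esub> s) < e" if a: "a \<in> carrier l1" and "e > 0" for a e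
    proof -
      have p: "dec a \<in> series"
        using a by auto
      obtain M where "total (\<lambda>n x. dec a n x - truncate M (dec a) n x) < e"
        using truncate_approx[OF p \<open>e > 0\<close>] by blast
      moreover have "enc (truncate M (dec a)) \<in> carrier l1"
        by (simp add: p truncate_poly poly_series)
      ultimately show ?thesis
        using a truncate_poly[OF p] by (intro bexI[of _ "enc (truncate M (dec a))"]) (simp_all add: dec_minus)
    qed
    then show ?thesis
      using l1.in_closure_of_iff[OF sub] by blast
  qed
  show "enc \<one>\<^bsub>?P\<^esub> = \<one>\<^bsub>l1\<^esub>"
    by (simp add: skew_poly_alg_def)
  show "closedin (norm_topology l1) ((\<lambda>f. enc (skew_monom 0 f)) ` carrier (cont_alg X))" (is "closedin _ ?S")
    unfolding l1.closedin_iff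
  proof (intro conjI ballI impI)
    show "?S \<subseteq> carrier l1"
      by (auto simp: poly_series skew_monom_carrier)
    fix a
    assume a: "a \<in> carrier l1" and approx: "\<forall>e>0. \<exists>s\<in>?S. nrm l1 (a \<ominus>\<^bsub>l1\<^esub> s) < e"
    have p: "dec a \<in> series" "a = enc (dec a)"
      using a by auto
    have "dec a n x = 0" if "n \<noteq> 0" for n x
    proof -
      have "cmod (dec a n x) \<le> 0 + e" if "e > 0" for e
      proof -
        obtain f where f: "f \<in> carrier (cont_alg X)" "nrm l1 (a \<ominus>\<^bsub>l1\<^esub> enc (skew_monom 0 f)) < e"
          using approx \<open>e > 0\<close> by blast
        have m: "skew_monom 0 f \<in> series"
          using f(1) by (intro poly_series skew_monom_carrier)
        then have "total (\<lambda>n x. dec a n x - skew_monom 0 f n x) < e"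
          using f(2) dec_minus[OF a, of "enc (skew_monom 0 f)"] by simp
        then have "cmod (dec a n x - skew_monom 0 f n x) \<le> e"
          using coeff_le[OF series_minus[OF p(1) m], of n x] coeff_le_total[OF series_minus[OF p(1) m], of n]
          by linarith
        then show ?thesis
          using \<open>n \<noteq> 0\<close> by (simp add: skew_monom_def)
      qed
      then have "cmod (dec a n x) \<le> 0"
        by (rule field_le_epsilon)
      then show ?thesis
        by simp
    qed
    then have "dec a = skew_monom 0 (dec a 0)"
      by (auto simp: skew_monom_def fun_eq_iff)
    then show "a \<in> ?S"
      using p series_coeff[OF p(1), of 0] by (metis imageI)
  qed
  show "(\<lambda>a. dec a 0) \<in> alg_hom l1 (cont_alg X)"
    by (auto simp: alg_hom_def series_coeff)
  show "dec (enc (skew_monom 0 f)) 0 = f" if "f \<in> carrier (cont_alg X)" for f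
    by (simp add: skew_monom_def)
  show "{a \<in> carrier l1. dec a 0 = \<zero>\<^bsub>cont_alg X\<^esub>} = (\<lambda>b. b \<otimes>\<^bsub>l1\<^esub> enc (skew_U X)) ` carrier l1"
  proof
    show "(\<lambda>b. b \<otimes>\<^bsub>l1\<^esub> enc (skew_U X)) ` carrier l1 \<subseteq> {a \<in> carrier l1. dec a 0 = \<zero>\<^bsub>cont_alg X\<^esub>}"
    proof (intro subsetI)
      fix a
      assume "a \<in> (\<lambda>b. b \<otimes>\<^bsub>l1\<^esub> enc (skew_U X)) ` carrier l1"
      then obtain b where b: "b \<in> carrier l1" "a = b \<otimes>\<^bsub>l1\<^esub> enc (skew_U X)"
        by blast
      moreover have "enc (skew_U X) \<in> carrier l1"
        by (simp add: poly_series skew_U_carrier)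
      ultimately show "a \<in> {a \<in> carrier l1. dec a 0 = \<zero>\<^bsub>cont_alg X\<^esub>}"
        using l1.alg.m_closed[of b "enc (skew_U X)"] mult_U[OF b(1)] by (simp del: l1_simps(1,2))
    qed
    show "{a \<in> carrier l1. dec a 0 = \<zero>\<^bsub>cont_alg X\<^esub>} \<subseteq> (\<lambda>b. b \<otimes>\<^bsub>l1\<^esub> enc (skew_U X)) ` carrier l1"
    proof (intro subsetI)
      fix a
      assume "a \<in> {a \<in> carrier l1. dec a 0 = \<zero>\<^bsub>cont_alg X\<^esub>}"
      then have a: "a \<in> carrier l1" "dec a 0 = (\<lambda>x. 0)"
        by auto
      let ?t = "enc (\<lambda>n. dec a (Suc n))"
      have t: "?t \<in> carrier l1"
        using a tail_series by auto
      have "(\<lambda>n x. if n = 0 then 0 else dec ?t (n - 1) x) = dec a"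
        using a(2) by (auto simp: fun_eq_iff)
      then have "?t \<otimes>\<^bsub>l1\<^esub> enc (skew_U X) = a"
        unfolding mult_U[OF t] using a(1) by auto
      then show "a \<in> (\<lambda>b. b \<otimes>\<^bsub>l1\<^esub> enc (skew_U X)) ` carrier l1"
        by (rule image_eqI[OF sym t])
    qed
  qed
  show "a = \<zero>\<^bsub>l1\<^esub>" if "a \<in> carrier l1" "a \<otimes>\<^bsub>l1\<^esub> enc (skew_U X) = \<zero>\<^bsub>l1\<^esub>" for a
  proof (rule mult_U_cancel_l1)
    show "\<forall>n. dec (a \<otimes>\<^bsub>l1\<^esub> enc (skew_U X)) (Suc n) = dec (\<zero>\<^bsub>l1\<^esub> \<otimes>\<^bsub>l1\<^esub> enc (skew_U X)) (Suc n)"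
      unfolding that(2) by simp
  qed (use that(1) l1.alg.zero_closed in \<open>simp_all del: l1_simps\<close>)
  show "limsup (\<lambda>n. ereal (root n (coeff_onorm X l1 (coeff_map X l1 enc (\<lambda>a. dec a 0) n) *
      nrm l1 (enc (skew_U X) [^]\<^bsub>l1\<^esub> n)))) \<le> 1"
  proof (rule Limsup_bounded, rule always_eventually, rule allI)
    fix n :: nat
    let ?c = "coeff_onorm X l1 (coeff_map X l1 enc (\<lambda>a. dec a 0) n)"
    have "enc (skew_U X) [^]\<^bsub>l1\<^esub> n \<in> carrier l1"
      using poly_series[OF skew_U_carrier] by (intro l1.alg.nat_pow_closed) simp
    then have "?c * nrm l1 (enc (skew_U X) [^]\<^bsub>l1\<^esub> n) \<le> 1 * 1"
      using coeff_onorm_le nrm_U_power_le l1.nrm_nonneg by (intro mult_mono) auto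
    then have "root n (?c * nrm l1 (enc (skew_U X) [^]\<^bsub>l1\<^esub> n)) \<le> 1"
      by (cases "n = 0") (simp_all add: real_root_le_1_iff)
    then show "ereal (root n (?c * nrm l1 (enc (skew_U X) [^]\<^bsub>l1\<^esub> n))) \<le> 1"
      by (simp add: one_ereal_def)
  qed
qed (rule compact Hausdorff continuous)+

text \<open>Vanishing of the coefficients on \<open>K\<close> survives limits, and conversely
  truncation approximates a series within the same class. The explicit carrier is what allows an
  isomorphism to be written down coefficientwise.\<close>

lemma closed_subalgebra_generated_l1:
  assumes "closedin X K" "\<And>x. x \<in> topspace X \<Longrightarrow> \<eta> x \<in> K \<longleftrightarrow> x \<in> K"
  shows "closed_subalgebra_generated l1 (enc ` vanishing_poly X \<eta> K) =
    enc ` {p \<in> series. \<forall>n. p n \<in> vanishing X K}"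
proof -
  interpret conjugacy_ideal X \<eta> l1 enc "\<lambda>a. dec a 0" K
    "closed_subalgebra_generated l1 (enc ` vanishing_poly X \<eta> K)"
    by (intro conjugacy_ideal.intro compact_conjugacy_algebra_l1 conjugacy_ideal_axioms.intro assms refl)
  have diff: "nrm l1 (a \<ominus>\<^bsub>l1\<^esub> enc p) = total (\<lambda>n x. dec a n x - p n x)"
    if "a \<in> carrier l1" "p \<in> series" for a p
    using dec_minus[of a "enc p"] that by simp
  have "a \<in> enc ` {p \<in> series. \<forall>n. p n \<in> vanishing X K}" if "a \<in> V_closure" for a
  proof -
    have a: "a \<in> carrier l1" and approx: "\<forall>e>0. \<exists>v\<in>V. nrm l1 (a \<ominus>\<^bsub>l1\<^esub> v) < e"
      using that unfolding V_closure_iff by auto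
    have p: "dec a \<in> series" "a = enc (dec a)"
      using a by auto
    have "dec a n x = 0" if "x \<in> K" for n x
    proof -
      have "cmod (dec a n x) \<le> 0 + e" if "e > 0" for e
      proof -
        obtain q where q: "q \<in> vanishing_poly X \<eta> K" "nrm l1 (a \<ominus>\<^bsub>l1\<^esub> enc q) < e"
          using approx \<open>e > 0\<close> by blast
        have m: "q \<in> series"
          using q(1) by (intro poly_series vanishing_poly_carrier)
        then have "total (\<lambda>n x. dec a n x - q n x) < e"
          using q(2) by (simp only: diff[OF a])
        then have "cmod (dec a n x - q n x) \<le> e"
          using coeff_le[OF series_minus[OF p(1) m], of n x] coeff_le_total[OF series_minus[OF p(1) m], of n]
          by linarith
        then show ?thesis
          using q(1) \<open>x \<in> K\<close> by (simp add: vanishing_poly_def vanishing_def)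
      qed
      then have "cmod (dec a n x) \<le> 0"
        by (rule field_le_epsilon)
      then show ?thesis
        by simp
    qed
    then have "dec a \<in> {p \<in> series. \<forall>n. p n \<in> vanishing X K}"
      using p(1) by (simp add: vanishing_def series_coeff)
    then have "enc (dec a) \<in> enc ` {p \<in> series. \<forall>n. p n \<in> vanishing X K}"
      by (rule imageI)
    then show ?thesis
      by (simp only: p(2)[symmetric])
  qed
  moreover have "enc p \<in> V_closure" if ps: "p \<in> series" "\<And>n. p n \<in> vanishing X K" for p
    unfolding V_closure_iff
  proof (intro conjI allI impI)
    show p: "enc p \<in> carrier l1"
      using ps by simp
    fix e :: real
    assume "e > 0"
    then obtain M where M: "total (\<lambda>n x. p n x - truncate M p n x) < e"
      using truncate_approx[OF ps(1)] by blast
    have "truncate M p \<in> vanishing_poly X \<eta> K"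
      using truncate_poly[OF ps(1)] ps(2) by (simp add: vanishing_poly_def truncate_def)
    moreover have "nrm l1 (enc p \<ominus>\<^bsub>l1\<^esub> enc (truncate M p)) < e"
      using M diff[OF p poly_series[OF truncate_poly[OF ps(1)]]] by simp
    ultimately show "\<exists>v\<in>V. nrm l1 (enc p \<ominus>\<^bsub>l1\<^esub> v) < e"
      by blast
  qed
  ultimately show ?thesis
    unfolding I_eq_closure by blast
qed

end

section \<open>Conjugate systems have isomorphic algebras\<close>

text \<open>Coefficients of the first system are pulled back along \<open>\<delta>\<close>, so the
  compatibility conditions are stated for \<open>\<delta>\<close>; those for \<open>\<gamma>\<close>
  follow.\<close>

locale conjugate_series =
  S1: summable_series X1 \<eta>1 enc1 dec1 + S2: summable_series X2 \<eta>2 enc2 dec2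
  for X1 :: "'a topology" and \<eta>1 and enc1 :: "(nat \<Rightarrow> 'a \<Rightarrow> complex) \<Rightarrow> 'c" and dec1
    and X2 :: "'b topology" and \<eta>2 and enc2 :: "(nat \<Rightarrow> 'b \<Rightarrow> complex) \<Rightarrow> 'd" and dec2 +
  fixes \<gamma> :: "'a \<Rightarrow> 'b" and \<delta> :: "'b \<Rightarrow> 'a" and K1 :: "'a set" and K2 :: "'b set"
  assumes homeo: "homeomorphic_maps X1 X2 \<gamma> \<delta>"
    and intertwine: "y \<in> topspace X2 \<Longrightarrow> \<delta> (\<eta>2 y) = \<eta>1 (\<delta> y)"
    and K1: "closedin X1 K1" "x \<in> topspace X1 \<Longrightarrow> \<eta>1 x \<in> K1 \<longleftrightarrow> x \<in> K1"
    and K2: "closedin X2 K2" "y \<in> topspace X2 \<Longrightarrow> \<eta>2 y \<in> K2 \<longleftrightarrow> y \<in> K2"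
    and K_iff: "y \<in> topspace X2 \<Longrightarrow> \<delta> y \<in> K1 \<longleftrightarrow> y \<in> K2"
begin

lemma \<gamma>_continuous: "continuous_map X1 X2 \<gamma>" and \<delta>_continuous: "continuous_map X2 X1 \<delta>"
  and \<delta>_\<gamma>: "x \<in> topspace X1 \<Longrightarrow> \<delta> (\<gamma> x) = x" and \<gamma>_\<delta>: "y \<in> topspace X2 \<Longrightarrow> \<gamma> (\<delta> y) = y"
  using homeo by (auto simp: homeomorphic_maps_def)

lemma \<gamma>_topspace: "x \<in> topspace X1 \<Longrightarrow> \<gamma> x \<in> topspace X2"
  and \<delta>_topspace: "y \<in> topspace X2 \<Longrightarrow> \<delta> y \<in> topspace X1"
  using continuous_map_funspace[OF \<gamma>_continuous] continuous_map_funspace[OF \<delta>_continuous] by auto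

lemma intertwine_iter: "y \<in> topspace X2 \<Longrightarrow> \<delta> ((\<eta>2 ^^ k) y) = (\<eta>1 ^^ k) (\<delta> y)"
  by (induction k) (auto simp: intertwine S2.\<eta>_iter_closed)

lemma pullback_series:
  assumes "p \<in> S1.series" "\<And>n. p n \<in> vanishing X1 K1"
  shows "(\<lambda>n. pullback X2 \<delta> (p n)) \<in> S2.series" "pullback X2 \<delta> (p n) \<in> vanishing X2 K2"
proof -
  have p: "p n \<in> carrier (cont_alg X1)" for n
    using assms(1) by (rule S1.series_coeff)
  have pb: "pullback X2 \<delta> (p n) \<in> carrier (cont_alg X2)" for n
    using p \<delta>_continuous by (rule cont_alg_pullback)
  have le: "sup_norm X2 (pullback X2 \<delta> (p n)) \<le> sup_norm X1 (p n)" for n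
    using p S1.compact by (intro sup_norm_le sup_norm_nonneg) (auto intro: le_sup_norm)
  show "(\<lambda>n. pullback X2 \<delta> (p n)) \<in> S2.series"
    by (rule S2.seriesI[OF pb le S1.series_summable[OF assms(1)]])
  show "pullback X2 \<delta> (p n) \<in> vanishing X2 K2"
    using pb[of n] assms(2)[of n] K_iff closedin_subset[OF K2(1)] by (auto simp: vanishing_def)
qed

abbreviation I1 :: "'c set" where
  "I1 \<equiv> closed_subalgebra_generated S1.l1 (enc1 ` vanishing_poly X1 \<eta>1 K1)"

abbreviation I2 :: "'d set" where
  "I2 \<equiv> closed_subalgebra_generated S2.l1 (enc2 ` vanishing_poly X2 \<eta>2 K2)"

lemma I1_eq: "I1 = enc1 ` {p \<in> S1.series. \<forall>n. p n \<in> vanishing X1 K1}"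
  using K1 by (rule S1.closed_subalgebra_generated_l1)

lemma I2_eq: "I2 = enc2 ` {p \<in> S2.series. \<forall>n. p n \<in> vanishing X2 K2}"
  using K2 by (rule S2.closed_subalgebra_generated_l1)

definition pull :: "'c \<Rightarrow> 'd" where
  "pull a = enc2 (\<lambda>n. pullback X2 \<delta> (dec1 a n))"

lemma pull_closed: "a \<in> I1 \<Longrightarrow> pull a \<in> I2"
  using pullback_series unfolding I1_eq I2_eq by (auto simp: pull_def)

lemma pull_hom: "pull \<in> alg_hom (S1.l1\<lparr>carrier := I1\<rparr>) (S2.l1\<lparr>carrier := I2\<rparr>)"
proof -
  have "pullback X2 \<delta> (\<lambda>x. \<Sum>k\<le>n. p k x * q (n - k) ((\<eta>1 ^^ k) x)) =
      (\<lambda>y. \<Sum>k\<le>n. pullback X2 \<delta> (p k) y * pullback X2 \<delta> (q (n - k)) ((\<eta>2 ^^ k) y))" for p q n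
    by (auto simp: pullback_def fun_eq_iff intertwine_iter S2.\<eta>_iter_closed)
  moreover have "pullback X2 \<delta> (\<lambda>x. f x + g x) = (\<lambda>y. pullback X2 \<delta> f y + pullback X2 \<delta> g y)"
    "pullback X2 \<delta> (\<lambda>x. c * f x) = (\<lambda>y. c * pullback X2 \<delta> f y)" for f g c
    by (auto simp: pullback_def fun_eq_iff)
  ultimately show ?thesis
    using pull_closed by (simp add: alg_hom_def pull_def)
qed

lemma swapped: "conjugate_series X2 \<eta>2 enc2 dec2 X1 \<eta>1 enc1 dec1 \<delta> \<gamma> K2 K1"
proof (intro conjugate_series.intro S1.summable_series_axioms S2.summable_series_axioms
    conjugate_series_axioms.intro K1 K2)
  show "homeomorphic_maps X2 X1 \<delta> \<gamma>"
    using homeo by (auto simp: homeomorphic_maps_def)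
  fix x
  assume x: "x \<in> topspace X1"
  have "\<delta> (\<eta>2 (\<gamma> x)) = \<eta>1 x"
    using x by (simp add: intertwine \<gamma>_topspace \<delta>_\<gamma>)
  then show "\<gamma> (\<eta>1 x) = \<eta>2 (\<gamma> x)"
    using \<gamma>_\<delta>[of "\<eta>2 (\<gamma> x)"] x S2.\<eta>_iter_closed[of "\<gamma> x" 1] by (simp add: \<gamma>_topspace)
  show "\<gamma> x \<in> K2 \<longleftrightarrow> x \<in> K1"
    using K_iff[of "\<gamma> x"] x by (simp add: \<gamma>_topspace \<delta>_\<gamma>)
qed

end

context conjugate_series
begin

interpretation T: conjugate_series X2 \<eta>2 enc2 dec2 X1 \<eta>1 enc1 dec1 \<delta> \<gamma> K2 K1
  by (rule swapped)

lemma pull_pull: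
  assumes "a \<in> I1"
  shows "T.pull (pull a) = a"
proof -
  obtain p where p: "a = enc1 p" "p \<in> S1.series"
    using assms unfolding I1_eq by auto
  have "pullback X1 \<gamma> (pullback X2 \<delta> (p n)) = p n" for n
    using S1.series_coeff[OF p(2), of n]
    by (auto simp: pullback_def fun_eq_iff cont_alg_iff \<delta>_\<gamma> \<gamma>_topspace)
  then show ?thesis
    by (simp add: pull_def T.pull_def p(1))
qed

lemma isomorphic: "alg_isomorphic (S1.l1\<lparr>carrier := I1\<rparr>) (S2.l1\<lparr>carrier := I2\<rparr>)"
proof -
  have "pull (T.pull b) = b" if "b \<in> I2" for b
    using that by (rule conjugate_series.pull_pull[OF swapped])
  then have "bij_betw pull I1 I2"
    using pull_pull pull_closed T.pull_closed by (intro bij_betwI[of _ _ _ T.pull]) auto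
  then show ?thesis
    unfolding alg_isomorphic_def using pull_hom by (intro bexI[of _ pull]) auto
qed

end

section \<open>One-point compactifications\<close>

text \<open>Continuity at the added point is where properness enters: neighbourhoods of
  \<open>None\<close> are complements of closed compact sets, whose preimages have to be
  compact.\<close>

lemma continuous_map_Alexandroff:
  assumes h: "continuous_map X Y h" and proper: "proper_map X Y h"
  shows "continuous_map (Alexandroff_compactification X) (Alexandroff_compactification Y) (map_option h)"
  unfolding continuous_map_def
proof (intro conjI allI impI)
  show "map_option h \<in> topspace (Alexandroff_compactification X) \<rightarrow>
      topspace (Alexandroff_compactification Y)"
    using continuous_map_funspace[OF h] by auto
  fix W
  assume "openin (Alexandroff_compactification Y) W"
  then consider U where "openin Y U" "W = Some ` U"
    | C where "compactin Y C" "closedin Y C" "W = insert None (Some ` (topspace Y - C))"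
    unfolding openin_Alexandroff_compactification by blast
  then show "openin (Alexandroff_compactification X)
      {x \<in> topspace (Alexandroff_compactification X). map_option h x \<in> W}"
  proof cases
    case 1
    have "{x \<in> topspace (Alexandroff_compactification X). map_option h x \<in> W} =
        Some ` {x \<in> topspace X. h x \<in> U}"
      using 1 by auto
    then show ?thesis
      using openin_continuous_map_preimage[OF h 1(1)] by simp
  next
    case 2
    let ?C = "{x \<in> topspace X. h x \<in> C}"
    have "{x \<in> topspace (Alexandroff_compactification X). map_option h x \<in> W} =
        insert None (Some ` (topspace X - ?C))"
      using 2 continuous_map_funspace[OF h] by auto
    moreover have "compactin X ?C" "closedin X ?C"
      using compactin_proper_map_preimage[OF proper 2(1)] closedin_continuous_map_preimage[OF h 2(2)]
      by auto
    ultimately show ?thesis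
      unfolding openin_Alexandroff_compactification by blast
  qed
qed

lemma homeomorphic_maps_Alexandroff:
  assumes "homeomorphic_maps X Y \<gamma> \<delta>"
  shows "homeomorphic_maps (Alexandroff_compactification X) (Alexandroff_compactification Y)
    (map_option \<gamma>) (map_option \<delta>)"
proof -
  have "homeomorphic_map X Y \<gamma>" "homeomorphic_map Y X \<delta>"
    using assms homeomorphic_maps_map by blast+
  then have "proper_map X Y \<gamma>" "proper_map Y X \<delta>"
    by (simp_all add: homeomorphic_imp_proper_map)
  then show ?thesis
    using assms unfolding homeomorphic_maps_def
    by (auto simp: continuous_map_Alexandroff)
qed

section \<open>Models on compact spaces\<close>

lemma conjugate_systems_inverse:
  assumes "conjugate_systems X \<eta> Y \<theta>" and \<eta>: "\<eta> \<in> topspace X \<rightarrow> topspace X"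
  obtains \<gamma> \<delta> where "homeomorphic_maps X Y \<gamma> \<delta>" "\<And>y. y \<in> topspace Y \<Longrightarrow> \<delta> (\<theta> y) = \<eta> (\<delta> y)"
proof -
  obtain \<gamma> where \<gamma>: "homeomorphic_map X Y \<gamma>" and eq: "\<forall>x\<in>topspace X. \<gamma> (\<eta> x) = \<theta> (\<gamma> x)"
    using assms(1) by (auto simp: conjugate_systems_def)
  then obtain \<delta> where \<delta>: "homeomorphic_maps X Y \<gamma> \<delta>"
    by (auto simp: homeomorphic_map_maps)
  have "\<delta> (\<theta> y) = \<eta> (\<delta> y)" if "y \<in> topspace Y" for y
  proof -
    have "\<delta> y \<in> topspace X" "\<gamma> (\<delta> y) = y"
      using \<delta> that by (auto simp: homeomorphic_maps_def continuous_map_def)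
    then have "\<theta> y = \<gamma> (\<eta> (\<delta> y))"
      using eq by auto
    moreover have "\<eta> (\<delta> y) \<in> topspace X"
      using \<eta> \<open>\<delta> y \<in> topspace X\<close> by auto
    ultimately show ?thesis
      using \<delta> by (auto simp: homeomorphic_maps_def)
  qed
  with \<delta> show ?thesis
    using that by blast
qed

lemma conjugate_systems_sym:
  assumes "conjugate_systems X \<eta> Y \<theta>" "\<eta> \<in> topspace X \<rightarrow> topspace X"
  shows "conjugate_systems Y \<theta> X \<eta>"
proof -
  obtain \<gamma> \<delta> where "homeomorphic_maps X Y \<gamma> \<delta>" "\<And>y. y \<in> topspace Y \<Longrightarrow> \<delta> (\<theta> y) = \<eta> (\<delta> y)"
    using conjugate_systems_inverse[OF assms] by blast
  moreover from this(1) have "homeomorphic_map Y X \<delta>"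
    using homeomorphic_maps_map by blast
  ultimately show ?thesis
    by (auto simp: conjugate_systems_def)
qed

lemma conjugate_systems_trans:
  assumes "conjugate_systems X \<eta> Y \<theta>" "conjugate_systems Y \<theta> Z \<zeta>"
  shows "conjugate_systems X \<eta> Z \<zeta>"
proof -
  obtain \<alpha> \<beta> where \<alpha>: "homeomorphic_map X Y \<alpha>" "\<forall>x\<in>topspace X. \<alpha> (\<eta> x) = \<theta> (\<alpha> x)"
    and \<beta>: "homeomorphic_map Y Z \<beta>" "\<forall>y\<in>topspace Y. \<beta> (\<theta> y) = \<zeta> (\<beta> y)"
    using assms by (auto simp: conjugate_systems_def)
  have "\<alpha> x \<in> topspace Y" if "x \<in> topspace X" for x
    using homeomorphic_imp_surjective_map[OF \<alpha>(1)] that by auto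
  then show ?thesis
    unfolding conjugate_systems_def
    using \<alpha> \<beta> homeomorphic_map_compose[OF \<alpha>(1) \<beta>(1)] by (intro exI[of _ "\<beta> \<circ> \<alpha>"]) auto
qed

text \<open>A common form for compact and non-compact systems. It puts them on an equal footing when
  two algebras are compared, so that one space being compact and the other not is covered by the
  same argument.\<close>

definition ideal_model ::
  "'a topology \<Rightarrow> ('a \<Rightarrow> 'a) \<Rightarrow> 'c normed_alg \<Rightarrow> 'b topology \<Rightarrow> ('b \<Rightarrow> 'b) \<Rightarrow> 'b set \<Rightarrow> bool" where
  "ideal_model X \<eta> A Z \<zeta> K \<longleftrightarrow>
    (\<exists>B \<iota> E0 I. conjugacy_ideal Z \<zeta> B \<iota> E0 K I \<and> A = B\<lparr>carrier := I\<rparr>) \<and>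
    conjugate_systems X \<eta> (subtopology Z (topspace Z - K)) \<zeta>"

lemma ideal_model_compact:
  assumes "compact_conjugacy_algebra X \<eta> A \<iota> E0"
  shows "ideal_model X \<eta> A X \<eta> {}"
proof -
  interpret compact_conjugacy_algebra X \<eta> A \<iota> E0
    by fact
  interpret conjugacy_ideal X \<eta> A \<iota> E0 "{}" "closed_subalgebra_generated A (\<iota> ` vanishing_poly X \<eta> {})"
    by unfold_locales auto
  have "closed_subalgebra_generated A (\<iota> ` vanishing_poly X \<eta> {}) = carrier A"
    unfolding I_eq_closure by (simp add: vanishing_poly_empty incl_dense)
  then have "A = A\<lparr>carrier := closed_subalgebra_generated A (\<iota> ` vanishing_poly X \<eta> {})\<rparr>"
    by simp
  then show ?thesis
    unfolding ideal_model_def conjugate_systems_def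
    using conjugacy_ideal_axioms by (auto intro!: exI[of _ id] exI[of _ A])
qed

lemma ideal_model_Alexandroff:
  assumes "compact_conjugacy_algebra (Alexandroff_compactification X) (map_option \<eta>) B \<iota> E0"
  shows "ideal_model X \<eta> (B\<lparr>carrier := closed_subalgebra_generated B (\<iota> ` vanishing_polys X \<eta>)\<rparr>)
    (Alexandroff_compactification X) (map_option \<eta>) {None}"
proof -
  let ?Z = "Alexandroff_compactification X"
  interpret compact_conjugacy_algebra ?Z "map_option \<eta>" B \<iota> E0
    by fact
  have "conjugacy_ideal ?Z (map_option \<eta>) B \<iota> E0 {None}
      (closed_subalgebra_generated B (\<iota> ` vanishing_polys X \<eta>))"
    unfolding vanishing_polys_eq
    by unfold_locales (auto simp: Hausdorff closedin_Hausdorff_singleton)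
  moreover have "topspace ?Z - {None} = Some ` topspace X"
    by auto
  then have "homeomorphic_map X (subtopology ?Z (topspace ?Z - {None})) Some"
    using embedding_map_Some[of X] by (simp add: embedding_map_def)
  ultimately show ?thesis
    unfolding ideal_model_def conjugate_systems_def by auto
qed

lemma conjugate_if_isomorphic_models:
  assumes model1: "ideal_model X1 \<eta>1 A1 Z1 \<zeta>1 K1" and model2: "ideal_model X2 \<eta>2 A2 Z2 \<zeta>2 K2"
    and iso: "alg_isomorphic A1 A2" and \<eta>2: "\<eta>2 \<in> topspace X2 \<rightarrow> topspace X2"
  shows "conjugate_systems X1 \<eta>1 X2 \<eta>2"
proof -
  let ?Y1 = "subtopology Z1 (topspace Z1 - K1)" and ?Y2 = "subtopology Z2 (topspace Z2 - K2)"
  obtain B1 \<iota>1 E1 I1 where ideal1: "conjugacy_ideal Z1 \<zeta>1 B1 \<iota>1 E1 K1 I1" "A1 = B1\<lparr>carrier := I1\<rparr>"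
    and conj1: "conjugate_systems X1 \<eta>1 ?Y1 \<zeta>1"
    using model1 unfolding ideal_model_def by blast
  obtain B2 \<iota>2 E2 I2 where ideal2: "conjugacy_ideal Z2 \<zeta>2 B2 \<iota>2 E2 K2 I2" "A2 = B2\<lparr>carrier := I2\<rparr>"
    and conj2: "conjugate_systems X2 \<eta>2 ?Y2 \<zeta>2"
    using model2 unfolding ideal_model_def by blast
  interpret L1: conjugacy_ideal Z1 \<zeta>1 B1 \<iota>1 E1 K1 I1
    by (rule ideal1)
  obtain \<phi> where \<phi>: "\<phi> \<in> alg_hom A1 A2" "bij_betw \<phi> I1 I2"
    using iso ideal1(2) ideal2(2) by (auto simp: alg_isomorphic_def)
  define \<psi> where "\<psi> = inv_into I1 \<phi>"
  have \<psi>_\<phi>: "\<psi> (\<phi> a) = a" if "a \<in> I1" for a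
    using \<phi>(2) that by (simp add: \<psi>_def bij_betw_def)
  have \<phi>_\<psi>: "\<phi> (\<psi> b) = b" and \<psi>_closed: "\<psi> b \<in> I1" if "b \<in> I2" for b
    using \<phi>(2) that by (auto simp: \<psi>_def bij_betw_def intro: f_inv_into_f inv_into_into)
  have \<phi>_closed: "\<phi> a \<in> I2" if "a \<in> I1" for a
    using \<phi>(2) that by (auto simp: bij_betw_def)
  have \<phi>_hom: "\<phi> (a \<oplus>\<^bsub>B1\<^esub> b) = \<phi> a \<oplus>\<^bsub>B2\<^esub> \<phi> b" "\<phi> (a \<otimes>\<^bsub>B1\<^esub> b) = \<phi> a \<otimes>\<^bsub>B2\<^esub> \<phi> b"
    "\<phi> (c \<odot>\<^bsub>B1\<^esub> a) = c \<odot>\<^bsub>B2\<^esub> \<phi> a" if "a \<in> I1" "b \<in> I1" for a b c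
    using \<phi>(1) that by (simp_all add: alg_hom_def ideal1(2) ideal2(2))
  have "\<psi> \<in> alg_hom A2 A1"
  proof -
    have "\<psi> (b \<oplus>\<^bsub>B2\<^esub> b') = \<psi> b \<oplus>\<^bsub>B1\<^esub> \<psi> b'" "\<psi> (b \<otimes>\<^bsub>B2\<^esub> b') = \<psi> b \<otimes>\<^bsub>B1\<^esub> \<psi> b'"
      "\<psi> (c \<odot>\<^bsub>B2\<^esub> b) = c \<odot>\<^bsub>B1\<^esub> \<psi> b" if b: "b \<in> I2" "b' \<in> I2" for b b' c
    proof -
      note c = \<psi>_closed[OF b(1)] \<psi>_closed[OF b(2)]
      note hom = \<phi>_hom[OF c]
      show "\<psi> (b \<oplus>\<^bsub>B2\<^esub> b') = \<psi> b \<oplus>\<^bsub>B1\<^esub> \<psi> b'"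
        using hom(1) \<psi>_\<phi>[OF L1.I_add[OF c]] b by (simp add: \<phi>_\<psi>)
      show "\<psi> (b \<otimes>\<^bsub>B2\<^esub> b') = \<psi> b \<otimes>\<^bsub>B1\<^esub> \<psi> b'"
        using hom(2) \<psi>_\<phi>[OF L1.I_mult_left[OF L1.I_carrier[OF c(1)] c(2)]] b by (simp add: \<phi>_\<psi>)
      show "\<psi> (c \<odot>\<^bsub>B2\<^esub> b) = c \<odot>\<^bsub>B1\<^esub> \<psi> b"
        using hom(3)[of c] \<psi>_\<phi>[OF L1.I_smult[OF c(1), of c]] b by (simp add: \<phi>_\<psi>)
    qed
    then show ?thesis
      using \<psi>_closed by (simp add: alg_hom_def ideal1(2) ideal2(2))
  qed
  then interpret isomorphic_ideals Z1 \<zeta>1 B1 \<iota>1 E1 K1 I1 Z2 \<zeta>2 B2 \<iota>2 E2 K2 I2 \<phi> \<psi>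
    using \<phi>(1) \<psi>_\<phi> \<phi>_\<psi> ideal1 ideal2
    by (intro isomorphic_ideals.intro isomorphic_ideals_axioms.intro) auto
  have "conjugate_systems ?Y1 \<zeta>1 ?Y2 \<zeta>2"
    unfolding conjugate_systems_def using homeomorphic_map_dual dual_intertwines by auto
  moreover have "conjugate_systems ?Y2 \<zeta>2 X2 \<eta>2"
    using conj2 \<eta>2 by (rule conjugate_systems_sym)
  ultimately have "conjugate_systems ?Y1 \<zeta>1 X2 \<eta>2"
    by (rule conjugate_systems_trans)
  with conj1 show ?thesis
    by (rule conjugate_systems_trans)
qed

lemma ideal_model_if_conjugacy_algebra:
  assumes "topological_conjugacy_algebra X \<eta> A"
  shows "ideal_model X \<eta> A X \<eta> {} \<or>
    ideal_model X \<eta> A (Alexandroff_compactification X) (map_option \<eta>) {None}"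
proof (cases "compact_space X")
  case True
  then obtain \<iota> E0 where "compact_conjugacy_algebra X \<eta> A \<iota> E0"
    using assms by (auto simp: topological_conjugacy_algebra_def)
  then show ?thesis
    by (intro disjI1 ideal_model_compact)
next
  case False
  then obtain B \<iota> E0 where
    "compact_conjugacy_algebra (Alexandroff_compactification X) (map_option \<eta>) B \<iota> E0"
    "A = B\<lparr>carrier := closed_subalgebra_generated B (\<iota> ` vanishing_polys X \<eta>)\<rparr>"
    using assms by (auto simp: topological_conjugacy_algebra_def)
  then show ?thesis
    using ideal_model_Alexandroff by blast
qed

text \<open>All four combinations of compact and non-compact spaces are instances of the statement
  for models; compactness of one is carried to the other by the conclusion.\<close>

lemma conjugate_if_isomorphic:
  assumes A1: "topological_conjugacy_algebra X1 \<eta>1 A1" and A2: "topological_conjugacy_algebra X2 \<eta>2 A2"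
    and iso: "alg_isomorphic A1 A2" and "continuous_map X2 X2 \<eta>2"
  shows "conjugate_systems X1 \<eta>1 X2 \<eta>2"
proof -
  have \<eta>2: "\<eta>2 \<in> topspace X2 \<rightarrow> topspace X2"
    using assms(4) by (simp add: continuous_map_def)
  note conj = conjugate_if_isomorphic_models[OF _ _ iso \<eta>2]
  show ?thesis
    using ideal_model_if_conjugacy_algebra[OF A1] ideal_model_if_conjugacy_algebra[OF A2]
    by (elim disjE) (rule conj, assumption+)+
qed

text \<open>A space that is already compact has no added point, so the value at \<open>None\<close>
  is filled with 0. The first index of the carrier type is a dummy: the encoded sequence is constant
  in it.\<close>

definition encode_some :: "(nat \<Rightarrow> 'a \<Rightarrow> complex) \<Rightarrow> 'a seq_carrier" where
  "encode_some p = (\<lambda>k n. case_option 0 (p n))"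

definition decode_some :: "'a seq_carrier \<Rightarrow> nat \<Rightarrow> 'a \<Rightarrow> complex" where
  "decode_some s = (\<lambda>n x. s 0 n (Some x))"

definition encode_option :: "(nat \<Rightarrow> 'a option \<Rightarrow> complex) \<Rightarrow> 'a seq_carrier" where
  "encode_option p = (\<lambda>k. p)"

definition decode_option :: "'a seq_carrier \<Rightarrow> nat \<Rightarrow> 'a option \<Rightarrow> complex" where
  "decode_option s = s 0"

lemma isomorphic_if_conjugate:
  fixes X1 :: "'a topology" and X2 :: "'b topology"
  assumes X1: "locally_compact_space X1" "Hausdorff_space X1" "continuous_map X1 X1 \<eta>1" "proper_map X1 X1 \<eta>1"
    and X2: "locally_compact_space X2" "Hausdorff_space X2" "continuous_map X2 X2 \<eta>2" "proper_map X2 X2 \<eta>2"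
    and conj: "conjugate_systems X1 \<eta>1 X2 \<eta>2"
  obtains A1 :: "'a seq_carrier normed_alg" and A2 :: "'b seq_carrier normed_alg"
  where "topological_conjugacy_algebra X1 \<eta>1 A1" "topological_conjugacy_algebra X2 \<eta>2 A2"
    "alg_isomorphic A1 A2"
proof -
  have "\<eta>1 \<in> topspace X1 \<rightarrow> topspace X1"
    using X1(3) by (simp add: continuous_map_def)
  then obtain \<gamma> \<delta> where homeo: "homeomorphic_maps X1 X2 \<gamma> \<delta>"
    and intertwine: "\<And>y. y \<in> topspace X2 \<Longrightarrow> \<delta> (\<eta>2 y) = \<eta>1 (\<delta> y)"
    using conjugate_systems_inverse[OF conj] by blast
  have compact_iff: "compact_space X1 \<longleftrightarrow> compact_space X2"
    using homeo homeomorphic_compact_space homeomorphic_space_def by blast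
  show ?thesis
  proof (cases "compact_space X1")
    case True
    interpret conjugate_series X1 \<eta>1 encode_some decode_some X2 \<eta>2 encode_some decode_some \<gamma> \<delta> "{}" "{}"
      using X1 X2 True compact_iff homeo intertwine
      by unfold_locales (simp_all add: encode_some_def decode_some_def)
    \<comment> \<open>For empty \<open>K\<close> the vanishing condition is void and the ideal is
      the whole algebra.\<close>
    have "S1.l1\<lparr>carrier := I1\<rparr> = S1.l1" "S2.l1\<lparr>carrier := I2\<rparr> = S2.l1"
      unfolding I1_eq I2_eq
      by (simp_all add: S1.l1_def S2.l1_def S1.series_coeff S2.series_coeff cong: conj_cong)
    then have "alg_isomorphic S1.l1 S2.l1"
      using isomorphic by simp
    moreover have "topological_conjugacy_algebra X1 \<eta>1 S1.l1" "topological_conjugacy_algebra X2 \<eta>2 S2.l1"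
      using True compact_iff S1.compact_conjugacy_algebra_l1 S2.compact_conjugacy_algebra_l1
      by (auto simp: topological_conjugacy_algebra_def)
    ultimately show ?thesis
      using that by blast
  next
    case False
    interpret conjugate_series "Alexandroff_compactification X1" "map_option \<eta>1" encode_option decode_option
      "Alexandroff_compactification X2" "map_option \<eta>2" encode_option decode_option
      "map_option \<gamma>" "map_option \<delta>" "{None}" "{None}"
    proof (intro conjugate_series.intro summable_series.intro conjugate_series_axioms.intro)
      show "homeomorphic_maps (Alexandroff_compactification X1) (Alexandroff_compactification X2)
          (map_option \<gamma>) (map_option \<delta>)"
        using homeo by (rule homeomorphic_maps_Alexandroff)
      show "closedin (Alexandroff_compactification X1) {None}"
        using X1 by (simp add: closedin_Hausdorff_singleton Hausdorff_space_Alexandroff_compactification)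
      show "closedin (Alexandroff_compactification X2) {None}"
        using X2 by (simp add: closedin_Hausdorff_singleton Hausdorff_space_Alexandroff_compactification)
    qed (use X1 X2 intertwine in \<open>auto simp: Hausdorff_space_Alexandroff_compactification
        continuous_map_Alexandroff encode_option_def decode_option_def\<close>)
    have "topological_conjugacy_algebra X1 \<eta>1 (S1.l1\<lparr>carrier := I1\<rparr>)"
      "topological_conjugacy_algebra X2 \<eta>2 (S2.l1\<lparr>carrier := I2\<rparr>)"
      using False compact_iff S1.compact_conjugacy_algebra_l1 S2.compact_conjugacy_algebra_l1
      unfolding topological_conjugacy_algebra_def vanishing_polys_eq by auto
    then show ?thesis
      using that isomorphic by blast
  qed
qed

text \<open>The second conjunct frees the converse from the prescribed carrier types: isomorphic
  conjugacy algebras on arbitrary types force the systems to be conjugate.\<close>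

theorem theorem4p6:
  fixes X1 :: "'a topology" and \<eta>1 :: "'a \<Rightarrow> 'a"
    and X2 :: "'b topology" and \<eta>2 :: "'b \<Rightarrow> 'b"
  assumes "locally_compact_space X1" "Hausdorff_space X1"
    and "continuous_map X1 X1 \<eta>1" "proper_map X1 X1 \<eta>1"
    and "locally_compact_space X2" "Hausdorff_space X2"
    and "continuous_map X2 X2 \<eta>2" "proper_map X2 X2 \<eta>2"
  shows "(conjugate_systems X1 \<eta>1 X2 \<eta>2 \<longleftrightarrow>
      (\<exists>(A1 :: 'a seq_carrier normed_alg) (A2 :: 'b seq_carrier normed_alg).
         topological_conjugacy_algebra X1 \<eta>1 A1 \<and>
         topological_conjugacy_algebra X2 \<eta>2 A2 \<and>
         alg_isomorphic A1 A2)) \<and>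
    (\<forall>(B1 :: 'c normed_alg) (B2 :: 'd normed_alg).
       topological_conjugacy_algebra X1 \<eta>1 B1 \<and>
       topological_conjugacy_algebra X2 \<eta>2 B2 \<and>
       alg_isomorphic B1 B2 \<longrightarrow> conjugate_systems X1 \<eta>1 X2 \<eta>2)"
proof (intro conjI iffI allI impI)
  assume "conjugate_systems X1 \<eta>1 X2 \<eta>2"
  then show "\<exists>(A1 :: 'a seq_carrier normed_alg) (A2 :: 'b seq_carrier normed_alg).
      topological_conjugacy_algebra X1 \<eta>1 A1 \<and>
      topological_conjugacy_algebra X2 \<eta>2 A2 \<and> alg_isomorphic A1 A2"
    using isomorphic_if_conjugate[OF assms] by blast
next
  assume "\<exists>(A1 :: 'a seq_carrier normed_alg) (A2 :: 'b seq_carrier normed_alg).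
      topological_conjugacy_algebra X1 \<eta>1 A1 \<and>
      topological_conjugacy_algebra X2 \<eta>2 A2 \<and> alg_isomorphic A1 A2"
  then show "conjugate_systems X1 \<eta>1 X2 \<eta>2"
    using conjugate_if_isomorphic assms(7) by blast
next
  fix B1 :: "'c normed_alg" and B2 :: "'d normed_alg"
  assume "topological_conjugacy_algebra X1 \<eta>1 B1 \<and>
      topological_conjugacy_algebra X2 \<eta>2 B2 \<and> alg_isomorphic B1 B2"
  then show "conjugate_systems X1 \<eta>1 X2 \<eta>2"
    using conjugate_if_isomorphic assms(7) by blast
qed

end
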